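(* Let $\mathsf{R}$ be a principal ideal domain with field of fractions $\mathsf{k}$. The square of PROP morphisms with top edge $[\kappa_1,\kappa_2]:\mathsf{Mat}\,\mathsf{R}+(\mathsf{Mat}\,\mathsf{R})^{op}\to\mathsf{Span}(\mathsf{Mat}\,\mathsf{R})$, left edge $[\iota_1,\iota_2]:\mathsf{Mat}\,\mathsf{R}+(\mathsf{Mat}\,\mathsf{R})^{op}\to\mathsf{Cospan}(\mathsf{Mat}\,\mathsf{R})$, right edge $\Phi:\mathsf{Span}(\mathsf{Mat}\,\mathsf{R})\to\mathbb{SV}_{\mathsf{k}}$ and bottom edge $\Psi:\mathsf{Cospan}(\mathsf{Mat}\,\mathsf{R})\to\mathbb{SV}_{\mathsf{k}}$ is a pushout in the category $\mathbf{PROP}$ of PROPs.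
   Context: A PROP is a strict symmetric monoidal category whose objects are the natural numbers and whose monoidal product $\oplus$ on objects is addition. Morphisms of PROPs are identity-on-objects strict symmetric monoidal functors; $\mathbf{PROP}$ is the resulting category and $+$ denotes its coproduct. Composition is in diagrammatic order $f;g$. $\mathsf{Mat}\,\mathsf{R}$ is the PROP whose arrows $n\to m$ are $m\times n$ matrices over $\mathsf{R}$, with $A;B$ the matrix product $BA$, $A\oplus B$ block-diagonal, and permutation matrices as symmetries. Since $\mathsf{R}$ is a PID it has pullbacks and pushouts. $\mathsf{Span}(\mathsf{Mat}\,\mathsf{R})$ (resp. $\mathsf{Cospan}(\mathsf{Mat}\,\mathsf{R})$) is the PROP whose arrows $n\to m$ are isomorphism classes of spans $n\leftarrow z\to m$ (resp. cospans $n\to z\leftarrow m$) in $\mathsf{Mat}\,\mathsf{R}$, composed by pullback (resp. pushout), with $\oplus$ inherited from $\mathsf{Mat}\,\mathsf{R}$. $\mathbb{SV}_{\mathsf{k}}$ is the PROP whose arrows $n\to m$ are $\mathsf{k}$-linear subspaces of $\mathsf{k}^n\times\mathsf{k}^m$, with relational composition, direct sum as $\oplus$, and symmetry $n+m\to m+n$ given by $\{(\binom{\mathbf{x}}{\mathbf{y}},\binom{\mathbf{y}}{\mathbf{x}}):\mathbf{x}\in\mathsf{k}^n,\mathbf{y}\in\mathsf{k}^m\}$. The morphisms are: for $A:n\to m$ in $\mathsf{Mat}\,\mathsf{R}$, $\kappa_1(A)=(n\xleftarrow{\mathrm{id}}n\xrightarrow{A}m)$ and $\iota_1(A)=(n\xrightarrow{A}m\xleftarrow{\mathrm{id}}m)$;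 for $A:n\to m$ in $(\mathsf{Mat}\,\mathsf{R})^{op}$ (i.e. a matrix $A:m\to n$ in $\mathsf{Mat}\,\mathsf{R}$), $\kappa_2(A)=(n\xleftarrow{A}m\xrightarrow{\mathrm{id}}m)$ and $\iota_2(A)=(n\xrightarrow{\mathrm{id}}n\xleftarrow{A}m)$; $\Phi(n\xleftarrow{A}z\xrightarrow{B}m)=\{(\mathbf{x},\mathbf{y}):\mathbf{x}\in\mathsf{k}^n,\mathbf{y}\in\mathsf{k}^m,\exists\mathbf{z}\in\mathsf{k}^z.\ A\mathbf{z}=\mathbf{x}\wedge B\mathbf{z}=\mathbf{y}\}$; $\Psi(n\xrightarrow{A}z\xleftarrow{B}m)=\{(\mathbf{x},\mathbf{y}):\mathbf{x}\in\mathsf{k}^n,\mathbf{y}\in\mathsf{k}^m,A\mathbf{x}=B\mathbf{y}\}$. *)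

theory Defs
  imports
    "Jordan_Normal_Form.VS_Connect"
    "HOL-Algebra.Ring_Divisibility"
    "HOL-Computational_Algebra.Polynomial_Factorial"
begin

section \<open>PROPs and their morphisms\<close>

text \<open>
  The objects are the natural numbers, so a PROP is given by its set of arrows.  All operations are
  total functions, constrained only on \<open>arr\<close>; composition \<open>seq\<close> is in diagrammatic order, and
  \<open>swp n m : n + m \<rightarrow> m + n\<close> is the symmetry.
\<close>

record 'a prop_data =
  arr :: "'a set"
  src :: "'a \<Rightarrow> nat"
  tgt :: "'a \<Rightarrow> nat"
  idn :: "nat \<Rightarrow> 'a"
  seq :: "'a \<Rightarrow> 'a \<Rightarrow> 'a"
  tns :: "'a \<Rightarrow> 'a \<Rightarrow> 'a"
  swp :: "nat \<Rightarrow> nat \<Rightarrow> 'a"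

locale is_prop =
  fixes P :: "'a prop_data"
  assumes idn_arr: "idn P n \<in> arr P" "src P (idn P n) = n" "tgt P (idn P n) = n"
    and seq_arr: "\<lbrakk>f \<in> arr P; g \<in> arr P; tgt P f = src P g\<rbrakk> \<Longrightarrow> seq P f g \<in> arr P"
      "\<lbrakk>f \<in> arr P; g \<in> arr P; tgt P f = src P g\<rbrakk> \<Longrightarrow> src P (seq P f g) = src P f"
      "\<lbrakk>f \<in> arr P; g \<in> arr P; tgt P f = src P g\<rbrakk> \<Longrightarrow> tgt P (seq P f g) = tgt P g"
    and seq_assoc: "\<lbrakk>f \<in> arr P; g \<in> arr P; h \<in> arr P; tgt P f = src P g; tgt P g = src P h\<rbrakk>
      \<Longrightarrow> seq P (seq P f g) h = seq P f (seq P g h)"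
    and seq_idn: "f \<in> arr P \<Longrightarrow> seq P (idn P (src P f)) f = f"
      "f \<in> arr P \<Longrightarrow> seq P f (idn P (tgt P f)) = f"
    and tns_arr: "\<lbrakk>f \<in> arr P; g \<in> arr P\<rbrakk> \<Longrightarrow> tns P f g \<in> arr P"
      "\<lbrakk>f \<in> arr P; g \<in> arr P\<rbrakk> \<Longrightarrow> src P (tns P f g) = src P f + src P g"
      "\<lbrakk>f \<in> arr P; g \<in> arr P\<rbrakk> \<Longrightarrow> tgt P (tns P f g) = tgt P f + tgt P g"
    and tns_idn: "tns P (idn P n) (idn P m) = idn P (n + m)"
    and tns_seq: "\<lbrakk>f \<in> arr P; g \<in> arr P; f' \<in> arr P; g' \<in> arr P; tgt P f = src P g; tgt P f' = src P g'\<rbrakk>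
      \<Longrightarrow> tns P (seq P f g) (seq P f' g') = seq P (tns P f f') (tns P g g')"
    and tns_assoc: "\<lbrakk>f \<in> arr P; g \<in> arr P; h \<in> arr P\<rbrakk> \<Longrightarrow> tns P (tns P f g) h = tns P f (tns P g h)"
    and tns_unit: "f \<in> arr P \<Longrightarrow> tns P (idn P 0) f = f" "f \<in> arr P \<Longrightarrow> tns P f (idn P 0) = f"
    and swp_arr: "swp P n m \<in> arr P" "src P (swp P n m) = n + m" "tgt P (swp P n m) = m + n"
    and swp_natural: "\<lbrakk>f \<in> arr P; g \<in> arr P\<rbrakk> \<Longrightarrow>
      seq P (tns P f g) (swp P (tgt P f) (tgt P g)) = seq P (swp P (src P f) (src P g)) (tns P g f)"
    and swp_inverse: "seq P (swp P n m) (swp P m n) = idn P (n + m)"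
    and swp_unit: "swp P n 0 = idn P n"
    and swp_hexagon: "swp P n (m + k) =
      seq P (tns P (swp P n m) (idn P k)) (tns P (idn P m) (swp P n k))"

definition prop_morphism :: "'a prop_data \<Rightarrow> 'b prop_data \<Rightarrow> ('a \<Rightarrow> 'b) \<Rightarrow> bool" where
  "prop_morphism P Q F \<longleftrightarrow>
     (\<forall>f\<in>arr P. F f \<in> arr Q \<and> src Q (F f) = src P f \<and> tgt Q (F f) = tgt P f) \<and>
     (\<forall>n. F (idn P n) = idn Q n) \<and>
     (\<forall>f\<in>arr P. \<forall>g\<in>arr P. tgt P f = src P g \<longrightarrow> F (seq P f g) = seq Q (F f) (F g)) \<and>
     (\<forall>f\<in>arr P. \<forall>g\<in>arr P. F (tns P f g) = tns Q (F f) (F g)) \<and>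
     (\<forall>n m. F (swp P n m) = swp Q n m)"

text \<open>
  The square with edges \<open>s : A \<rightarrow> B\<close>, \<open>t : A \<rightarrow> C\<close>, \<open>p : B \<rightarrow> D\<close>, \<open>q : C \<rightarrow> D\<close> is a pushout in the category
  of PROPs.  Functions between PROPs represent the same morphism iff they agree on \<open>arr\<close>.  A definition
  cannot quantify over types, so the type of the arrows of the test PROP \<open>X\<close> is a parameter; a theorem
  in which \<open>'x\<close> is free covers test PROPs of every size.
\<close>

definition prop_pushout :: "'x itself \<Rightarrow> 'a prop_data \<Rightarrow> 'b prop_data \<Rightarrow> 'c prop_data \<Rightarrow> 'd prop_data \<Rightarrow>
    ('a \<Rightarrow> 'b) \<Rightarrow> ('a \<Rightarrow> 'c) \<Rightarrow> ('b \<Rightarrow> 'd) \<Rightarrow> ('c \<Rightarrow> 'd) \<Rightarrow> bool" where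
  "prop_pushout _ A B C D s t p q \<longleftrightarrow>
     is_prop A \<and> is_prop B \<and> is_prop C \<and> is_prop D \<and>
     prop_morphism A B s \<and> prop_morphism A C t \<and> prop_morphism B D p \<and> prop_morphism C D q \<and>
     (\<forall>f\<in>arr A. p (s f) = q (t f)) \<and>
     (\<forall>(X :: 'x prop_data) F G.
        is_prop X \<and> prop_morphism B X F \<and> prop_morphism C X G \<and> (\<forall>f\<in>arr A. F (s f) = G (t f)) \<longrightarrow>
        (\<exists>H. prop_morphism D X H \<and> (\<forall>f\<in>arr B. H (p f) = F f) \<and> (\<forall>f\<in>arr C. H (q f) = G f) \<and>
          (\<forall>H'. prop_morphism D X H' \<and> (\<forall>f\<in>arr B. H' (p f) = F f) \<and> (\<forall>f\<in>arr C. H' (q f) = G f) \<longrightarrow>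
             (\<forall>f\<in>arr D. H' f = H f))))"

definition op_prop :: "'a prop_data \<Rightarrow> 'a prop_data" where
  "op_prop P = \<lparr>arr = arr P, src = tgt P, tgt = src P, idn = idn P, seq = (\<lambda>f g. seq P g f),
     tns = tns P, swp = (\<lambda>n m. swp P m n)\<rparr>"

section \<open>The coproduct of two PROPs\<close>

text \<open>
  Arrows of the coproduct are well-typed formal composites of arrows of \<open>P\<close> and of \<open>Q\<close>, modulo the
  congruence generated by the laws of PROPs and by the requirement that both inclusions be morphisms.
  The universal property is the lemma \<open>coprod_universal\<close> below.
\<close>

datatype ('a, 'b) pterm = InL 'a | InR 'b | Idt nat | Swp nat nat
  | Sq "('a, 'b) pterm" "('a, 'b) pterm" | Tn "('a, 'b) pterm" "('a, 'b) pterm"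

primrec tsrc :: "'a prop_data \<Rightarrow> 'b prop_data \<Rightarrow> ('a, 'b) pterm \<Rightarrow> nat" where
  "tsrc P Q (InL f) = src P f"
| "tsrc P Q (InR f) = src Q f"
| "tsrc P Q (Idt n) = n"
| "tsrc P Q (Swp n m) = n + m"
| "tsrc P Q (Sq s t) = tsrc P Q s"
| "tsrc P Q (Tn s t) = tsrc P Q s + tsrc P Q t"

primrec ttgt :: "'a prop_data \<Rightarrow> 'b prop_data \<Rightarrow> ('a, 'b) pterm \<Rightarrow> nat" where
  "ttgt P Q (InL f) = tgt P f"
| "ttgt P Q (InR f) = tgt Q f"
| "ttgt P Q (Idt n) = n"
| "ttgt P Q (Swp n m) = m + n"
| "ttgt P Q (Sq s t) = ttgt P Q t"
| "ttgt P Q (Tn s t) = ttgt P Q s + ttgt P Q t"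

primrec wt :: "'a prop_data \<Rightarrow> 'b prop_data \<Rightarrow> ('a, 'b) pterm \<Rightarrow> bool" where
  "wt P Q (InL f) \<longleftrightarrow> f \<in> arr P"
| "wt P Q (InR f) \<longleftrightarrow> f \<in> arr Q"
| "wt P Q (Idt n) \<longleftrightarrow> True"
| "wt P Q (Swp n m) \<longleftrightarrow> True"
| "wt P Q (Sq s t) \<longleftrightarrow> wt P Q s \<and> wt P Q t \<and> ttgt P Q s = tsrc P Q t"
| "wt P Q (Tn s t) \<longleftrightarrow> wt P Q s \<and> wt P Q t"

inductive teq :: "'a prop_data \<Rightarrow> 'b prop_data \<Rightarrow> ('a, 'b) pterm \<Rightarrow> ('a, 'b) pterm \<Rightarrow> bool"
  for P Q where
  teq_refl: "wt P Q s \<Longrightarrow> teq P Q s s"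
| teq_sym: "teq P Q s t \<Longrightarrow> teq P Q t s"
| teq_trans: "teq P Q s t \<Longrightarrow> teq P Q t u \<Longrightarrow> teq P Q s u"
| teq_Sq: "teq P Q s s' \<Longrightarrow> teq P Q t t' \<Longrightarrow> wt P Q (Sq s t) \<Longrightarrow> teq P Q (Sq s t) (Sq s' t')"
| teq_Tn: "teq P Q s s' \<Longrightarrow> teq P Q t t' \<Longrightarrow> teq P Q (Tn s t) (Tn s' t')"
| teq_Sq_assoc: "wt P Q (Sq (Sq s t) u) \<Longrightarrow> teq P Q (Sq (Sq s t) u) (Sq s (Sq t u))"
| teq_Sq_idl: "wt P Q s \<Longrightarrow> teq P Q (Sq (Idt (tsrc P Q s)) s) s"
| teq_Sq_idr: "wt P Q s \<Longrightarrow> teq P Q (Sq s (Idt (ttgt P Q s))) s"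
| teq_Tn_id: "teq P Q (Tn (Idt n) (Idt m)) (Idt (n + m))"
| teq_Tn_Sq: "wt P Q (Sq s t) \<Longrightarrow> wt P Q (Sq s' t') \<Longrightarrow>
    teq P Q (Tn (Sq s t) (Sq s' t')) (Sq (Tn s s') (Tn t t'))"
| teq_Tn_assoc: "wt P Q s \<Longrightarrow> wt P Q t \<Longrightarrow> wt P Q u \<Longrightarrow> teq P Q (Tn (Tn s t) u) (Tn s (Tn t u))"
| teq_Tn_unitl: "wt P Q s \<Longrightarrow> teq P Q (Tn (Idt 0) s) s"
| teq_Tn_unitr: "wt P Q s \<Longrightarrow> teq P Q (Tn s (Idt 0)) s"
| teq_Swp_natural: "wt P Q s \<Longrightarrow> wt P Q t \<Longrightarrow>
    teq P Q (Sq (Tn s t) (Swp (ttgt P Q s) (ttgt P Q t))) (Sq (Swp (tsrc P Q s) (tsrc P Q t)) (Tn t s))"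
| teq_Swp_inverse: "teq P Q (Sq (Swp n m) (Swp m n)) (Idt (n + m))"
| teq_Swp_unit: "teq P Q (Swp n 0) (Idt n)"
| teq_Swp_hexagon:
    "teq P Q (Swp n (m + k)) (Sq (Tn (Swp n m) (Idt k)) (Tn (Idt m) (Swp n k)))"
| teq_InL_idn: "teq P Q (InL (idn P n)) (Idt n)"
| teq_InL_swp: "teq P Q (InL (swp P n m)) (Swp n m)"
| teq_InL_seq: "f \<in> arr P \<Longrightarrow> g \<in> arr P \<Longrightarrow> tgt P f = src P g \<Longrightarrow>
    teq P Q (InL (seq P f g)) (Sq (InL f) (InL g))"
| teq_InL_tns: "f \<in> arr P \<Longrightarrow> g \<in> arr P \<Longrightarrow> teq P Q (InL (tns P f g)) (Tn (InL f) (InL g))"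
| teq_InR_idn: "teq P Q (InR (idn Q n)) (Idt n)"
| teq_InR_swp: "teq P Q (InR (swp Q n m)) (Swp n m)"
| teq_InR_seq: "f \<in> arr Q \<Longrightarrow> g \<in> arr Q \<Longrightarrow> tgt Q f = src Q g \<Longrightarrow>
    teq P Q (InR (seq Q f g)) (Sq (InR f) (InR g))"
| teq_InR_tns: "f \<in> arr Q \<Longrightarrow> g \<in> arr Q \<Longrightarrow> teq P Q (InR (tns Q f g)) (Tn (InR f) (InR g))"

definition tcls :: "'a prop_data \<Rightarrow> 'b prop_data \<Rightarrow> ('a, 'b) pterm \<Rightarrow> ('a, 'b) pterm set" where
  "tcls P Q t = {s. teq P Q t s}"

definition coprod :: "'a prop_data \<Rightarrow> 'b prop_data \<Rightarrow> ('a, 'b) pterm set prop_data" where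
  "coprod P Q = \<lparr>arr = tcls P Q ` {t. wt P Q t},
     src = (\<lambda>U. the_elem (tsrc P Q ` U)), tgt = (\<lambda>U. the_elem (ttgt P Q ` U)),
     idn = (\<lambda>n. tcls P Q (Idt n)),
     seq = (\<lambda>U V. \<Union>s\<in>U. \<Union>t\<in>V. tcls P Q (Sq s t)),
     tns = (\<lambda>U V. \<Union>s\<in>U. \<Union>t\<in>V. tcls P Q (Tn s t)),
     swp = (\<lambda>n m. tcls P Q (Swp n m))\<rparr>"

definition inl :: "'a prop_data \<Rightarrow> 'b prop_data \<Rightarrow> 'a \<Rightarrow> ('a, 'b) pterm set" where
  "inl P Q f = tcls P Q (InL f)"

definition inr :: "'a prop_data \<Rightarrow> 'b prop_data \<Rightarrow> 'b \<Rightarrow> ('a, 'b) pterm set" where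
  "inr P Q g = tcls P Q (InR g)"

primrec teval :: "'x prop_data \<Rightarrow> ('a \<Rightarrow> 'x) \<Rightarrow> ('b \<Rightarrow> 'x) \<Rightarrow> ('a, 'b) pterm \<Rightarrow> 'x" where
  "teval X F G (InL f) = F f"
| "teval X F G (InR g) = G g"
| "teval X F G (Idt n) = idn X n"
| "teval X F G (Swp n m) = swp X n m"
| "teval X F G (Sq s t) = seq X (teval X F G s) (teval X F G t)"
| "teval X F G (Tn s t) = tns X (teval X F G s) (teval X F G t)"

definition copair :: "'x prop_data \<Rightarrow> ('a \<Rightarrow> 'x) \<Rightarrow> ('b \<Rightarrow> 'x) \<Rightarrow> ('a, 'b) pterm set \<Rightarrow> 'x" where
  "copair X F G U = the_elem (teval X F G ` U)"

lemma teq_typed: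
  assumes "is_prop P" "is_prop Q" "teq P Q s t"
  shows "wt P Q s \<and> wt P Q t \<and> tsrc P Q s = tsrc P Q t \<and> ttgt P Q s = ttgt P Q t"
proof -
  interpret P: is_prop P by fact
  interpret Q: is_prop Q by fact
  show ?thesis using assms(3)
    by induction
      (simp_all add: P.idn_arr P.seq_arr P.tns_arr P.swp_arr Q.idn_arr Q.seq_arr Q.tns_arr Q.swp_arr)
qed

lemma teq_teval:
  assumes "is_prop P" "is_prop Q" "is_prop X" and F: "prop_morphism P X F" and G: "prop_morphism Q X G"
    and "teq P Q s t"
  shows "teval X F G s = teval X F G t"
proof -
  interpret X: is_prop X by fact
  have ty: "teval X F G u \<in> arr X \<and> src X (teval X F G u) = tsrc P Q u \<and>
      tgt X (teval X F G u) = ttgt P Q u" if "wt P Q u" for u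
    using that F G by (induction u)
      (simp_all add: X.idn_arr X.seq_arr X.tns_arr X.swp_arr prop_morphism_def)
  note F = F[unfolded prop_morphism_def] and G = G[unfolded prop_morphism_def]
  show ?thesis using assms(6)
  proof induction
    case (teq_Swp_natural s t)
    then show ?case using X.swp_natural[of "teval X F G s" "teval X F G t"] ty[of s] ty[of t] by simp
  next
    case (teq_Sq_idl s)
    then show ?case using X.seq_idn(1)[of "teval X F G s"] ty[of s] by simp
  next
    case (teq_Sq_idr s)
    then show ?case using X.seq_idn(2)[of "teval X F G s"] ty[of s] by simp
  next
    case (teq_Sq_assoc s t u)
    then show ?case using X.seq_assoc ty by simp
  next
    case (teq_Tn_Sq s t s' t')
    then show ?case using X.tns_seq ty by simp
  next
    case (teq_Tn_assoc s t u)
    then show ?case using X.tns_assoc ty by simp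
  next
    case (teq_Swp_hexagon n m k)
    show ?case using X.swp_hexagon by simp
  next
    case (teq_Tn_unitl s)
    then show ?case using X.tns_unit ty by simp
  next
    case (teq_Tn_unitr s)
    then show ?case using X.tns_unit ty by simp
  qed (simp_all add: F G X.tns_idn X.swp_inverse X.swp_unit)
qed

context
  fixes P :: "'a prop_data" and Q :: "'b prop_data"
  assumes P: "is_prop P" and Q: "is_prop Q"
begin

lemma typed: "teq P Q s t \<Longrightarrow>
    wt P Q s \<and> wt P Q t \<and> tsrc P Q s = tsrc P Q t \<and> ttgt P Q s = ttgt P Q t"
  by (rule teq_typed[OF P Q])

lemma tcls_eq: "teq P Q s t \<Longrightarrow> tcls P Q s = tcls P Q t"
  unfolding tcls_def by (intro Collect_cong iffI) (erule (1) teq_trans[OF teq_sym], erule (1) teq_trans)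

lemma tcls_self: "wt P Q s \<Longrightarrow> s \<in> tcls P Q s"
  by (simp add: tcls_def teq_refl)

lemma the_elem_tcls:
  assumes "wt P Q s" "\<And>t. teq P Q s t \<Longrightarrow> \<phi> t = \<phi> s"
  shows "the_elem (\<phi> ` tcls P Q s) = \<phi> s"
proof -
  have "\<phi> t = \<phi> s" if "t \<in> tcls P Q s" for t
    using that assms(2) unfolding tcls_def by blast
  then have "\<phi> ` tcls P Q s = {\<phi> s}"
    using tcls_self[OF assms(1)] by blast
  then show ?thesis by simp
qed

lemma coprod_src: "wt P Q s \<Longrightarrow> src (coprod P Q) (tcls P Q s) = tsrc P Q s"
  unfolding coprod_def prop_data.simps by (rule the_elem_tcls, assumption, metis typed)

lemma coprod_tgt: "wt P Q s \<Longrightarrow> tgt (coprod P Q) (tcls P Q s) = ttgt P Q s"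
  unfolding coprod_def prop_data.simps by (rule the_elem_tcls, assumption, metis typed)

lemma coprod_seq:
  assumes "wt P Q s" "wt P Q t" "ttgt P Q s = tsrc P Q t"
  shows "seq (coprod P Q) (tcls P Q s) (tcls P Q t) = tcls P Q (Sq s t)"
proof -
  have "tcls P Q (Sq s' t') = tcls P Q (Sq s t)" if "s' \<in> tcls P Q s" "t' \<in> tcls P Q t" for s' t'
    using that assms tcls_eq[OF teq_Sq[of P Q s s' t t']] by (simp add: tcls_def)
  then have "(\<Union>s'\<in>tcls P Q s. \<Union>t'\<in>tcls P Q t. tcls P Q (Sq s' t')) =
      (\<Union>s'\<in>tcls P Q s. \<Union>t'\<in>tcls P Q t. tcls P Q (Sq s t))"
    by simp
  also have "\<dots> = tcls P Q (Sq s t)"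
    using tcls_self[OF assms(1)] tcls_self[OF assms(2)] by auto
  finally have "(\<Union>s'\<in>tcls P Q s. \<Union>t'\<in>tcls P Q t. tcls P Q (Sq s' t')) = tcls P Q (Sq s t)" .
  then show ?thesis by (simp add: coprod_def)
qed

lemma coprod_tns:
  assumes "wt P Q s" "wt P Q t"
  shows "tns (coprod P Q) (tcls P Q s) (tcls P Q t) = tcls P Q (Tn s t)"
proof -
  have "tcls P Q (Tn s' t') = tcls P Q (Tn s t)" if "s' \<in> tcls P Q s" "t' \<in> tcls P Q t" for s' t'
    using that assms tcls_eq[OF teq_Tn[of P Q s s' t t']] by (simp add: tcls_def)
  then have "(\<Union>s'\<in>tcls P Q s. \<Union>t'\<in>tcls P Q t. tcls P Q (Tn s' t')) =
      (\<Union>s'\<in>tcls P Q s. \<Union>t'\<in>tcls P Q t. tcls P Q (Tn s t))"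
    by simp
  also have "\<dots> = tcls P Q (Tn s t)"
    using tcls_self[OF assms(1)] tcls_self[OF assms(2)] by auto
  finally have "(\<Union>s'\<in>tcls P Q s. \<Union>t'\<in>tcls P Q t. tcls P Q (Tn s' t')) = tcls P Q (Tn s t)" .
  then show ?thesis by (simp add: coprod_def)
qed

lemma coprod_arr: "U \<in> arr (coprod P Q) \<longleftrightarrow> (\<exists>s. wt P Q s \<and> U = tcls P Q s)"
  by (auto simp: coprod_def)

lemma coprod_idn: "idn (coprod P Q) n = tcls P Q (Idt n)"
  by (simp add: coprod_def)

lemma coprod_swp: "swp (coprod P Q) n m = tcls P Q (Swp n m)"
  by (simp add: coprod_def)

lemmas coprod_simps = coprod_src coprod_tgt coprod_seq coprod_tns coprod_idn coprod_swp

lemma coprod_arrI: "wt P Q s \<Longrightarrow> tcls P Q s \<in> arr (coprod P Q)"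
  by (auto simp: coprod_arr)

lemma coprod_arrE:
  "\<lbrakk>U \<in> arr (coprod P Q); \<And>s. \<lbrakk>wt P Q s; U = tcls P Q s\<rbrakk> \<Longrightarrow> thesis\<rbrakk> \<Longrightarrow> thesis"
  by (auto simp: coprod_arr)

lemma coprod_is_prop: "is_prop (coprod P Q)"
proof
  fix n m k
  show "swp (coprod P Q) n (m + k) = seq (coprod P Q) (tns (coprod P Q) (swp (coprod P Q) n m)
      (idn (coprod P Q) k)) (tns (coprod P Q) (idn (coprod P Q) m) (swp (coprod P Q) n k))"
    by (simp add: coprod_simps tcls_eq[OF teq_Swp_hexagon])
qed (auto elim!: coprod_arrE simp: coprod_arrI coprod_simps add.assoc tcls_eq[OF teq_Sq_assoc]
    tcls_eq[OF teq_Sq_idl] tcls_eq[OF teq_Sq_idr] tcls_eq[OF teq_Tn_id] tcls_eq[OF teq_Tn_Sq]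
    tcls_eq[OF teq_Tn_assoc] tcls_eq[OF teq_Tn_unitl] tcls_eq[OF teq_Tn_unitr]
    tcls_eq[OF teq_Swp_natural] tcls_eq[OF teq_Swp_inverse] tcls_eq[OF teq_Swp_unit])

lemma inl_morphism: "prop_morphism P (coprod P Q) (inl P Q)"
  by (auto simp: prop_morphism_def inl_def coprod_arrI coprod_simps
      intro!: tcls_eq teq_InL_idn teq_InL_seq teq_InL_tns teq_InL_swp)

lemma inr_morphism: "prop_morphism Q (coprod P Q) (inr P Q)"
  by (auto simp: prop_morphism_def inr_def coprod_arrI coprod_simps
      intro!: tcls_eq teq_InR_idn teq_InR_seq teq_InR_tns teq_InR_swp)

end

lemma coprod_universal:
  assumes "is_prop P" "is_prop Q"
  shows "is_prop (coprod P Q)"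
    and "prop_morphism P (coprod P Q) (inl P Q)"
    and "prop_morphism Q (coprod P Q) (inr P Q)"
    and "\<lbrakk>is_prop X; prop_morphism P X F; prop_morphism Q X G\<rbrakk> \<Longrightarrow>
      prop_morphism (coprod P Q) X (copair X F G) \<and>
      (\<forall>f\<in>arr P. copair X F G (inl P Q f) = F f) \<and> (\<forall>g\<in>arr Q. copair X F G (inr P Q g) = G g)"
    and "\<lbrakk>is_prop X; prop_morphism P X F; prop_morphism Q X G; prop_morphism (coprod P Q) X H;
        \<forall>f\<in>arr P. H (inl P Q f) = F f; \<forall>g\<in>arr Q. H (inr P Q g) = G g; U \<in> arr (coprod P Q)\<rbrakk> \<Longrightarrow>
      H U = copair X F G U"
proof -
  note coprod_arr = coprod_arr[OF assms] and coprod_simps = coprod_simps[OF assms]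
  show "is_prop (coprod P Q)" "prop_morphism P (coprod P Q) (inl P Q)"
      "prop_morphism Q (coprod P Q) (inr P Q)"
    by (fact coprod_is_prop[OF assms] inl_morphism[OF assms] inr_morphism[OF assms])+
  assume X: "is_prop X" and F: "prop_morphism P X F" and G: "prop_morphism Q X G"
  interpret X: is_prop X by fact
  have ty: "teval X F G u \<in> arr X \<and> src X (teval X F G u) = tsrc P Q u \<and>
      tgt X (teval X F G u) = ttgt P Q u" if "wt P Q u" for u
    using that F G by (induction u)
      (simp_all add: X.idn_arr X.seq_arr X.tns_arr X.swp_arr prop_morphism_def)
  have cp: "copair X F G (tcls P Q s) = teval X F G s" if "wt P Q s" for s
    unfolding copair_def
    by (rule the_elem_tcls[OF assms that]) (rule teq_teval[OF assms X F G, symmetric])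
  show "prop_morphism (coprod P Q) X (copair X F G) \<and>
      (\<forall>f\<in>arr P. copair X F G (inl P Q f) = F f) \<and> (\<forall>g\<in>arr Q. copair X F G (inr P Q g) = G g)"
    by (auto simp: prop_morphism_def coprod_arr coprod_simps cp ty inl_def inr_def)
  assume H: "prop_morphism (coprod P Q) X H" "\<forall>f\<in>arr P. H (inl P Q f) = F f"
      "\<forall>g\<in>arr Q. H (inr P Q g) = G g" and U: "U \<in> arr (coprod P Q)"
  have Hseq: "H (seq (coprod P Q) U V) = seq X (H U) (H V)"
    if "U \<in> arr (coprod P Q)" "V \<in> arr (coprod P Q)" "tgt (coprod P Q) U = src (coprod P Q) V" for U V
    using H(1) that unfolding prop_morphism_def by blast
  have Htns: "H (tns (coprod P Q) U V) = tns X (H U) (H V)"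
    if "U \<in> arr (coprod P Q)" "V \<in> arr (coprod P Q)" for U V
    using H(1) that unfolding prop_morphism_def by blast
  have "H (tcls P Q s) = teval X F G s" if "wt P Q s" for s
    using that
  proof (induction s)
    case (Sq s t)
    then show ?case using Hseq[of "tcls P Q s" "tcls P Q t"] coprod_arrI[OF assms]
      by (simp add: coprod_simps)
  next
    case (Tn s t)
    then show ?case using Htns[of "tcls P Q s" "tcls P Q t"] coprod_arrI[OF assms]
      by (simp add: coprod_simps)
  qed (use H in \<open>auto simp: inl_def inr_def prop_morphism_def coprod_idn[OF assms] coprod_swp[OF assms]\<close>)
  with U cp show "H U = copair X F G U" by (auto simp: coprod_arr)
qed

section \<open>Spans and cospans\<close>

definition iso_arr :: "'a prop_data \<Rightarrow> 'a \<Rightarrow> bool" where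
  "iso_arr P u \<longleftrightarrow> u \<in> arr P \<and> (\<exists>v\<in>arr P. src P v = tgt P u \<and> tgt P v = src P u \<and>
     seq P u v = idn P (src P u) \<and> seq P v u = idn P (tgt P u))"

text \<open>\<open>pullback_sq P f g p q\<close>: the span \<open>(p, q)\<close> is a pullback of the cospan \<open>(f, g)\<close>.\<close>

definition pullback_sq :: "'a prop_data \<Rightarrow> 'a \<Rightarrow> 'a \<Rightarrow> 'a \<Rightarrow> 'a \<Rightarrow> bool" where
  "pullback_sq P f g p q \<longleftrightarrow>
     p \<in> arr P \<and> q \<in> arr P \<and> src P p = src P q \<and> tgt P p = src P f \<and> tgt P q = src P g \<and>
     seq P p f = seq P q g \<and>
     (\<forall>p'\<in>arr P. \<forall>q'\<in>arr P. src P p' = src P q' \<and> tgt P p' = src P f \<and> tgt P q' = src P g \<and>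
        seq P p' f = seq P q' g \<longrightarrow>
        (\<exists>!u. u \<in> arr P \<and> src P u = src P p' \<and> tgt P u = src P p \<and> seq P u p = p' \<and> seq P u q = q'))"

text \<open>\<open>pushout_sq P f g p q\<close>: the cospan \<open>(p, q)\<close> is a pushout of the span \<open>(f, g)\<close>.\<close>

definition pushout_sq :: "'a prop_data \<Rightarrow> 'a \<Rightarrow> 'a \<Rightarrow> 'a \<Rightarrow> 'a \<Rightarrow> bool" where
  "pushout_sq P f g p q \<longleftrightarrow>
     p \<in> arr P \<and> q \<in> arr P \<and> tgt P p = tgt P q \<and> src P p = tgt P f \<and> src P q = tgt P g \<and>
     seq P f p = seq P g q \<and>
     (\<forall>p'\<in>arr P. \<forall>q'\<in>arr P. tgt P p' = tgt P q' \<and> src P p' = tgt P f \<and> src P q' = tgt P g \<and>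
        seq P f p' = seq P g q' \<longrightarrow>
        (\<exists>!u. u \<in> arr P \<and> src P u = tgt P p \<and> tgt P u = tgt P p' \<and> seq P p u = p' \<and> seq P q u = q'))"

text \<open>The isomorphism class of the span \<open>n \<leftarrow>f\<midarrow> z \<midarrow>g\<rightarrow> m\<close>, resp. of the cospan \<open>n \<midarrow>f\<rightarrow> z \<leftarrow>g\<midarrow> m\<close>.\<close>

definition span_cls :: "'a prop_data \<Rightarrow> 'a \<Rightarrow> 'a \<Rightarrow> ('a \<times> 'a) set" where
  "span_cls P f g = {(seq P u f, seq P u g) | u. iso_arr P u \<and> tgt P u = src P f}"

definition cospan_cls :: "'a prop_data \<Rightarrow> 'a \<Rightarrow> 'a \<Rightarrow> ('a \<times> 'a) set" where
  "cospan_cls P f g = {(seq P f u, seq P g u) | u. iso_arr P u \<and> src P u = tgt P f}"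

text \<open>
  The composites below run over all representatives and all pullbacks (pushouts); the union is a
  single isomorphism class because pullbacks are unique up to isomorphism.
\<close>

definition Span :: "'a prop_data \<Rightarrow> ('a \<times> 'a) set prop_data" where
  "Span P = \<lparr>arr = {span_cls P f g | f g. f \<in> arr P \<and> g \<in> arr P \<and> src P f = src P g},
     src = (\<lambda>S. the_elem ((\<lambda>(f, g). tgt P f) ` S)),
     tgt = (\<lambda>S. the_elem ((\<lambda>(f, g). tgt P g) ` S)),
     idn = (\<lambda>n. span_cls P (idn P n) (idn P n)),
     seq = (\<lambda>S T. \<Union>{span_cls P (seq P p f) (seq P q g') | p q f g f' g'.
              (f, g) \<in> S \<and> (f', g') \<in> T \<and> pullback_sq P g f' p q}),
     tns = (\<lambda>S T. \<Union>{span_cls P (tns P f f') (tns P g g') | f g f' g'. (f, g) \<in> S \<and> (f', g') \<in> T}),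
     swp = (\<lambda>n m. span_cls P (idn P (n + m)) (swp P n m))\<rparr>"

definition Cospan :: "'a prop_data \<Rightarrow> ('a \<times> 'a) set prop_data" where
  "Cospan P = \<lparr>arr = {cospan_cls P f g | f g. f \<in> arr P \<and> g \<in> arr P \<and> tgt P f = tgt P g},
     src = (\<lambda>S. the_elem ((\<lambda>(f, g). src P f) ` S)),
     tgt = (\<lambda>S. the_elem ((\<lambda>(f, g). src P g) ` S)),
     idn = (\<lambda>n. cospan_cls P (idn P n) (idn P n)),
     seq = (\<lambda>S T. \<Union>{cospan_cls P (seq P f p) (seq P g' q) | p q f g f' g'.
              (f, g) \<in> S \<and> (f', g') \<in> T \<and> pushout_sq P g f' p q}),
     tns = (\<lambda>S T. \<Union>{cospan_cls P (tns P f f') (tns P g g') | f g f' g'. (f, g) \<in> S \<and> (f', g') \<in> T}),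
     swp = (\<lambda>n m. cospan_cls P (swp P n m) (idn P (m + n)))\<rparr>"

text \<open>In \<open>kappa2\<close> and \<open>iota2\<close> the argument is an arrow of \<open>op_prop P\<close>; \<open>src\<close> and \<open>tgt\<close> are those of \<open>P\<close>.\<close>

definition kappa1 :: "'a prop_data \<Rightarrow> 'a \<Rightarrow> ('a \<times> 'a) set" where
  "kappa1 P f = span_cls P (idn P (src P f)) f"

definition kappa2 :: "'a prop_data \<Rightarrow> 'a \<Rightarrow> ('a \<times> 'a) set" where
  "kappa2 P f = span_cls P f (idn P (src P f))"

definition iota1 :: "'a prop_data \<Rightarrow> 'a \<Rightarrow> ('a \<times> 'a) set" where
  "iota1 P f = cospan_cls P f (idn P (tgt P f))"

definition iota2 :: "'a prop_data \<Rightarrow> 'a \<Rightarrow> ('a \<times> 'a) set" where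
  "iota2 P f = cospan_cls P (idn P (tgt P f)) f"

section \<open>Matrices and linear relations\<close>

definition Mat :: "'r::comm_ring_1 mat prop_data" where
  "Mat = \<lparr>arr = UNIV, src = dim_col, tgt = dim_row, idn = 1\<^sub>m, seq = (\<lambda>A B. B * A),
     tns = (\<lambda>A B. four_block_mat A (0\<^sub>m (dim_row A) (dim_col B)) (0\<^sub>m (dim_row B) (dim_col A)) B),
     swp = (\<lambda>n m. four_block_mat (0\<^sub>m m n) (1\<^sub>m m) (1\<^sub>m n) (0\<^sub>m n m))\<rparr>"

definition lin_rel :: "nat \<Rightarrow> nat \<Rightarrow> ('k::field vec \<times> 'k vec) set \<Rightarrow> bool" where
  "lin_rel n m S \<longleftrightarrow> S \<subseteq> carrier_vec n \<times> carrier_vec m \<and> (0\<^sub>v n, 0\<^sub>v m) \<in> S \<and>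
     (\<forall>x y x' y'. (x, y) \<in> S \<and> (x', y') \<in> S \<longrightarrow> (x + x', y + y') \<in> S) \<and>
     (\<forall>c x y. (x, y) \<in> S \<longrightarrow> (c \<cdot>\<^sub>v x, c \<cdot>\<^sub>v y) \<in> S)"

definition SV :: "('k::field vec \<times> 'k vec) set prop_data" where
  "SV = \<lparr>arr = {S. \<exists>n m. lin_rel n m S},
     src = (\<lambda>S. the_elem (dim_vec ` Domain S)), tgt = (\<lambda>S. the_elem (dim_vec ` Range S)),
     idn = (\<lambda>n. {(x, x) | x. x \<in> carrier_vec n}),
     seq = (O),
     tns = (\<lambda>S T. {(x @\<^sub>v x', y @\<^sub>v y') | x y x' y'. (x, y) \<in> S \<and> (x', y') \<in> T}),
     swp = (\<lambda>n m. {(x @\<^sub>v y, y @\<^sub>v x) | x y. x \<in> carrier_vec n \<and> y \<in> carrier_vec m})\<rparr>"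

text \<open>
  A span or cospan is given by its isomorphism class \<open>S\<close>, all of whose representatives determine the
  same subspace.
\<close>

definition Phi :: "('r::idom mat \<times> 'r mat) set \<Rightarrow> ('r fract vec \<times> 'r fract vec) set" where
  "Phi S = {(map_mat to_fract A *\<^sub>v z, map_mat to_fract B *\<^sub>v z) | A B z.
     (A, B) \<in> S \<and> z \<in> carrier_vec (dim_col A)}"

definition Psi :: "('r::idom mat \<times> 'r mat) set \<Rightarrow> ('r fract vec \<times> 'r fract vec) set" where
  "Psi S = {(x, y) | x y A B. (A, B) \<in> S \<and> x \<in> carrier_vec (dim_col A) \<and> y \<in> carrier_vec (dim_col B) \<and>
     map_mat to_fract A *\<^sub>v x = map_mat to_fract B *\<^sub>v y}"

end

theory Submission
  imports Defs
begin

text \<open>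
  A cospan over \<open>P\<close> is a span over the opposite PROP, so both PROPs of the square come from one
  construction on a PROP with pullbacks preserved by \<open>\<oplus>\<close>.  For matrices, pullbacks exist because submodules
  of \<open>R^n\<close> are free, and transposition turns pullbacks into pushouts.

  A pullback square and a pushout square have the same effect over the field of fractions: the relation of
  the span equals the relation of the cospan.  Let \<open>F\<close> and \<open>G\<close> form a cocone.  As \<open>F\<close> and \<open>G\<close> agree on matrices
  and transposed matrices, \<open>F\<close> of a span equals \<open>G\<close> of a cospan whenever the two form a pullback square or a
  pushout square.  Hence \<open>F\<close> of a span is unchanged if the span is replaced by the pullback of its pushout,
  which consists of the vectors over \<open>R\<close> in the linear relation of the span and so depends on that relation
  only.  Since every linear relation over the field of fractions is that of a span, by clearing denominators,
  \<open>F\<close> factors uniquely through \<open>Phi\<close>.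
\<close>

section \<open>Spans in a PROP with pullbacks\<close>

text \<open>The detour through cospans is forced. For a nonzero nonunit \<open>d\<close> the span
  with both legs \<open>d\<close> has the identity relation over the fractions without being
  isomorphic to the identity span; its pushout, however, is the identity cospan. In general a
  pushout in \<open>Mat\<close> is a cokernel modulo torsion, since only free modules occur, and
  torsion is invisible over the fractions. Such a quotient is awkward to describe by vectors, so
  pushouts are handled only through transposition, which gives their existence, and through
  functionals, which give their relation. \<open>F\<close> and \<open>G\<close> can be compared
  because each composite of generators has two roles: \<open>kappa2\<close> followed by
  \<open>kappa1\<close> merely assembles a span, while \<open>kappa1\<close> followed by
  \<open>kappa2\<close> computes a pullback; dually, \<open>iota1\<close> followed by
  \<open>iota2\<close> assembles a cospan, while \<open>iota2\<close> followed by
  \<open>iota1\<close> computes a pushout. Crossing from \<open>F\<close> to \<open>G\<close> turns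
  assembling into computing.\<close>

lemma op_prop_simps:
  "arr (op_prop P) = arr P" "src (op_prop P) = tgt P" "tgt (op_prop P) = src P"
  "idn (op_prop P) = idn P" "seq (op_prop P) f g = seq P g f" "tns (op_prop P) = tns P"
  "swp (op_prop P) n m = swp P m n"
  by (simp_all add: op_prop_def)

context is_prop
begin

lemmas typing = idn_arr seq_arr tns_arr swp_arr

declare typing [simp]

lemma seq_idn_left [simp]: "f \<in> arr P \<Longrightarrow> src P f = n \<Longrightarrow> seq P (idn P n) f = f"
  using seq_idn by blast

lemma seq_idn_right [simp]: "f \<in> arr P \<Longrightarrow> tgt P f = n \<Longrightarrow> seq P f (idn P n) = f"
  using seq_idn by blast

text \<open>Reversal turns the hexagon into the one that decomposes \<open>swp P (m + k) n\<close>,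
  which is not an axiom of \<open>P\<close>. It follows because its right side \<open>R\<close> is a
  left inverse of \<open>swp P n (m + k)\<close>, and \<open>L\<close> is a right inverse of that
  same arrow, so \<open>R = L\<close>. The unit law \<open>swp P 0 n = idn P n\<close> is likewise
  derived.\<close>

lemma op_is_prop: "is_prop (op_prop P)"
proof (unfold_locales, unfold op_prop_simps)
  fix n m k
  define L where "L = swp P (m + k) n"
  define R where "R = seq P (tns P (idn P m) (swp P k n)) (tns P (swp P m n) (idn P k))"
  have R: "R \<in> arr P" "src P R = m + k + n" "tgt P R = n + (m + k)"
    unfolding R_def by (simp_all add: algebra_simps)
  have L: "L \<in> arr P" "src P L = m + k + n" "tgt P L = n + (m + k)"
    unfolding L_def by simp_all
  \<comment> \<open>After expanding the hexagon, the two swaps of \<open>m\<close> and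
    \<open>n\<close> meet in the middle and cancel, and then those of \<open>n\<close> and
    \<open>k\<close> do.\<close>
  have "seq P R (swp P n (m + k)) = idn P (m + k + n)"
  proof -
    have "seq P (tns P (swp P m n) (idn P k)) (tns P (swp P n m) (idn P k)) = idn P (m + n + k)"
      by (subst tns_seq [symmetric]) (simp_all add: swp_inverse tns_idn)
    then have "seq P R (swp P n (m + k)) =
        seq P (tns P (idn P m) (swp P k n)) (tns P (idn P m) (swp P n k))"
      unfolding R_def swp_hexagon
      by (simp add: seq_assoc add.assoc)
        (subst seq_assoc [symmetric], simp_all add: algebra_simps)
    also have "\<dots> = idn P (m + k + n)"
      by (subst tns_seq [symmetric]) (simp_all add: swp_inverse tns_idn add.assoc)
    finally show ?thesis .
  qed
  then have "seq P (seq P R (swp P n (m + k))) L = L"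
    using L by simp
  then have "L = seq P R (seq P (swp P n (m + k)) L)"
    using R L by (simp add: seq_assoc)
  also have "\<dots> = R"
    using R unfolding L_def by (simp add: swp_inverse)
  finally show "swp P (m + k) n =
      seq P (tns P (idn P m) (swp P k n)) (tns P (swp P m n) (idn P k))"
    unfolding L_def R_def .
next
  fix n show "swp P 0 n = idn P n"
    using swp_inverse [of n 0] swp_unit [of n] swp_arr [of 0 n] by simp
next
  fix f g assume "f \<in> arr P" "g \<in> arr P"
  then show "seq P (swp P (src P g) (src P f)) (tns P f g) =
      seq P (tns P g f) (swp P (tgt P g) (tgt P f))"
    using swp_natural [of g f] by simp
qed (simp_all add: seq_assoc tns_seq tns_assoc tns_unit tns_idn swp_inverse add.commute)

section \<open>Isomorphisms and isomorphism classes of spans\<close>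

lemma iso_arrE:
  assumes "iso_arr P u"
  obtains v where "u \<in> arr P" "v \<in> arr P" "src P v = tgt P u" "tgt P v = src P u"
    "seq P u v = idn P (src P u)" "seq P v u = idn P (tgt P u)" "iso_arr P v"
  using assms unfolding iso_arr_def by metis

lemma iso_arrI:
  assumes "u \<in> arr P" "v \<in> arr P" "src P v = tgt P u" "tgt P v = src P u"
    "seq P u v = idn P (src P u)" "seq P v u = idn P (tgt P u)"
  shows "iso_arr P u"
  using assms unfolding iso_arr_def by blast

lemma iso_arr_arr: "iso_arr P u \<Longrightarrow> u \<in> arr P"
  by (simp add: iso_arr_def)

lemma iso_idn [simp]: "iso_arr P (idn P n)"
  by (rule iso_arrI [of _ "idn P n"]) simp_all

lemma iso_swp [simp]: "iso_arr P (swp P n m)"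
  by (rule iso_arrI [of _ "swp P m n"]) (simp_all add: swp_inverse add.commute)

lemma seq_cancel:
  assumes "u \<in> arr P" "v \<in> arr P" "f \<in> arr P" "tgt P u = src P v" "tgt P v = src P f"
    "seq P u v = idn P n"
  shows "seq P u (seq P v f) = f"
proof -
  have "n = src P f"
    using seq_arr(3) [of u v] assms by simp
  then show ?thesis
    using assms by (simp flip: seq_assoc)
qed

lemma iso_seq:
  assumes "iso_arr P u" "iso_arr P v" "tgt P u = src P v"
  shows "iso_arr P (seq P u v)"
proof -
  from assms(1) obtain u' where u: "u \<in> arr P" "u' \<in> arr P" "src P u' = tgt P u"
    "tgt P u' = src P u" "seq P u u' = idn P (src P u)" "seq P u' u = idn P (tgt P u)"
    by (rule iso_arrE)
  from assms(2) obtain v' where v: "v \<in> arr P" "v' \<in> arr P" "src P v' = tgt P v"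
    "tgt P v' = src P v" "seq P v v' = idn P (src P v)" "seq P v' v = idn P (tgt P v)"
    by (rule iso_arrE)
  have "seq P v (seq P v' u') = u'"
    using u v assms(3) by (intro seq_cancel) simp_all
  moreover have "seq P u' (seq P u v) = v"
    using u v assms(3) by (intro seq_cancel) simp_all
  ultimately show ?thesis
    using u v assms(3) by (intro iso_arrI [of _ "seq P v' u'"]) (simp_all add: seq_assoc)
qed

lemma iso_tns:
  assumes "iso_arr P u" "iso_arr P v"
  shows "iso_arr P (tns P u v)"
proof -
  from assms(1) obtain u' where u: "u \<in> arr P" "u' \<in> arr P" "src P u' = tgt P u"
    "tgt P u' = src P u" "seq P u u' = idn P (src P u)" "seq P u' u = idn P (tgt P u)"
    by (rule iso_arrE)
  from assms(2) obtain v' where v: "v \<in> arr P" "v' \<in> arr P" "src P v' = tgt P v"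
    "tgt P v' = src P v" "seq P v v' = idn P (src P v)" "seq P v' v = idn P (tgt P v)"
    by (rule iso_arrE)
  from u v show ?thesis
    by (intro iso_arrI [of _ "tns P u' v'"]) (simp_all add: tns_idn flip: tns_seq)
qed

lemma span_cls_self: "f \<in> arr P \<Longrightarrow> g \<in> arr P \<Longrightarrow> src P f = src P g \<Longrightarrow> (f, g) \<in> span_cls P f g"
  unfolding span_cls_def by (rule CollectI, rule exI [of _ "idn P (src P f)"]) simp

lemma span_clsE:
  assumes "(f', g') \<in> span_cls P f g"
  obtains u where "iso_arr P u" "tgt P u = src P f" "f' = seq P u f" "g' = seq P u g"
  using assms unfolding span_cls_def by blast

text \<open>Isomorphisms compose with \<open>u\<close> and with its inverse, so the class does not
  depend on the representative. All independence proofs for the operations of \<open>Span\<close>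
  end here.\<close>

lemma span_cls_seq:
  assumes "f \<in> arr P" "g \<in> arr P" "src P f = src P g" "iso_arr P u" "tgt P u = src P f"
  shows "span_cls P (seq P u f) (seq P u g) = span_cls P f g"
proof -
  from assms(4) obtain v where u: "u \<in> arr P" "v \<in> arr P" "src P v = tgt P u" "tgt P v = src P u"
    "seq P u v = idn P (src P u)" "seq P v u = idn P (tgt P u)" "iso_arr P v"
    by (rule iso_arrE)
  show ?thesis
  proof (intro equalityI subsetI)
    fix x assume "x \<in> span_cls P (seq P u f) (seq P u g)"
    then obtain w where w: "iso_arr P w" "tgt P w = src P u"
        "x = (seq P w (seq P u f), seq P w (seq P u g))"
      using assms u by (auto simp: span_cls_def)
    then have "x = (seq P (seq P w u) f, seq P (seq P w u) g)"
      using assms u by (simp add: seq_assoc iso_arr_arr)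
    then show "x \<in> span_cls P f g"
      using iso_seq [OF w(1) assms(4) w(2)] w assms u unfolding span_cls_def
      by (intro CollectI exI [of _ "seq P w u"]) (auto simp: iso_arr_arr)
  next
    fix x assume "x \<in> span_cls P f g"
    then obtain w where w: "iso_arr P w" "tgt P w = src P f" "x = (seq P w f, seq P w g)"
      by (auto simp: span_cls_def)
    have "seq P v (seq P u f) = f" "seq P v (seq P u g) = g"
      using u assms by (auto intro!: seq_cancel)
    then have "x = (seq P (seq P w v) (seq P u f), seq P (seq P w v) (seq P u g))"
      using assms u w by (simp add: seq_assoc iso_arr_arr)
    then show "x \<in> span_cls P (seq P u f) (seq P u g)"
      using iso_seq [OF w(1) u(7)] w assms u unfolding span_cls_def
      by (intro CollectI exI [of _ "seq P w v"]) (auto simp: iso_arr_arr)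
  qed
qed

section \<open>Calculus of pullback squares\<close>

lemma pullback_factor:
  assumes "pullback_sq P f g p q" "p' \<in> arr P" "q' \<in> arr P" "src P p' = src P q'"
    "tgt P p' = src P f" "tgt P q' = src P g" "seq P p' f = seq P q' g"
  obtains u where "u \<in> arr P" "src P u = src P p'" "tgt P u = src P p" "seq P u p = p'" "seq P u q = q'"
  using assms unfolding pullback_sq_def by metis

lemma pullback_sqD:
  assumes "pullback_sq P f g p q"
  shows "p \<in> arr P" "q \<in> arr P" "src P q = src P p" "tgt P p = src P f" "tgt P q = src P g"
    "seq P p f = seq P q g"
  using assms unfolding pullback_sq_def by simp_all

text \<open>The legs of a pullback are jointly monic: \<open>u\<close> and \<open>v\<close> both
  mediate for the cone obtained by composing \<open>u\<close> with the legs.\<close>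

lemma pullback_cancel:
  assumes pb: "pullback_sq P f g p q" and fg: "f \<in> arr P" "g \<in> arr P"
    and u: "u \<in> arr P" "tgt P u = src P p" and v: "v \<in> arr P" "tgt P v = src P p"
    and eq: "seq P u p = seq P v p" "seq P u q = seq P v q"
  shows "u = v"
proof -
  note D = pullback_sqD [OF pb]
  have s: "src P v = src P u"
    using arg_cong [OF eq(1), of "src P"] D u v by simp
  have "seq P (seq P u p) f = seq P (seq P u q) g"
    using D u fg by (simp add: seq_assoc)
  then have "\<exists>!w. w \<in> arr P \<and> src P w = src P u \<and> tgt P w = src P p \<and>
      seq P w p = seq P u p \<and> seq P w q = seq P u q"
    using pb[unfolded pullback_sq_def, THEN conjunct2, THEN conjunct2, THEN conjunct2, THEN conjunct2,
        THEN conjunct2, THEN conjunct2, rule_format, of "seq P u p" "seq P u q"] D u by simp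
  then show ?thesis
    using u v s eq by metis
qed

text \<open>Splits the unique existence into the existence of a mediating arrow and joint monicity
  of the legs, which no longer mentions a cone.\<close>

lemma pullback_sqI:
  assumes "p \<in> arr P" "q \<in> arr P" "src P q = src P p" "tgt P p = src P f" "tgt P q = src P g"
    "seq P p f = seq P q g"
    and ex: "\<And>p' q'. \<lbrakk>p' \<in> arr P; q' \<in> arr P; src P q' = src P p'; tgt P p' = src P f;
      tgt P q' = src P g; seq P p' f = seq P q' g\<rbrakk> \<Longrightarrow>
      \<exists>u \<in> arr P. src P u = src P p' \<and> tgt P u = src P p \<and> seq P u p = p' \<and> seq P u q = q'"
    and mono: "\<And>u v. \<lbrakk>u \<in> arr P; v \<in> arr P; src P v = src P u; tgt P u = src P p; tgt P v = src P p;
      seq P u p = seq P v p; seq P u q = seq P v q\<rbrakk> \<Longrightarrow> u = v"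
  shows "pullback_sq P f g p q"
  unfolding pullback_sq_def
proof (intro conjI ballI impI, goal_cases)
  case (7 p' q')
  then obtain u where u: "u \<in> arr P" "src P u = src P p'" "tgt P u = src P p"
      "seq P u p = p'" "seq P u q = q'"
    using ex [of p' q'] by auto
  show ?case
  proof (rule ex1I [of _ u])
    fix v assume "v \<in> arr P \<and> src P v = src P p' \<and> tgt P v = src P p \<and> seq P v p = p' \<and> seq P v q = q'"
    then show "v = u"
      using u by - (rule mono, simp_all)
  qed (use u in simp)
qed (use assms(1-6) in auto)

lemma pullback_sym:
  assumes "pullback_sq P f g p q" "f \<in> arr P" "g \<in> arr P"
  shows "pullback_sq P g f q p"
proof (rule pullback_sqI)
  note D = pullback_sqD [OF assms(1)]
  show "q \<in> arr P" "p \<in> arr P" "src P p = src P q" "tgt P q = src P g" "tgt P p = src P f"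
    "seq P q g = seq P p f"
    using D by simp_all
  fix p' q' assume "p' \<in> arr P" "q' \<in> arr P" "src P q' = src P p'" "tgt P p' = src P g"
      "tgt P q' = src P f" "seq P p' g = seq P q' f"
  then show "\<exists>u \<in> arr P. src P u = src P p' \<and> tgt P u = src P q \<and> seq P u q = p' \<and> seq P u p = q'"
    using pullback_factor [OF assms(1), of q' p'] D by metis
next
  note D = pullback_sqD [OF assms(1)]
  fix u v assume "u \<in> arr P" "v \<in> arr P" "tgt P u = src P q" "tgt P v = src P q"
      "seq P u q = seq P v q" "seq P u p = seq P v p"
  then show "u = v"
    using pullback_cancel [OF assms] D by metis
qed

text \<open>The pasting law: a cone over \<open>seq P h f\<close> and \<open>g\<close> is mediated
  first into the square of \<open>f\<close> and \<open>g\<close>, and the result then into the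
  square of \<open>h\<close> and \<open>p\<close>. Associativity of span composition rests on
  it.\<close>

lemma pullback_paste:
  assumes pb: "pullback_sq P f g p q" and pb': "pullback_sq P h p r s"
    and arr: "f \<in> arr P" "g \<in> arr P" "h \<in> arr P" "tgt P h = src P f"
  shows "pullback_sq P (seq P h f) g r (seq P s q)"
proof (rule pullback_sqI)
  note D = pullback_sqD [OF pb] and D' = pullback_sqD [OF pb'] and [simp] = arr
  show "r \<in> arr P" "seq P s q \<in> arr P" "src P (seq P s q) = src P r" "tgt P r = src P (seq P h f)"
     "tgt P (seq P s q) = src P g"
    using D D' by simp_all
  have "seq P r (seq P h f) = seq P (seq P s p) f"
    using D D' by (simp flip: seq_assoc)
  also have "\<dots> = seq P (seq P s q) g"
    using D D' by (simp add: seq_assoc)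
  finally show "seq P r (seq P h f) = seq P (seq P s q) g" .
  {
    fix p' q' assume p': "p' \<in> arr P" "q' \<in> arr P" "src P q' = src P p'" "tgt P p' = src P (seq P h f)"
      "tgt P q' = src P g" "seq P p' (seq P h f) = seq P q' g"
    then have "seq P (seq P p' h) f = seq P q' g"
      by (simp add: seq_assoc)
    then obtain w where w: "w \<in> arr P" "src P w = src P p'" "tgt P w = src P p"
        "seq P w p = seq P p' h" "seq P w q = q'"
      using pullback_factor [OF pb, of "seq P p' h" q'] p' by auto
    then obtain t where t: "t \<in> arr P" "src P t = src P p'" "tgt P t = src P r"
        "seq P t r = p'" "seq P t s = w"
      using pullback_factor [OF pb', of p' w] p' by auto
    then have "seq P t (seq P s q) = q'"
      using D D' w by (simp flip: seq_assoc)
    with t show "\<exists>u \<in> arr P. src P u = src P p' \<and> tgt P u = src P r \<and> seq P u r = p' \<and>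
        seq P u (seq P s q) = q'"
      by blast
  next
    fix u v assume u: "u \<in> arr P" "v \<in> arr P" "src P v = src P u" "tgt P u = src P r"
      "tgt P v = src P r" "seq P u r = seq P v r" "seq P u (seq P s q) = seq P v (seq P s q)"
    have e: "seq P (seq P w s) p = seq P (seq P w r) h" if "w \<in> arr P" "tgt P w = src P r" for w
      using D D' that by (simp add: seq_assoc)
    have "seq P (seq P u s) p = seq P (seq P v s) p"
      using u e by simp
    moreover have "seq P (seq P u s) q = seq P (seq P v s) q"
      using D D' u by (simp add: seq_assoc)
    ultimately have "seq P u s = seq P v s"
      using pullback_cancel [OF pb, of "seq P u s" "seq P v s"] D D' u by simp
    then show "u = v"
      using pullback_cancel [OF pb', of u v] D D' u by simp
  }
qed

lemma pullback_idn: "f \<in> arr P \<Longrightarrow> pullback_sq P f (idn P (tgt P f)) (idn P (src P f)) f"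
  by (rule pullback_sqI) auto

lemma pullback_iso:
  assumes "f \<in> arr P" "u \<in> arr P" "v \<in> arr P" "src P v = tgt P u" "tgt P v = src P u"
    "tgt P u = tgt P f" "seq P u v = idn P (src P u)" "seq P v u = idn P (tgt P u)"
  shows "pullback_sq P f u (idn P (src P f)) (seq P f v)"
proof (rule pullback_sqI)
  fix p' q' assume *: "p' \<in> arr P" "q' \<in> arr P" "src P q' = src P p'" "tgt P p' = src P f"
      "tgt P q' = src P u" "seq P p' f = seq P q' u"
  then have "seq P p' (seq P f v) = seq P (seq P q' u) v"
    using assms by (simp flip: seq_assoc)
  also have "\<dots> = q'"
    using assms * by (simp add: seq_assoc)
  finally show "\<exists>w\<in>arr P. src P w = src P p' \<and> tgt P w = src P (idn P (src P f)) \<and>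
      seq P w (idn P (src P f)) = p' \<and> seq P w (seq P f v) = q'"
    using * by (intro bexI [of _ p']) auto
qed (use assms in \<open>auto simp: seq_assoc\<close>)

lemma pullback_unique:
  assumes pb: "pullback_sq P f g p q" and pb': "pullback_sq P f g p' q'"
    and arr: "f \<in> arr P" "g \<in> arr P"
  obtains u where "iso_arr P u" "tgt P u = src P p" "src P u = src P p'" "p' = seq P u p" "q' = seq P u q"
proof -
  note D = pullback_sqD [OF pb] and D' = pullback_sqD [OF pb']
  obtain u where u: "u \<in> arr P" "src P u = src P p'" "tgt P u = src P p" "seq P u p = p'" "seq P u q = q'"
    using pullback_factor [OF pb, of p' q'] D' by auto
  obtain v where v: "v \<in> arr P" "src P v = src P p" "tgt P v = src P p'" "seq P v p' = p" "seq P v q' = q"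
    using pullback_factor [OF pb', of p q] D by auto
  have "seq P u v = idn P (src P p')"
    by (rule pullback_cancel [OF pb' arr]) (use u v D D' in \<open>simp_all add: seq_assoc\<close>)
  moreover have "seq P v u = idn P (src P p)"
    by (rule pullback_cancel [OF pb arr]) (use u v D D' in \<open>simp_all add: seq_assoc\<close>)
  ultimately have "iso_arr P u"
    using u v by (intro iso_arrI [of _ v]) auto
  with u that show ?thesis by blast
qed

text \<open>Pasting with the trivial pullback along the inverse \<open>v\<close> of \<open>u\<close>
  replaces the leg \<open>seq P u f\<close> by \<open>seq P v (seq P u f)\<close>, which is
  \<open>f\<close>.\<close>

lemma pullback_precompose_iso:
  assumes pb: "pullback_sq P (seq P u f) g p q" and u: "iso_arr P u" "tgt P u = src P f"
    and arr: "f \<in> arr P" "g \<in> arr P"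
  shows "pullback_sq P f g (seq P p u) q"
proof -
  from u(1) obtain v where v: "u \<in> arr P" "v \<in> arr P" "src P v = tgt P u" "tgt P v = src P u"
    "seq P u v = idn P (src P u)" "seq P v u = idn P (tgt P u)" "iso_arr P v"
    by (rule iso_arrE)
  note D = pullback_sqD [OF pb]
  have "pullback_sq P v p (seq P p u) (idn P (src P p))"
    by (rule pullback_sym [OF pullback_iso]) (use D v u arr in auto)
  then have "pullback_sq P (seq P v (seq P u f)) g (seq P p u) (seq P (idn P (src P p)) q)"
    by (intro pullback_paste [OF pb]) (use D v u arr in auto)
  moreover have "seq P v (seq P u f) = f"
    using v u arr by (intro seq_cancel) auto
  ultimately show ?thesis
    using D by simp
qed

lemma pullback_precompose_isos:
  assumes pb: "pullback_sq P (seq P u f) (seq P v g) p q" and u: "iso_arr P u" "tgt P u = src P f"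
    and v: "iso_arr P v" "tgt P v = src P g"
    and arr: "f \<in> arr P" "g \<in> arr P"
  shows "pullback_sq P f g (seq P p u) (seq P q v)"
proof -
  have "pullback_sq P f (seq P v g) (seq P p u) q"
    by (rule pullback_precompose_iso [OF pb]) (use u v arr in \<open>auto simp: iso_arr_arr\<close>)
  then have "pullback_sq P (seq P v g) f q (seq P p u)"
    by (rule pullback_sym) (use u v arr in \<open>auto simp: iso_arr_arr\<close>)
  then have "pullback_sq P g f (seq P q v) (seq P p u)"
    by (rule pullback_precompose_iso) (use u v arr in \<open>auto simp: iso_arr_arr\<close>)
  then show ?thesis
    by (rule pullback_sym) (use u v arr in \<open>auto simp: iso_arr_arr\<close>)
qed

section \<open>The operations of \<open>Span\<close> on representatives\<close>

lemma Span_src: "f \<in> arr P \<Longrightarrow> g \<in> arr P \<Longrightarrow> src P f = src P g \<Longrightarrow> src (Span P) (span_cls P f g) = tgt P f"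
  and Span_tgt: "f \<in> arr P \<Longrightarrow> g \<in> arr P \<Longrightarrow> src P f = src P g \<Longrightarrow> tgt (Span P) (span_cls P f g) = tgt P g"
proof -
  assume *: "f \<in> arr P" "g \<in> arr P" "src P f = src P g"
  have "tgt P f' = tgt P f \<and> tgt P g' = tgt P g" if "(f', g') \<in> span_cls P f g" for f' g'
  proof -
    from that obtain u where "iso_arr P u" "tgt P u = src P f" "f' = seq P u f" "g' = seq P u g"
      by (rule span_clsE)
    then show ?thesis
      using * by (simp add: iso_arr_arr)
  qed
  then have "case x of (f', g') \<Rightarrow> tgt P f' = tgt P f \<and> tgt P g' = tgt P g" if "x \<in> span_cls P f g" for x
    using that by auto
  then have "(\<lambda>(f, g). tgt P f) ` span_cls P f g = (\<lambda>_. tgt P f) ` span_cls P f g"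
      "(\<lambda>(f, g). tgt P g) ` span_cls P f g = (\<lambda>_. tgt P g) ` span_cls P f g"
    by (force intro!: image_cong)+
  then have "(\<lambda>(f, g). tgt P f) ` span_cls P f g = {tgt P f}"
      "(\<lambda>(f, g). tgt P g) ` span_cls P f g = {tgt P g}"
    using span_cls_self [OF *] by auto
  then show "src (Span P) (span_cls P f g) = tgt P f" "tgt (Span P) (span_cls P f g) = tgt P g"
    by (simp_all add: Span_def)
qed

text \<open>Two choices have to be shown harmless: other representatives are absorbed by
  \<open>pullback_precompose_isos\<close>, which makes their pullback a pullback of \<open>g\<close>
  and \<open>f'\<close>; the choice of a pullback is absorbed by
  \<open>pullback_unique\<close>.\<close>

lemma Span_seq:
  assumes arr: "f \<in> arr P" "g \<in> arr P" "f' \<in> arr P" "g' \<in> arr P" "src P f = src P g" "src P f' = src P g'"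
    and pb: "pullback_sq P g f' p q"
  shows "seq (Span P) (span_cls P f g) (span_cls P f' g') = span_cls P (seq P p f) (seq P q g')"
proof -
  note D = pullback_sqD [OF pb]
  have *: "span_cls P (seq P p2 f2) (seq P q2 g2') = span_cls P (seq P p f) (seq P q g')"
    if "(f2, g2) \<in> span_cls P f g" "(f2', g2') \<in> span_cls P f' g'" "pullback_sq P g2 f2' p2 q2"
    for f2 g2 f2' g2' p2 q2
  proof -
    from that(1) obtain u where u: "iso_arr P u" "tgt P u = src P f" "f2 = seq P u f" "g2 = seq P u g"
      by (rule span_clsE)
    from that(2) obtain v where v: "iso_arr P v" "tgt P v = src P f'" "f2' = seq P v f'" "g2' = seq P v g'"
      by (rule span_clsE)
    note [simp] = iso_arr_arr [OF u(1)] iso_arr_arr [OF v(1)]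
    note D2 = pullback_sqD [OF that(3)]
    have "pullback_sq P g f' (seq P p2 u) (seq P q2 v)"
      by (rule pullback_precompose_isos) (use that u v arr in simp_all)
    then obtain w where w: "iso_arr P w" "tgt P w = src P p"
        "seq P p2 u = seq P w p" "seq P q2 v = seq P w q"
      using pullback_unique [OF pb] arr by metis
    have "seq P p2 f2 = seq P (seq P p2 u) f" "seq P q2 g2' = seq P (seq P q2 v) g'"
      using D2 u v arr by (simp_all add: seq_assoc)
    then have "seq P p2 f2 = seq P w (seq P p f)" "seq P q2 g2' = seq P w (seq P q g')"
      using D w arr by (simp_all add: seq_assoc iso_arr_arr)
    then show ?thesis
      using D w arr by (simp add: span_cls_seq)
  qed
  \<comment> \<open>Equality of all members is not enough, since the union of an empty family would
    be empty; this gives a member.\<close>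
  have "\<exists>p q f2 g2 f2' g2'. (f2, g2) \<in> span_cls P f g \<and> (f2', g2') \<in> span_cls P f' g' \<and>
      pullback_sq P g2 f2' p q \<and> span_cls P (seq P p f2) (seq P q g2') = span_cls P (seq P p f) (seq P q g')"
    using span_cls_self [of f g] span_cls_self [of f' g'] arr pb by blast
  with * have "{span_cls P (seq P p f2) (seq P q g2') | p q f2 g2 f2' g2'.
      (f2, g2) \<in> span_cls P f g \<and> (f2', g2') \<in> span_cls P f' g' \<and> pullback_sq P g2 f2' p q} =
      {span_cls P (seq P p f) (seq P q g')}"
    by (intro equalityI subsetI; clarsimp) metis+
  then show ?thesis
    by (simp add: Span_def)
qed

lemma Span_tns:
  assumes arr: "f \<in> arr P" "g \<in> arr P" "f' \<in> arr P" "g' \<in> arr P" "src P f = src P g" "src P f' = src P g'"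
  shows "tns (Span P) (span_cls P f g) (span_cls P f' g') = span_cls P (tns P f f') (tns P g g')"
proof -
  have *: "span_cls P (tns P f2 f2') (tns P g2 g2') = span_cls P (tns P f f') (tns P g g')"
    if "(f2, g2) \<in> span_cls P f g" "(f2', g2') \<in> span_cls P f' g'" for f2 g2 f2' g2'
  proof -
    from that(1) obtain u where u: "iso_arr P u" "tgt P u = src P f" "f2 = seq P u f" "g2 = seq P u g"
      by (rule span_clsE)
    from that(2) obtain v where v: "iso_arr P v" "tgt P v = src P f'" "f2' = seq P v f'" "g2' = seq P v g'"
      by (rule span_clsE)
    have "tns P f2 f2' = seq P (tns P u v) (tns P f f')" "tns P g2 g2' = seq P (tns P u v) (tns P g g')"
      using u v arr by (simp_all add: tns_seq iso_arr_arr)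
    then show ?thesis
      using iso_tns [OF u(1) v(1)] u v arr by (simp add: span_cls_seq iso_arr_arr)
  qed
  have "\<exists>f2 g2 f2' g2'. (f2, g2) \<in> span_cls P f g \<and> (f2', g2') \<in> span_cls P f' g' \<and>
      span_cls P (tns P f2 f2') (tns P g2 g2') = span_cls P (tns P f f') (tns P g g')"
    using span_cls_self [of f g] span_cls_self [of f' g'] arr by blast
  with * have "{span_cls P (tns P f2 f2') (tns P g2 g2') | f2 g2 f2' g2'.
      (f2, g2) \<in> span_cls P f g \<and> (f2', g2') \<in> span_cls P f' g'} =
      {span_cls P (tns P f f') (tns P g g')}"
    by (intro equalityI subsetI; clarsimp) metis+
  then show ?thesis
    by (simp add: Span_def)
qed

lemma Span_arrI: "f \<in> arr P \<Longrightarrow> g \<in> arr P \<Longrightarrow> src P f = src P g \<Longrightarrow> span_cls P f g \<in> arr (Span P)"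
  by (auto simp: Span_def)

lemma Span_arrE:
  assumes "S \<in> arr (Span P)"
  obtains f g where "f \<in> arr P" "g \<in> arr P" "src P f = src P g" "S = span_cls P f g"
  using assms by (auto simp: Span_def)

lemma Span_idn: "idn (Span P) n = span_cls P (idn P n) (idn P n)"
  and Span_swp: "swp (Span P) n m = span_cls P (idn P (n + m)) (swp P n m)"
  by (simp_all add: Span_def)

text \<open>When one of the two inner legs is an identity, the pullback is trivial and the composite
  only lengthens an outer leg. This yields the unit laws and the functoriality of
  \<open>kappa1\<close>, and its mirror image that of \<open>kappa2\<close>.\<close>

lemma Span_seq_left:
  assumes "f \<in> arr P" "g \<in> arr P" "src P f = src P g" "h \<in> arr P" "tgt P g = src P h"
  shows "seq (Span P) (span_cls P f g) (span_cls P (idn P (src P h)) h) = span_cls P f (seq P g h)"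
  using assms pullback_idn [of g] by (subst Span_seq) auto

lemma Span_seq_right:
  assumes "f \<in> arr P" "g \<in> arr P" "src P f = src P g" "h \<in> arr P" "tgt P f = src P h"
  shows "seq (Span P) (span_cls P h (idn P (src P h))) (span_cls P f g) = span_cls P (seq P f h) g"
  using assms pullback_sym [OF pullback_idn [of f]] by (subst Span_seq) auto

text \<open>The inner legs are identities, so nothing has to be pulled back. Together with
  \<open>kappa_seq\<close>, where the opposite order does compute a pullback, this is what relates a
  cocone to spans; read in \<open>op_prop P\<close>, the two statements concern cospans and
  pushouts.\<close>

lemma span_cls_decompose:
  assumes "f \<in> arr P" "g \<in> arr P" "src P f = src P g"
  shows "seq (Span P) (kappa2 P f) (kappa1 P g) = span_cls P f g"
  unfolding kappa1_def kappa2_def using Span_seq_left [of f "idn P (src P f)" g] assms by simp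

lemma kappa_seq:
  assumes "f \<in> arr P" "g \<in> arr P" "tgt P f = tgt P g" "pullback_sq P f g p q"
  shows "seq (Span P) (kappa1 P f) (kappa2 P g) = span_cls P p q"
  unfolding kappa1_def kappa2_def using assms pullback_sqD [OF assms(4)]
  by (subst Span_seq) auto

end

section \<open>The PROP of spans\<close>

text \<open>The tensor of an abstract PROP has no universal property, so its compatibility with
  pullbacks is an assumption; it is what makes the interchange law hold for spans. For matrices it
  holds because \<open>dsum\<close> acts on the two blocks of a vector separately.\<close>

locale span_prop = is_prop +
  assumes pullback_ex: "\<lbrakk>f \<in> arr P; g \<in> arr P; tgt P f = tgt P g\<rbrakk> \<Longrightarrow> \<exists>p q. pullback_sq P f g p q"
    and pullback_tns: "\<lbrakk>f \<in> arr P; g \<in> arr P; tgt P f = tgt P g; f' \<in> arr P; g' \<in> arr P;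
      tgt P f' = tgt P g'; pullback_sq P f g p q; pullback_sq P f' g' p' q'\<rbrakk> \<Longrightarrow>
      pullback_sq P (tns P f f') (tns P g g') (tns P p p') (tns P q q')"
begin

text \<open>Both bracketings are represented by one iterated pullback: pasting on either side of the
  square \<open>pb2\<close> gives the pullback that each outer composition asks for.\<close>

lemma Span_seq_assoc:
  assumes f: "f1 \<in> arr P" "f2 \<in> arr P" "f3 \<in> arr P" and g: "g1 \<in> arr P" "g2 \<in> arr P" "g3 \<in> arr P"
    and s: "src P f1 = src P g1" "src P f2 = src P g2" "src P f3 = src P g3"
    and t: "tgt P g1 = tgt P f2" "tgt P g2 = tgt P f3"
  shows "seq (Span P) (seq (Span P) (span_cls P f1 g1) (span_cls P f2 g2)) (span_cls P f3 g3) =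
    seq (Span P) (span_cls P f1 g1) (seq (Span P) (span_cls P f2 g2) (span_cls P f3 g3))"
proof -
  obtain p q where pb: "pullback_sq P g1 f2 p q"
    using pullback_ex f g t by metis
  obtain p' q' where pb': "pullback_sq P g2 f3 p' q'"
    using pullback_ex f g t by metis
  note D = pullback_sqD [OF pb] and D' = pullback_sqD [OF pb']
  obtain r s where pb2: "pullback_sq P q p' r s"
    using pullback_ex D D' assms by metis
  note D2 = pullback_sqD [OF pb2]
  have left: "pullback_sq P (seq P q g2) f3 r (seq P s q')"
    by (rule pullback_paste [OF pb' pb2]) (use D D' assms in auto)
  have "pullback_sq P f2 g1 q p" "pullback_sq P p' q s r"
    by (rule pullback_sym [OF pb] pullback_sym [OF pb2]; use assms D D' in auto)+
  then have "pullback_sq P (seq P p' f2) g1 s (seq P r p)"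
    by (rule pullback_paste) (use D D' assms in auto)
  then have right: "pullback_sq P g1 (seq P p' f2) (seq P r p) s"
    by (rule pullback_sym) (use D D' assms in auto)
  show ?thesis
    using assms D D' D2 Span_seq [OF _ _ _ _ _ _ pb] Span_seq [OF _ _ _ _ _ _ pb']
      Span_seq [OF _ _ _ _ _ _ left] Span_seq [OF _ _ _ _ _ _ right]
    by (simp add: seq_assoc)
qed

lemma Span_seq_cls:
  assumes "f \<in> arr P" "g \<in> arr P" "f' \<in> arr P" "g' \<in> arr P" "src P f = src P g" "src P f' = src P g'"
    "tgt P g = tgt P f'"
  obtains p q where "pullback_sq P g f' p q" "p \<in> arr P" "q \<in> arr P" "src P q = src P p"
    "tgt P p = src P g" "tgt P q = src P f'"
    "seq (Span P) (span_cls P f g) (span_cls P f' g') = span_cls P (seq P p f) (seq P q g')"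
proof -
  obtain p q where pb: "pullback_sq P g f' p q"
    using pullback_ex assms by metis
  note D = pullback_sqD [OF pb]
  show ?thesis
    using that [OF pb D(1-5)] Span_seq [OF assms(1-6) pb] by blast
qed

lemma Span_tns_seq:
  assumes f: "f1 \<in> arr P" "f2 \<in> arr P" "f3 \<in> arr P" "f4 \<in> arr P"
    and g: "g1 \<in> arr P" "g2 \<in> arr P" "g3 \<in> arr P" "g4 \<in> arr P"
    and s: "src P f1 = src P g1" "src P f2 = src P g2" "src P f3 = src P g3" "src P f4 = src P g4"
    and t: "tgt P g1 = tgt P f2" "tgt P g3 = tgt P f4"
  shows "tns (Span P) (seq (Span P) (span_cls P f1 g1) (span_cls P f2 g2))
      (seq (Span P) (span_cls P f3 g3) (span_cls P f4 g4)) =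
    seq (Span P) (tns (Span P) (span_cls P f1 g1) (span_cls P f3 g3))
      (tns (Span P) (span_cls P f2 g2) (span_cls P f4 g4))"
proof -
  obtain p q where pb: "pullback_sq P g1 f2 p q"
    using pullback_ex f g t by metis
  obtain p' q' where pb': "pullback_sq P g3 f4 p' q'"
    using pullback_ex f g t by metis
  note D = pullback_sqD [OF pb] and D' = pullback_sqD [OF pb']
  have pb2: "pullback_sq P (tns P g1 g3) (tns P f2 f4) (tns P p p') (tns P q q')"
    by (rule pullback_tns) (use assms pb pb' in auto)
  show ?thesis
    using assms D D' Span_seq [OF _ _ _ _ _ _ pb] Span_seq [OF _ _ _ _ _ _ pb']
      Span_seq [OF _ _ _ _ _ _ pb2]
    by (simp add: Span_tns tns_seq)
qed

text \<open>The right side needs a pullback along a symmetry, which is trivial because symmetries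
  are invertible. The two resulting spans differ by the isomorphism \<open>?s\<close> of their
  apexes, by naturality in \<open>P\<close> for each of the two legs.\<close>

lemma Span_swp_natural:
  assumes "f \<in> arr P" "g \<in> arr P" "f' \<in> arr P" "g' \<in> arr P" "src P f = src P g" "src P f' = src P g'"
  shows "seq (Span P) (tns (Span P) (span_cls P f g) (span_cls P f' g')) (swp (Span P) (tgt P g) (tgt P g')) =
    seq (Span P) (swp (Span P) (tgt P f) (tgt P f')) (tns (Span P) (span_cls P f' g') (span_cls P f g))"
proof -
  let ?s = "swp P (src P f) (src P f')"
  have pb: "pullback_sq P (swp P (tgt P f) (tgt P f')) (tns P f' f)
      (seq P (tns P f' f) (swp P (tgt P f') (tgt P f))) (idn P (src P f' + src P f))"
    using pullback_iso [of "tns P f' f" "swp P (tgt P f) (tgt P f')" "swp P (tgt P f') (tgt P f)"] assms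
    by - (rule pullback_sym, simp_all add: swp_inverse add.commute)
  have "seq (Span P) (tns (Span P) (span_cls P f g) (span_cls P f' g')) (swp (Span P) (tgt P g) (tgt P g')) =
      span_cls P (tns P f f') (seq P (tns P g g') (swp P (tgt P g) (tgt P g')))"
    using assms Span_seq_left [of "tns P f f'" "tns P g g'" "swp P (tgt P g) (tgt P g')"]
    by (simp add: Span_tns Span_swp)
  also have "\<dots> = span_cls P (tns P f f') (seq P ?s (tns P g' g))"
    using assms by (simp add: swp_natural)
  also have "tns P f f' = seq P ?s (seq P (tns P f' f) (swp P (tgt P f') (tgt P f)))"
  proof -
    have "seq P ?s (seq P (tns P f' f) (swp P (tgt P f') (tgt P f))) =
        seq P ?s (seq P (swp P (src P f') (src P f)) (tns P f f'))"
      using assms by (simp add: swp_natural)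
    also have "\<dots> = tns P f f'"
      using assms by (intro seq_cancel) (simp_all add: swp_inverse)
    finally show ?thesis ..
  qed
  also have "span_cls P \<dots> (seq P ?s (tns P g' g)) =
      span_cls P (seq P (tns P f' f) (swp P (tgt P f') (tgt P f))) (tns P g' g)"
    using assms by (intro span_cls_seq) simp_all
  also have "\<dots> = seq (Span P) (swp (Span P) (tgt P f) (tgt P f'))
      (tns (Span P) (span_cls P f' g') (span_cls P f g))"
    using assms Span_seq [OF _ _ _ _ _ _ pb, of "idn P (tgt P f + tgt P f')" "tns P g' g"]
    by (simp add: Span_tns Span_swp add.commute)
  finally show ?thesis .
qed

lemma kappa1_seq:
  assumes "f \<in> arr P" "g \<in> arr P" "tgt P f = src P g"
  shows "seq (Span P) (kappa1 P f) (kappa1 P g) = kappa1 P (seq P f g)"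
  using assms Span_seq_left [of "idn P (src P f)" f g] by (simp add: kappa1_def)

lemma kappa2_seq:
  assumes "f \<in> arr P" "g \<in> arr P" "tgt P f = src P g"
  shows "seq (Span P) (kappa2 P g) (kappa2 P f) = kappa2 P (seq P f g)"
  using assms Span_seq_right [of f "idn P (src P f)" g] by (simp add: kappa2_def)

lemma kappa_tns:
  assumes "f \<in> arr P" "g \<in> arr P"
  shows "tns (Span P) (kappa1 P f) (kappa1 P g) = kappa1 P (tns P f g)"
    and "tns (Span P) (kappa2 P f) (kappa2 P g) = kappa2 P (tns P f g)"
  using assms by (simp_all add: kappa1_def kappa2_def Span_tns tns_idn)

lemma kappa_arr:
  assumes "f \<in> arr P"
  shows "kappa1 P f \<in> arr (Span P)" "src (Span P) (kappa1 P f) = src P f" "tgt (Span P) (kappa1 P f) = tgt P f"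
    "kappa2 P f \<in> arr (Span P)" "src (Span P) (kappa2 P f) = tgt P f" "tgt (Span P) (kappa2 P f) = src P f"
  using assms by (simp_all add: kappa1_def kappa2_def Span_src Span_tgt Span_arrI)

lemma kappa_idn: "idn (Span P) n = kappa1 P (idn P n)" "idn (Span P) n = kappa2 P (idn P n)"
  by (simp_all add: kappa1_def kappa2_def Span_idn)

lemma kappa1_swp: "swp (Span P) n m = kappa1 P (swp P n m)"
  by (simp_all add: kappa1_def Span_swp)

text \<open>\<open>swp (Span P)\<close> carries the symmetry on its right leg, \<open>kappa2\<close>
  on its left; the isomorphism \<open>swp P n m\<close> of apexes moves it across.\<close>

lemma kappa2_swp: "swp (Span P) n m = kappa2 P (swp P m n)"
proof -
  have "span_cls P (seq P (swp P n m) (swp P m n)) (seq P (swp P n m) (idn P (m + n))) =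
      span_cls P (swp P m n) (idn P (m + n))"
    by (rule span_cls_seq) simp_all
  then show ?thesis
    by (simp add: kappa2_def Span_swp swp_inverse add.commute)
qed

lemma Span_is_prop: "is_prop (Span P)"
proof
  fix S assume "S \<in> arr (Span P)"
  then obtain f g where S: "f \<in> arr P" "g \<in> arr P" "src P f = src P g" "S = span_cls P f g"
    by (rule Span_arrE)
  show "seq (Span P) (idn (Span P) (src (Span P) S)) S = S"
    using S Span_seq_right [of f g "idn P (tgt P f)"] by (simp add: Span_src Span_idn)
  show "seq (Span P) S (idn (Span P) (tgt (Span P) S)) = S"
    using S Span_seq_left [of f g "idn P (tgt P g)"] by (simp add: Span_tgt Span_idn)
  show "tns (Span P) (idn (Span P) 0) S = S" "tns (Span P) S (idn (Span P) 0) = S"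
    using S by (simp_all add: Span_idn Span_tns tns_unit)
next
  fix S T assume "S \<in> arr (Span P)" "T \<in> arr (Span P)"
  then obtain f g f' g' where S: "f \<in> arr P" "g \<in> arr P" "src P f = src P g" "S = span_cls P f g"
    and T: "f' \<in> arr P" "g' \<in> arr P" "src P f' = src P g'" "T = span_cls P f' g'"
    by (elim Span_arrE)
  show "tns (Span P) S T \<in> arr (Span P)"
    "src (Span P) (tns (Span P) S T) = src (Span P) S + src (Span P) T"
    "tgt (Span P) (tns (Span P) S T) = tgt (Span P) S + tgt (Span P) T"
    using S T by (simp_all add: Span_tns Span_src Span_tgt Span_arrI)
  show "seq (Span P) (tns (Span P) S T) (swp (Span P) (tgt (Span P) S) (tgt (Span P) T)) =
      seq (Span P) (swp (Span P) (src (Span P) S) (src (Span P) T)) (tns (Span P) T S)"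
    using S T Span_swp_natural [of f g f' g'] by (simp add: Span_src Span_tgt)
  assume "tgt (Span P) S = src (Span P) T"
  then have "tgt P g = tgt P f'"
    using S T by (simp add: Span_src Span_tgt)
  with S T obtain p q where "p \<in> arr P" "q \<in> arr P" "src P q = src P p"
    "tgt P p = src P g" "tgt P q = src P f'"
    "seq (Span P) S T = span_cls P (seq P p f) (seq P q g')"
    using Span_seq_cls [of f g f' g'] by metis
  with S T show "seq (Span P) S T \<in> arr (Span P)" "src (Span P) (seq (Span P) S T) = src (Span P) S"
    "tgt (Span P) (seq (Span P) S T) = tgt (Span P) T"
    by (simp_all add: Span_arrI Span_src Span_tgt)
next
  fix S T U assume "S \<in> arr (Span P)" "T \<in> arr (Span P)" "U \<in> arr (Span P)"
  then obtain f1 g1 f2 g2 f3 g3 where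
        S: "f1 \<in> arr P" "g1 \<in> arr P" "src P f1 = src P g1" "S = span_cls P f1 g1"
    and T: "f2 \<in> arr P" "g2 \<in> arr P" "src P f2 = src P g2" "T = span_cls P f2 g2"
    and U: "f3 \<in> arr P" "g3 \<in> arr P" "src P f3 = src P g3" "U = span_cls P f3 g3"
    by (elim Span_arrE)
  show "tns (Span P) (tns (Span P) S T) U = tns (Span P) S (tns (Span P) T U)"
    using S T U by (simp add: Span_tns tns_assoc)
  assume "tgt (Span P) S = src (Span P) T" "tgt (Span P) T = src (Span P) U"
  then show "seq (Span P) (seq (Span P) S T) U = seq (Span P) S (seq (Span P) T U)"
    using S T U Span_seq_assoc [of f1 f2 f3 g1 g2 g3] by (simp add: Span_src Span_tgt)
next
  fix S T U V assume "S \<in> arr (Span P)" "T \<in> arr (Span P)" "U \<in> arr (Span P)" "V \<in> arr (Span P)"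
  then obtain f1 g1 f2 g2 f3 g3 f4 g4 where
        S: "f1 \<in> arr P" "g1 \<in> arr P" "src P f1 = src P g1" "S = span_cls P f1 g1"
    and T: "f2 \<in> arr P" "g2 \<in> arr P" "src P f2 = src P g2" "T = span_cls P f2 g2"
    and U: "f3 \<in> arr P" "g3 \<in> arr P" "src P f3 = src P g3" "U = span_cls P f3 g3"
    and V: "f4 \<in> arr P" "g4 \<in> arr P" "src P f4 = src P g4" "V = span_cls P f4 g4"
    by (elim Span_arrE)
  assume "tgt (Span P) S = src (Span P) T" "tgt (Span P) U = src (Span P) V"
  then show "tns (Span P) (seq (Span P) S T) (seq (Span P) U V) =
      seq (Span P) (tns (Span P) S U) (tns (Span P) T V)"
    using S T U V Span_tns_seq [of f1 f2 f3 f4 g1 g2 g3 g4] by (simp add: Span_src Span_tgt)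
next
  \<comment> \<open>Laws that involve only identities and symmetries are images under
    \<open>kappa1\<close> of the same laws in \<open>P\<close>.\<close>
  fix n m k
  show "idn (Span P) n \<in> arr (Span P)" "src (Span P) (idn (Span P) n) = n"
      "tgt (Span P) (idn (Span P) n) = n"
    by (simp_all add: kappa_idn(1) kappa_arr)
  show "swp (Span P) n m \<in> arr (Span P)" "src (Span P) (swp (Span P) n m) = n + m"
      "tgt (Span P) (swp (Span P) n m) = m + n"
    by (simp_all add: kappa1_swp kappa_arr)
  show "tns (Span P) (idn (Span P) n) (idn (Span P) m) = idn (Span P) (n + m)"
    by (simp add: kappa_idn(1) kappa_tns tns_idn)
  show "seq (Span P) (swp (Span P) n m) (swp (Span P) m n) = idn (Span P) (n + m)"
    by (simp add: kappa_idn(1) kappa1_swp kappa1_seq swp_inverse)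
  show "swp (Span P) n 0 = idn (Span P) n"
    by (simp add: kappa_idn(1) kappa1_swp swp_unit)
  show "swp (Span P) n (m + k) = seq (Span P) (tns (Span P) (swp (Span P) n m) (idn (Span P) k))
      (tns (Span P) (idn (Span P) m) (swp (Span P) n k))"
    by (simp add: kappa_idn(1) kappa1_swp kappa1_seq kappa_tns swp_hexagon)
qed

lemma kappa1_morphism: "prop_morphism P (Span P) (kappa1 P)"
  by (simp add: prop_morphism_def kappa_arr kappa1_seq kappa_tns kappa_idn(1) kappa1_swp)

lemma kappa2_morphism: "prop_morphism (op_prop P) (Span P) (kappa2 P)"
  by (simp add: prop_morphism_def op_prop_simps kappa_arr kappa2_seq kappa_tns kappa_idn(2) kappa2_swp)

end

section \<open>Cospans as spans in the opposite PROP\<close>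

context is_prop
begin

lemma iso_arr_op: "iso_arr (op_prop P) u = iso_arr P u"
  unfolding iso_arr_def op_prop_simps by blast

lemma pushout_sq_op: "pushout_sq P f g p q = pullback_sq (op_prop P) f g p q"
  unfolding pushout_sq_def pullback_sq_def op_prop_simps by (simp only: conj_ac)

lemma cospan_cls_op: "cospan_cls P f g = span_cls (op_prop P) f g"
  by (simp add: cospan_cls_def span_cls_def op_prop_simps iso_arr_op)

text \<open>The indices cross: \<open>iota1\<close> has its identity on the right leg, as
  \<open>kappa2\<close> does, and reversing the arrows leaves the sides of the legs
  unchanged.\<close>

lemma iota_op: "iota1 P f = kappa2 (op_prop P) f" "iota2 P f = kappa1 (op_prop P) f"
  by (simp_all add: iota1_def iota2_def kappa1_def kappa2_def cospan_cls_op op_prop_simps)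

text \<open>An equality of records. All fields match after unfolding except the symmetry, which
  \<open>Cospan\<close> puts on the left leg and \<open>Span\<close> on the right; the two describe
  one isomorphism class.\<close>

lemma Cospan_op: "Cospan P = Span (op_prop P)"
proof -
  interpret op: is_prop "op_prop P" by (rule op_is_prop)
  have "span_cls (op_prop P) (swp P n m) (idn P (m + n)) =
      span_cls (op_prop P) (idn P (n + m)) (swp P m n)" for n m
    using op.span_cls_seq [of "swp P n m" "idn P (m + n)" "swp P m n", unfolded op_prop_simps]
    by (simp add: swp_inverse iso_arr_op add.commute)
  then show ?thesis
    unfolding Cospan_def Span_def cospan_cls_op pushout_sq_op op_prop_simps by simp
qed

lemma op_op: "op_prop (op_prop P) = P"
  by (simp add: op_prop_def)

end

section \<open>Transport along an isomorphism of PROPs\<close>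

lemma prop_morphismD:
  assumes "prop_morphism P Q F"
  shows "f \<in> arr P \<Longrightarrow> F f \<in> arr Q" "f \<in> arr P \<Longrightarrow> src Q (F f) = src P f"
    "f \<in> arr P \<Longrightarrow> tgt Q (F f) = tgt P f" "F (idn P n) = idn Q n"
    "\<lbrakk>f \<in> arr P; g \<in> arr P; tgt P f = src P g\<rbrakk> \<Longrightarrow> F (seq P f g) = seq Q (F f) (F g)"
    "\<lbrakk>f \<in> arr P; g \<in> arr P\<rbrakk> \<Longrightarrow> F (tns P f g) = tns Q (F f) (F g)"
    "F (swp P n m) = swp Q n m"
  using assms unfolding prop_morphism_def by blast+

text \<open>A cone in \<open>Q\<close> is carried back by \<open>T'\<close>, mediated in
  \<open>P\<close>, and the mediating arrow is carried forward by \<open>T\<close>. The intended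
  instance has transposition in both roles.\<close>

lemma pullback_transport:
  assumes P: "is_prop P" and Q: "is_prop Q" and T: "prop_morphism P Q T" and T': "prop_morphism Q P T'"
    and inv: "\<And>f. f \<in> arr P \<Longrightarrow> T' (T f) = f" "\<And>f. f \<in> arr Q \<Longrightarrow> T (T' f) = f"
    and arr: "f \<in> arr P" "g \<in> arr P" and pb: "pullback_sq P f g p q"
  shows "pullback_sq Q (T f) (T g) (T p) (T q)"
proof -
  interpret P: is_prop P by fact
  interpret Q: is_prop Q by fact
  note D = P.pullback_sqD [OF pb] and TD [simp] = prop_morphismD [OF T] and TD' [simp] = prop_morphismD [OF T']
  show ?thesis
  proof (rule Q.pullback_sqI)
    show "seq Q (T p) (T f) = seq Q (T q) (T g)"
      using D arr TD(5) by metis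
  next
    fix p' q' assume *: "p' \<in> arr Q" "q' \<in> arr Q" "src Q q' = src Q p'" "tgt Q p' = src Q (T f)"
      "tgt Q q' = src Q (T g)" "seq Q p' (T f) = seq Q q' (T g)"
    have "seq P (T' p') f = T' (seq Q p' (T f))" "seq P (T' q') g = T' (seq Q q' (T g))"
      using TD'(5) [of p' "T f"] TD'(5) [of q' "T g"] * arr by (simp_all add: inv)
    then have "seq P (T' p') f = seq P (T' q') g"
      using * by simp
    then obtain u where u: "u \<in> arr P" "src P u = src P (T' p')" "tgt P u = src P p"
        "seq P u p = T' p'" "seq P u q = T' q'"
      using P.pullback_factor [OF pb, of "T' p'" "T' q'"] * arr by auto
    have "seq Q (T u) (T p) = T (T' p')" "seq Q (T u) (T q) = T (T' q')"
      using u D arr TD(5) by metis+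
    then show "\<exists>u\<in>arr Q. src Q u = src Q p' \<and> tgt Q u = src Q (T p) \<and> seq Q u (T p) = p' \<and> seq Q u (T q) = q'"
      using u * D by (intro bexI [of _ "T u"]) (simp_all add: inv)
  next
    fix u v assume *: "u \<in> arr Q" "v \<in> arr Q" "tgt Q u = src Q (T p)" "tgt Q v = src Q (T p)"
      "seq Q u (T p) = seq Q v (T p)" "seq Q u (T q) = seq Q v (T q)"
    have T'w: "T' (seq Q w (T p)) = seq P (T' w) p" "T' (seq Q w (T q)) = seq P (T' w) q"
      if "w \<in> arr Q" "tgt Q w = src Q (T p)" for w
      using that D TD'(5) [of w "T p"] TD'(5) [of w "T q"] by (simp_all add: inv)
    have "seq P (T' u) p = seq P (T' v) p" "seq P (T' u) q = seq P (T' v) q"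
      using arg_cong [OF *(5), of T'] arg_cong [OF *(6), of T']
      unfolding T'w [OF *(1,3)] T'w [OF *(2,4)] .
    then have "T' u = T' v"
      using * D by - (rule P.pullback_cancel [OF pb arr], simp_all)
    then show "u = v"
      using inv(2) * by metis
  qed (use D arr in simp_all)
qed

lemma span_prop_transport:
  assumes P: "span_prop P" and Q: "is_prop Q" and T: "prop_morphism P Q T" and T': "prop_morphism Q P T'"
    and inv: "\<And>f. f \<in> arr P \<Longrightarrow> T' (T f) = f" "\<And>f. f \<in> arr Q \<Longrightarrow> T (T' f) = f"
  shows "span_prop Q"
proof -
  interpret P: span_prop P by fact
  interpret Q: is_prop Q by fact
  note TD = prop_morphismD [OF T] and TD' = prop_morphismD [OF T']
  have fwd: "pullback_sq Q (T f) (T g) (T p) (T q)"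
    if "f \<in> arr P" "g \<in> arr P" "pullback_sq P f g p q" for f g p q
    by (rule pullback_transport [OF P.is_prop_axioms Q T T' _ _ that]) (auto simp: inv)
  have bwd: "pullback_sq P (T' f) (T' g) (T' p) (T' q)"
    if "f \<in> arr Q" "g \<in> arr Q" "pullback_sq Q f g p q" for f g p q
    by (rule pullback_transport [OF Q P.is_prop_axioms T' T _ _ that]) (auto simp: inv)
  show ?thesis
  proof
    fix f g assume *: "f \<in> arr Q" "g \<in> arr Q" "tgt Q f = tgt Q g"
    then obtain p q where "pullback_sq P (T' f) (T' g) p q"
      using P.pullback_ex [of "T' f" "T' g"] TD' by auto
    from fwd [OF _ _ this] show "\<exists>p q. pullback_sq Q f g p q"
      using * inv TD' by auto
  next
    fix f g f' g' p q p' q'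
    assume *: "f \<in> arr Q" "g \<in> arr Q" "tgt Q f = tgt Q g" "f' \<in> arr Q" "g' \<in> arr Q" "tgt Q f' = tgt Q g'"
      and pb: "pullback_sq Q f g p q" "pullback_sq Q f' g' p' q'"
    have "pullback_sq P (tns P (T' f) (T' f')) (tns P (T' g) (T' g')) (tns P (T' p) (T' p')) (tns P (T' q) (T' q'))"
      by (rule P.pullback_tns) (use * TD' bwd pb in auto)
    then have "pullback_sq Q (T (tns P (T' f) (T' f'))) (T (tns P (T' g) (T' g')))
        (T (tns P (T' p) (T' p'))) (T (tns P (T' q) (T' q')))"
      by (intro fwd) (use * TD' in auto)
    then show "pullback_sq Q (tns Q f f') (tns Q g g') (tns Q p p') (tns Q q q')"
      using * Q.pullback_sqD [OF pb(1)] Q.pullback_sqD [OF pb(2)] by (simp add: TD TD' inv)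
  qed
qed

section \<open>Block matrices and the PROP of matrices\<close>

text \<open>Tensor and symmetry of \<open>Mat\<close> get names so that the blocks stay folded;
  afterwards they are used mainly through their action on concatenated vectors.\<close>

definition dsum :: "'a::zero mat \<Rightarrow> 'a mat \<Rightarrow> 'a mat" where
  "dsum A B = four_block_mat A (0\<^sub>m (dim_row A) (dim_col B)) (0\<^sub>m (dim_row B) (dim_col A)) B"

definition swap_mat :: "nat \<Rightarrow> nat \<Rightarrow> 'a::{zero,one} mat" where
  "swap_mat n m = four_block_mat (0\<^sub>m m n) (1\<^sub>m m) (1\<^sub>m n) (0\<^sub>m n m)"

lemma Mat_simps [simp]:
  "arr Mat = UNIV" "src Mat = dim_col" "tgt Mat = dim_row" "idn Mat = 1\<^sub>m" "seq Mat A B = B * A"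
  "tns Mat = dsum" "swp Mat = swap_mat"
  by (simp_all add: Mat_def dsum_def swap_mat_def fun_eq_iff)

lemma dsum_dim [simp]: "dim_row (dsum A B) = dim_row A + dim_row B" "dim_col (dsum A B) = dim_col A + dim_col B"
  by (simp_all add: dsum_def)

lemma swap_mat_dim [simp]: "dim_row (swap_mat n m) = m + n" "dim_col (swap_mat n m) = n + m"
  by (simp_all add: swap_mat_def)

lemma vec_splitE:
  assumes "v \<in> carrier_vec (n + m)"
  obtains x y where "x \<in> carrier_vec n" "y \<in> carrier_vec m" "v = x @\<^sub>v y"
  using assms vec_first_last_append [of v n m] vec_first_carrier vec_last_carrier by metis

lemma append_vec_inject:
  "dim_vec x = dim_vec x' \<Longrightarrow> x @\<^sub>v y = x' @\<^sub>v y' \<longleftrightarrow> x = x' \<and> y = y'"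
  by (rule append_vec_eq [of _ "dim_vec x"]) (auto intro: carrier_vecI)

lemma append_vec_assoc: "(x @\<^sub>v y) @\<^sub>v z = x @\<^sub>v (y @\<^sub>v z)"
  by (rule eq_vecI) auto

lemma zero_append_zero [simp]: "0\<^sub>v n @\<^sub>v 0\<^sub>v m = 0\<^sub>v (n + m)"
  by (rule eq_vecI) auto

lemma smult_append: "c \<cdot>\<^sub>v (x @\<^sub>v y) = c \<cdot>\<^sub>v x @\<^sub>v c \<cdot>\<^sub>v y"
  by (rule eq_vecI) auto

lemma dsum_mult_vec:
  assumes "x \<in> carrier_vec (dim_col A)" "y \<in> carrier_vec (dim_col B)"
  shows "dsum A B *\<^sub>v (x @\<^sub>v y) = (A *\<^sub>v x) @\<^sub>v ((B :: 'a::semiring_0 mat) *\<^sub>v y)"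
  unfolding dsum_def using assms
  by (subst four_block_mat_mult_vec [of _ "dim_row A" "dim_col A" _ "dim_col B" _ "dim_row B"]) auto

lemma swap_mat_mult_vec:
  assumes "x \<in> carrier_vec n" "y \<in> carrier_vec m"
  shows "swap_mat n m *\<^sub>v (x @\<^sub>v y) = y @\<^sub>v (x :: 'a::semiring_1 vec)"
  unfolding swap_mat_def using assms
  by (subst four_block_mat_mult_vec [of _ m n _ m _ n]) auto

lemma mat_ext_cols:
  assumes "dim_row A = dim_row B" "dim_col A = dim_col B" "\<And>j. j < dim_col B \<Longrightarrow> col A j = col B j"
  shows "A = B"
  using assms by (intro mat_col_eqI) auto

lemma mult_unit_vec:
  fixes A :: "'a::comm_ring_1 mat"
  shows "j < dim_col A \<Longrightarrow> A *\<^sub>v unit_vec (dim_col A) j = col A j"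
  by (rule eq_vecI) auto

lemma mat_ext_vec:
  fixes A :: "'a::comm_ring_1 mat"
  assumes dim: "dim_row A = dim_row B" "dim_col A = dim_col B"
    and *: "\<And>v. v \<in> carrier_vec (dim_col B) \<Longrightarrow> A *\<^sub>v v = B *\<^sub>v v"
  shows "A = B"
proof (rule mat_ext_cols)
  fix j assume "j < dim_col B"
  then show "col A j = col B j"
    using * [of "unit_vec (dim_col B) j"] dim mult_unit_vec [of j A] mult_unit_vec [of j B] by simp
qed (use dim in auto)

lemma mult_mat_vec_in_carrier [simp]: "A *\<^sub>v v \<in> carrier_vec n \<longleftrightarrow> dim_row A = n"
  by (metis carrier_vecD carrier_vecI dim_mult_mat_vec)

lemma mult_mat_zero_vec: "dim_col A = n \<Longrightarrow> A *\<^sub>v 0\<^sub>v n = 0\<^sub>v (dim_row A)"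
  by (rule eq_vecI) auto

lemma mult_mat_vec_smult:
  fixes A :: "'a::comm_ring_1 mat"
  shows "dim_col A = dim_vec v \<Longrightarrow> A *\<^sub>v (c \<cdot>\<^sub>v v) = c \<cdot>\<^sub>v (A *\<^sub>v v)"
  by (rule eq_vecI) (auto simp: scalar_prod_def sum_distrib_left ac_simps)

lemma col_mult_dim: "dim_col A = dim_row B \<Longrightarrow> j < dim_col B \<Longrightarrow> col (A * B) j = A *\<^sub>v col B j"
  by (rule col_mult2 [of _ "dim_row A" "dim_row B" _ "dim_col B"]) auto

lemma mult_mat_vec_assoc:
  "dim_col A = dim_row B \<Longrightarrow> dim_col B = dim_vec v \<Longrightarrow> (A * B) *\<^sub>v v = A *\<^sub>v (B *\<^sub>v (v :: 'a::semiring_0 vec))"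
  by (rule assoc_mult_mat_vec [of _ "dim_row A" "dim_row B" _ "dim_col B"]) (auto intro: carrier_vecI)

text \<open>A matrix is determined by its action on vectors, and every vector of length
  \<open>n + m\<close> is a concatenation. Identities between \<open>dsum\<close> and
  \<open>swap_mat\<close> thereby reduce to rearranging blocks of a vector.\<close>

lemma mat_ext_append:
  fixes A :: "'a::comm_ring_1 mat"
  assumes dim: "dim_row A = dim_row B" "dim_col A = n + m" "dim_col B = n + m"
    and *: "\<And>x y. x \<in> carrier_vec n \<Longrightarrow> y \<in> carrier_vec m \<Longrightarrow> A *\<^sub>v (x @\<^sub>v y) = B *\<^sub>v (x @\<^sub>v y)"
  shows "A = B"
proof (rule mat_ext_vec)
  fix v :: "'a vec" assume "v \<in> carrier_vec (dim_col B)"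
  then obtain x y where "x \<in> carrier_vec n" "y \<in> carrier_vec m" "v = x @\<^sub>v y"
    using dim by (auto elim: vec_splitE)
  then show "A *\<^sub>v v = B *\<^sub>v v"
    using * by simp
qed (use dim in auto)

lemma dsum_mult:
  fixes A :: "'a::comm_ring_1 mat"
  assumes "dim_col A = dim_row A'" "dim_col B = dim_row B'"
  shows "dsum A B * dsum A' B' = dsum (A * A') (B * B')"
  by (rule mat_ext_append [of _ _ "dim_col A'" "dim_col B'"])
    (use assms in \<open>simp_all add: mult_mat_vec_assoc dsum_mult_vec\<close>)

lemma dsum_assoc: "dsum (dsum A B) C = dsum A (dsum B C)"
  using assoc_four_block_mat [of A B C] by (simp add: dsum_def)

lemma dsum_one: "dsum (1\<^sub>m n) (1\<^sub>m m) = 1\<^sub>m (n + m)"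
  by (simp add: dsum_def)

lemma transpose_dsum: "(dsum A B)\<^sup>T = dsum A\<^sup>T B\<^sup>T"
  unfolding dsum_def by (subst transpose_four_block_mat [of _ "dim_row A" "dim_col A" _ "dim_col B" _ "dim_row B"]) auto

lemma transpose_swap_mat: "(swap_mat n m)\<^sup>T = swap_mat m n"
  unfolding swap_mat_def by (subst transpose_four_block_mat [of _ m n _ m _ n]) auto

lemma Mat_is_prop: "is_prop (Mat :: 'a::comm_ring_1 mat prop_data)"
proof (unfold_locales, unfold Mat_simps)
  fix A B :: "'a mat"
  show "swap_mat (dim_row A) (dim_row B) * dsum A B = dsum B A * swap_mat (dim_col A) (dim_col B)"
    by (rule mat_ext_append [of _ _ "dim_col A" "dim_col B"])
      (simp_all add: mult_mat_vec_assoc dsum_mult_vec swap_mat_mult_vec)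
next
  fix n m k
  show "swap_mat m n * swap_mat n m = (1\<^sub>m (n + m) :: 'a mat)"
    by (rule mat_ext_append [of _ _ n m])
      (simp_all add: mult_mat_vec_assoc swap_mat_mult_vec)
  show "swap_mat n 0 = (1\<^sub>m n :: 'a mat)"
    unfolding swap_mat_def by (rule eq_matI) auto
  \<comment> \<open>On a vector of three blocks both sides move the first block behind the other
    two.\<close>
  show "swap_mat n (m + k) = dsum (1\<^sub>m m) (swap_mat n k) * (dsum (swap_mat n m) (1\<^sub>m k) :: 'a mat)"
  proof (rule mat_ext_vec; simp)
    fix v :: "'a vec" assume "v \<in> carrier_vec (n + m + k)"
    then obtain x y z where xyz: "x \<in> carrier_vec n" "y \<in> carrier_vec m" "z \<in> carrier_vec k"
      and v: "v = (x @\<^sub>v y) @\<^sub>v z"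
      by (metis vec_splitE)
    have "swap_mat n (m + k) *\<^sub>v v = (y @\<^sub>v z) @\<^sub>v x"
      unfolding v append_vec_assoc [of x] using xyz by (intro swap_mat_mult_vec) auto
    moreover have "dsum (swap_mat n m) (1\<^sub>m k) *\<^sub>v v = y @\<^sub>v (x @\<^sub>v z)"
      unfolding v using xyz by (subst dsum_mult_vec) (auto simp: swap_mat_mult_vec append_vec_assoc)
    moreover have "dsum (1\<^sub>m m) (swap_mat n k) *\<^sub>v (y @\<^sub>v (x @\<^sub>v z)) = (y @\<^sub>v z) @\<^sub>v x"
      using xyz by (subst dsum_mult_vec) (auto simp: swap_mat_mult_vec append_vec_assoc)
    moreover have "(dsum (1\<^sub>m m) (swap_mat n k) * dsum (swap_mat n m) (1\<^sub>m k)) *\<^sub>v v =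
        dsum (1\<^sub>m m) (swap_mat n k) *\<^sub>v (dsum (swap_mat n m) (1\<^sub>m k) *\<^sub>v v)"
      using xyz v by (intro mult_mat_vec_assoc) auto
    ultimately show "swap_mat n (m + k) *\<^sub>v v =
        (dsum (1\<^sub>m m) (swap_mat n k) * dsum (swap_mat n m) (1\<^sub>m k)) *\<^sub>v v"
      by simp
  qed
next
  fix A B C :: "'a mat" assume "dim_row A = dim_col B" "dim_row B = dim_col C"
  then show "C * (B * A) = C * B * A"
    by (intro assoc_mult_mat [symmetric] carrier_matI) auto
next
  fix A :: "'a mat"
  show "dsum (1\<^sub>m 0) A = A" "dsum A (1\<^sub>m 0) = A"
    unfolding dsum_def by (rule eq_matI; auto)+
qed (simp_all add: dsum_mult dsum_one dsum_assoc)

lemma transpose_morphism: "prop_morphism Mat (op_prop Mat) (transpose_mat :: 'a::comm_ring_1 mat \<Rightarrow> _)"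
  by (auto simp: prop_morphism_def op_prop_simps transpose_dsum transpose_swap_mat
      intro!: transpose_mult carrier_matI)

lemma transpose_morphism_op: "prop_morphism (op_prop Mat) Mat (transpose_mat :: 'a::comm_ring_1 mat \<Rightarrow> _)"
  by (auto simp: prop_morphism_def op_prop_simps transpose_dsum transpose_swap_mat
      intro!: transpose_mult carrier_matI)

section \<open>Pullbacks of matrices over a principal ideal domain\<close>

text \<open>The pullback property tested on vectors: \<open>p\<close> and \<open>q\<close> together
  map bijectively onto the pairs \<open>(x, y)\<close> solving the equation given by
  \<open>f\<close> and \<open>g\<close>.\<close>

definition vec_pullback :: "'a::comm_ring_1 mat \<Rightarrow> 'a mat \<Rightarrow> 'a mat \<Rightarrow> 'a mat \<Rightarrow> bool" where
  "vec_pullback f g p q \<longleftrightarrow> dim_col p = dim_col q \<and> dim_row p = dim_col f \<and> dim_row q = dim_col g \<and>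
     (\<forall>z\<in>carrier_vec (dim_col p). f *\<^sub>v (p *\<^sub>v z) = g *\<^sub>v (q *\<^sub>v z)) \<and>
     (\<forall>x\<in>carrier_vec (dim_col f). \<forall>y\<in>carrier_vec (dim_col g). f *\<^sub>v x = g *\<^sub>v y \<longrightarrow>
        (\<exists>z\<in>carrier_vec (dim_col p). p *\<^sub>v z = x \<and> q *\<^sub>v z = y)) \<and>
     (\<forall>z\<in>carrier_vec (dim_col p). \<forall>z'\<in>carrier_vec (dim_col p).
        p *\<^sub>v z = p *\<^sub>v z' \<longrightarrow> q *\<^sub>v z = q *\<^sub>v z' \<longrightarrow> z = z')"

text \<open>A vector as an arrow of \<open>Mat\<close> out of the object 1.\<close>

definition col_mat :: "'a vec \<Rightarrow> 'a mat" where
  "col_mat v = mat (dim_vec v) 1 (\<lambda>(i, j). v $ i)"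

lemma col_mat_dim [simp]: "dim_row (col_mat v) = dim_vec v" "dim_col (col_mat v) = 1"
  by (simp_all add: col_mat_def)

lemma col_col_mat [simp]: "col (col_mat v) 0 = v"
  by (rule eq_vecI) (auto simp: col_mat_def)

lemma mult_col_mat:
  assumes "dim_col A = dim_vec v"
  shows "A * col_mat v = col_mat (A *\<^sub>v v)"
  using assms by (intro mat_ext_cols) auto

lemma col_mat_inject: "col_mat v = col_mat w \<Longrightarrow> v = w"
  by (metis col_col_mat)

text \<open>The object 1 generates \<open>Mat\<close>: cones with source 1 are pairs of vectors, and
  a cone with any other source is a family of such pairs, one for each column.\<close>

lemma pullback_Mat_iff:
  fixes f :: "'a::comm_ring_1 mat"
  assumes fg: "dim_row f = dim_row g"
  shows "pullback_sq Mat f g p q \<longleftrightarrow> vec_pullback f g p q"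
proof
  interpret is_prop "Mat :: 'a mat prop_data" by (rule Mat_is_prop)
  assume pb: "pullback_sq Mat f g p q"
  note D = pullback_sqD [OF pb, simplified]
  show "vec_pullback f g p q"
    unfolding vec_pullback_def
  proof (intro conjI ballI impI)
    fix z :: "'a vec" assume "z \<in> carrier_vec (dim_col p)"
    then show "f *\<^sub>v (p *\<^sub>v z) = g *\<^sub>v (q *\<^sub>v z)"
      using D by (metis mult_mat_vec_assoc carrier_vecD)
  next
    fix x y :: "'a vec" assume xy: "x \<in> carrier_vec (dim_col f)" "y \<in> carrier_vec (dim_col g)" "f *\<^sub>v x = g *\<^sub>v y"
    then obtain u where u: "dim_col u = 1" "dim_row u = dim_col p" "p * u = col_mat x" "q * u = col_mat y"
      using pullback_factor [OF pb, of "col_mat x" "col_mat y"] by (auto simp: mult_col_mat)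
    have "p *\<^sub>v col u 0 = x" "q *\<^sub>v col u 0 = y"
      using u D col_mult_dim [of p u 0] col_mult_dim [of q u 0] by simp_all
    then show "\<exists>z\<in>carrier_vec (dim_col p). p *\<^sub>v z = x \<and> q *\<^sub>v z = y"
      using u by (intro bexI [of _ "col u 0"] carrier_vecI) auto
  next
    fix z z' :: "'a vec" assume "z \<in> carrier_vec (dim_col p)" "z' \<in> carrier_vec (dim_col p)"
      "p *\<^sub>v z = p *\<^sub>v z'" "q *\<^sub>v z = q *\<^sub>v z'"
    then show "z = z'"
      using pullback_cancel [OF pb, of "col_mat z" "col_mat z'"] D by (auto simp: mult_col_mat dest: col_mat_inject)
  qed (use D in simp_all)
next
  interpret is_prop "Mat :: 'a mat prop_data" by (rule Mat_is_prop)
  assume "vec_pullback f g p q"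
  then have D: "dim_col q = dim_col p" "dim_row p = dim_col f" "dim_row q = dim_col g"
    and comm: "\<And>z. z \<in> carrier_vec (dim_col p) \<Longrightarrow> f *\<^sub>v (p *\<^sub>v z) = g *\<^sub>v (q *\<^sub>v z)"
    and ex: "\<And>x y. \<lbrakk>x \<in> carrier_vec (dim_col f); y \<in> carrier_vec (dim_col g); f *\<^sub>v x = g *\<^sub>v y\<rbrakk> \<Longrightarrow>
        \<exists>z\<in>carrier_vec (dim_col p). p *\<^sub>v z = x \<and> q *\<^sub>v z = y"
    and inj: "\<And>z z'. \<lbrakk>z \<in> carrier_vec (dim_col p); z' \<in> carrier_vec (dim_col p);
        p *\<^sub>v z = p *\<^sub>v z'; q *\<^sub>v z = q *\<^sub>v z'\<rbrakk> \<Longrightarrow> z = z'"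
    unfolding vec_pullback_def by auto
  show "pullback_sq Mat f g p q"
  proof (rule pullback_sqI; simp add: D)
    show "f * p = g * q"
      using D comm fg by (intro mat_ext_vec) (auto simp: mult_mat_vec_assoc)
  next
    fix p' q' :: "'a mat"
    assume *: "dim_col q' = dim_col p'" "dim_row p' = dim_col f" "dim_row q' = dim_col g" "f * p' = g * q'"
    have "\<exists>z\<in>carrier_vec (dim_col p). p *\<^sub>v z = col p' j \<and> q *\<^sub>v z = col q' j" if "j < dim_col p'" for j
    proof (rule ex)
      show "f *\<^sub>v col p' j = g *\<^sub>v col q' j"
        using that * col_mult_dim [of f p' j] col_mult_dim [of g q' j] by simp
    qed (use * that in \<open>auto intro!: carrier_vecI\<close>)
    then obtain z where z: "\<And>j. j < dim_col p' \<Longrightarrow> z j \<in> carrier_vec (dim_col p)"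
        "\<And>j. j < dim_col p' \<Longrightarrow> p *\<^sub>v z j = col p' j" "\<And>j. j < dim_col p' \<Longrightarrow> q *\<^sub>v z j = col q' j"
      by metis
    \<comment> \<open>The mediating matrix has as columns the mediating vectors of the single
      columns.\<close>
    define u where "u = mat (dim_col p) (dim_col p') (\<lambda>(i, j). z j $ i)"
    have u: "dim_row u = dim_col p" "dim_col u = dim_col p'"
      by (simp_all add: u_def)
    have col_u: "col u j = z j" if "j < dim_col p'" for j
      using z(1) [OF that] that by (intro eq_vecI) (auto simp: u_def)
    have "col (p * u) j = col p' j" "col (q * u) j = col q' j" if "j < dim_col p'" for j
      using col_mult_dim [of p u j] col_mult_dim [of q u j] col_u [OF that] z(2,3) [OF that] that u D by simp_all
    then have "p * u = p'" "q * u = q'"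
      using * u D by (auto intro!: mat_ext_cols)
    then show "\<exists>u. dim_col u = dim_col p' \<and> dim_row u = dim_col p \<and> p * u = p' \<and> q * u = q'"
      using u by blast
  next
    fix u v :: "'a mat"
    assume *: "dim_col v = dim_col u" "dim_row u = dim_col p" "dim_row v = dim_col p" "p * u = p * v" "q * u = q * v"
    show "u = v"
    proof (rule mat_ext_cols)
      fix j assume "j < dim_col v"
      then show "col u j = col v j"
        using * D col_mult_dim [of p u j] col_mult_dim [of p v j] col_mult_dim [of q u j] col_mult_dim [of q v j]
        by - (rule inj, auto intro!: carrier_vecI)
    qed (use * in auto)
  qed
qed

lemma vec_pullback_dsum:
  fixes f :: "'a::comm_ring_1 mat"
  assumes dim: "dim_row f = dim_row g" "dim_row f' = dim_row g'"
    and pb: "vec_pullback f g p q" "vec_pullback f' g' p' q'"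
  shows "vec_pullback (dsum f f') (dsum g g') (dsum p p') (dsum q q')"
proof -
  from pb have D: "dim_col q = dim_col p" "dim_row p = dim_col f" "dim_row q = dim_col g"
      "dim_col q' = dim_col p'" "dim_row p' = dim_col f'" "dim_row q' = dim_col g'"
    by (simp_all add: vec_pullback_def)
  show ?thesis
    unfolding vec_pullback_def
  proof (intro conjI ballI impI)
    fix z :: "'a vec" assume "z \<in> carrier_vec (dim_col (dsum p p'))"
    then obtain z1 z2 where z: "z1 \<in> carrier_vec (dim_col p)" "z2 \<in> carrier_vec (dim_col p')" "z = z1 @\<^sub>v z2"
      by (auto elim: vec_splitE)
    with pb D show "dsum f f' *\<^sub>v (dsum p p' *\<^sub>v z) = dsum g g' *\<^sub>v (dsum q q' *\<^sub>v z)"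
      by (simp add: dsum_mult_vec vec_pullback_def)
  next
    fix x y :: "'a vec" assume "x \<in> carrier_vec (dim_col (dsum f f'))" "y \<in> carrier_vec (dim_col (dsum g g'))"
      and eq: "dsum f f' *\<^sub>v x = dsum g g' *\<^sub>v y"
    then obtain x1 x2 y1 y2 where xy: "x1 \<in> carrier_vec (dim_col f)" "x2 \<in> carrier_vec (dim_col f')"
      "y1 \<in> carrier_vec (dim_col g)" "y2 \<in> carrier_vec (dim_col g')" "x = x1 @\<^sub>v x2" "y = y1 @\<^sub>v y2"
      by (auto elim!: vec_splitE)
    with eq dim have "f *\<^sub>v x1 = g *\<^sub>v y1" "f' *\<^sub>v x2 = g' *\<^sub>v y2"
      by (simp_all add: dsum_mult_vec append_vec_inject)
    then obtain z1 z2 where "z1 \<in> carrier_vec (dim_col p)" "p *\<^sub>v z1 = x1" "q *\<^sub>v z1 = y1"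
        "z2 \<in> carrier_vec (dim_col p')" "p' *\<^sub>v z2 = x2" "q' *\<^sub>v z2 = y2"
      using pb xy unfolding vec_pullback_def by metis
    then show "\<exists>z\<in>carrier_vec (dim_col (dsum p p')). dsum p p' *\<^sub>v z = x \<and> dsum q q' *\<^sub>v z = y"
      using xy D by (intro bexI [of _ "z1 @\<^sub>v z2"]) (auto simp: dsum_mult_vec)
  next
    fix z w :: "'a vec" assume "z \<in> carrier_vec (dim_col (dsum p p'))" "w \<in> carrier_vec (dim_col (dsum p p'))"
      and eq: "dsum p p' *\<^sub>v z = dsum p p' *\<^sub>v w" "dsum q q' *\<^sub>v z = dsum q q' *\<^sub>v w"
    then obtain z1 z2 w1 w2 where *: "z1 \<in> carrier_vec (dim_col p)" "z2 \<in> carrier_vec (dim_col p')"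
      "w1 \<in> carrier_vec (dim_col p)" "w2 \<in> carrier_vec (dim_col p')" "z = z1 @\<^sub>v z2" "w = w1 @\<^sub>v w2"
      by (auto elim!: vec_splitE)
    with eq D have "p *\<^sub>v z1 = p *\<^sub>v w1" "p' *\<^sub>v z2 = p' *\<^sub>v w2" "q *\<^sub>v z1 = q *\<^sub>v w1" "q' *\<^sub>v z2 = q' *\<^sub>v w2"
      by (simp_all add: dsum_mult_vec append_vec_inject)
    with pb * show "z = w"
      unfolding vec_pullback_def by metis
  qed (use D in auto)
qed

text \<open>Independent of \<open>class_ring\<close>, so that fields, and in particular the field of fractions, are an
  immediate instance.\<close>

definition principal_ideals :: "'a::comm_ring_1 itself \<Rightarrow> bool" where
  "principal_ideals _ \<longleftrightarrow> (\<forall>I :: 'a set. 0 \<in> I \<and> (\<forall>x\<in>I. \<forall>y\<in>I. x + y \<in> I) \<and> (\<forall>c. \<forall>x\<in>I. c * x \<in> I) \<longrightarrow>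
     (\<exists>d\<in>I. \<forall>x\<in>I. d dvd x))"

lemma principal_ideals_field: "principal_ideals TYPE('a::field)"
  unfolding principal_ideals_def by (metis dvd_0_right dvd_field_iff)

lemma principal_ideals_domain:
  assumes "principal_domain (class_ring :: 'a::idom ring)"
  shows "principal_ideals TYPE('a)"
  unfolding principal_ideals_def
proof (intro allI impI)
  interpret principal_domain "class_ring :: 'a ring" by fact
  fix I :: "'a set" assume I: "0 \<in> I \<and> (\<forall>x\<in>I. \<forall>y\<in>I. x + y \<in> I) \<and> (\<forall>c. \<forall>x\<in>I. c * x \<in> I)"
  have neg: "- x \<in> I" if "x \<in> I" for x
    using I that by (metis mult_minus1)
  have inv: "inv\<^bsub>add_monoid class_ring\<^esub> x = - x" for x :: 'a
    using add.inv_equality [of "- x" x] by (simp add: class_ring_simps a_inv_def)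
  have "ideal I (class_ring :: 'a ring)"
  proof (rule idealI)
    show "subgroup I (add_monoid (class_ring :: 'a ring))"
      by (rule subgroup.intro) (use I neg inv in \<open>auto simp: class_ring_simps\<close>)
    show "ring (class_ring :: 'a ring)"
      by unfold_locales
    fix a x :: 'a assume "a \<in> I"
    then show "x \<otimes>\<^bsub>class_ring\<^esub> a \<in> I" "a \<otimes>\<^bsub>class_ring\<^esub> x \<in> I"
      using I by (simp_all add: class_ring_simps) (metis mult.commute)
  qed
  then obtain d where d: "I = PIdl\<^bsub>class_ring\<^esub> d"
    using exists_gen by blast
  then have "I = {c * d | c. True}"
    by (auto simp: cgenideal_def class_ring_simps)
  then show "\<exists>d\<in>I. \<forall>x\<in>I. d dvd x"
    by (intro bexI [of _ d]) (auto intro: exI [of _ 1])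
qed

section \<open>Submodules of free modules\<close>

definition submod :: "nat \<Rightarrow> 'a::comm_ring_1 vec set \<Rightarrow> bool" where
  "submod n S \<longleftrightarrow> S \<subseteq> carrier_vec n \<and> 0\<^sub>v n \<in> S \<and> (\<forall>x\<in>S. \<forall>y\<in>S. x + y \<in> S) \<and> (\<forall>c. \<forall>x\<in>S. c \<cdot>\<^sub>v x \<in> S)"

lemma smult_vCons: "c \<cdot>\<^sub>v vCons a v = vCons (c * a) (c \<cdot>\<^sub>v v)"
  by (rule eq_vecI) (auto simp: vec_index_vCons)

lemma add_vCons: "dim_vec v = dim_vec w \<Longrightarrow> vCons a v + vCons b w = vCons (a + b) (v + w)"
  by (rule eq_vecI) (auto simp: vec_index_vCons)

lemma submod_head:
  assumes "submod (Suc n) S"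
  shows "submod n {w. vCons 0 w \<in> S}"
proof -
  have "vCons 0 (v + w) \<in> S" if "vCons 0 v \<in> S" "vCons 0 w \<in> S" for v w
  proof -
    have "vCons 0 v + vCons 0 w \<in> S" "dim_vec v = n" "dim_vec w = n"
      using that assms by (force simp: submod_def)+
    then show ?thesis by (simp add: add_vCons)
  qed
  moreover have "vCons 0 (c \<cdot>\<^sub>v v) \<in> S" if "vCons 0 v \<in> S" for c v
  proof -
    have "c \<cdot>\<^sub>v vCons 0 v \<in> S"
      using that assms by (simp add: submod_def)
    then show ?thesis by (simp add: smult_vCons)
  qed
  moreover have "w \<in> carrier_vec n" if "vCons 0 w \<in> S" for w
    using that assms vCons_carrier_vec [of 0 w n] by (auto simp: submod_def)
  moreover have "vCons 0 (0\<^sub>v n) \<in> S"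
    using assms by (simp add: submod_def zero_vec_Suc)
  ultimately show ?thesis
    unfolding submod_def by blast
qed

text \<open>The first entries of the vectors in \<open>S\<close> form an ideal. \<open>d\<close>
  generates it and \<open>vCons d s\<close> is a vector of \<open>S\<close> attaining it, so
  multiples of this vector can clear the first entry of any other vector of
  \<open>S\<close>.\<close>

lemma submod_pivot:
  assumes pid: "principal_ideals TYPE('a::comm_ring_1)" and S: "submod (Suc n) (S :: 'a vec set)"
  obtains d s where "vCons d s \<in> S" "\<forall>a v. vCons a v \<in> S \<longrightarrow> d dvd a"
proof -
  define I where "I = {a. \<exists>v. vCons a v \<in> S}"
  have "0 \<in> I"
    using S by (auto simp: I_def submod_def zero_vec_Suc)
  moreover have "a + b \<in> I" if "a \<in> I" "b \<in> I" for a b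
  proof -
    from that obtain v w where vw: "vCons a v \<in> S" "vCons b w \<in> S"
      by (auto simp: I_def)
    then have "vCons a v + vCons b w \<in> S" "dim_vec v = n" "dim_vec w = n"
      using S by (force simp: submod_def)+
    then show ?thesis by (auto simp: I_def add_vCons)
  qed
  moreover have "c * a \<in> I" if "a \<in> I" for a c
  proof -
    from that obtain v where "vCons a v \<in> S"
      by (auto simp: I_def)
    then have "c \<cdot>\<^sub>v vCons a v \<in> S"
      using S by (simp add: submod_def)
    then show ?thesis by (auto simp: I_def smult_vCons)
  qed
  ultimately have "\<exists>d\<in>I. \<forall>x\<in>I. d dvd x"
    by (intro pid [unfolded principal_ideals_def, rule_format]) blast
  then show ?thesis
    using that unfolding I_def by blast
qed

lemma vec_SucE:
  assumes "v \<in> carrier_vec (Suc n)"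
  obtains a w where "w \<in> carrier_vec n" "v = vCons a w"
  using assms by (cases v) auto

lemma submod_diff_pivot:
  assumes S: "submod (Suc n) S" and "vCons d s \<in> S" "vCons (c * d) v \<in> S"
  shows "vCons 0 (v - c \<cdot>\<^sub>v s) \<in> S" "s \<in> carrier_vec n" "v \<in> carrier_vec n"
proof -
  show *: "s \<in> carrier_vec n" "v \<in> carrier_vec n"
    using assms by (force simp: submod_def)+
  have "vCons (c * d) v + (- c) \<cdot>\<^sub>v vCons d s \<in> S"
    using assms by (simp add: submod_def)
  moreover have "v + (- c) \<cdot>\<^sub>v s = v - c \<cdot>\<^sub>v s"
    using * by (intro eq_vecI) auto
  ultimately show "vCons 0 (v - c \<cdot>\<^sub>v s) \<in> S"
    using * by (simp add: smult_vCons add_vCons)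
qed

text \<open>Induction along the first coordinate: \<open>S\<close> is generated by a basis of its
  vectors with first entry 0, together with a pivot from \<open>submod_pivot\<close> if some first
  entry is nonzero. The columns of \<open>K\<close> are the basis, so \<open>dim_col K\<close> is
  the rank.\<close>

lemma submod_basis:
  assumes pid: "principal_ideals TYPE('a::idom)" and "submod n (S :: 'a vec set)"
  shows "\<exists>K. dim_row K = n \<and> S = (\<lambda>z. K *\<^sub>v z) ` carrier_vec (dim_col K) \<and>
    (\<forall>z\<in>carrier_vec (dim_col K). \<forall>z'\<in>carrier_vec (dim_col K). K *\<^sub>v z = K *\<^sub>v z' \<longrightarrow> z = z')"
  using assms(2)
proof (induction n arbitrary: S)
  case 0
  have triv: "v = 0\<^sub>v 0" if "v \<in> carrier_vec 0" for v :: "'a vec"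
    using that by (intro eq_vecI) auto
  then have "S = {0\<^sub>v 0}"
    using 0 by (auto simp: submod_def)
  moreover have "carrier_vec 0 = {0\<^sub>v 0 :: 'a vec}"
    using triv by auto
  moreover have "(0\<^sub>m 0 0 :: 'a mat) *\<^sub>v 0\<^sub>v 0 = 0\<^sub>v 0"
    by (rule triv) simp
  ultimately show ?case
    by (intro exI [of _ "0\<^sub>m 0 0"]) auto
next
  case (Suc n)
  define S' where "S' = {w. vCons 0 w \<in> S}"
  obtain K' where K': "dim_row K' = n" "S' = (\<lambda>z. K' *\<^sub>v z) ` carrier_vec (dim_col K')"
    and inj: "\<And>z z'. \<lbrakk>z \<in> carrier_vec (dim_col K'); z' \<in> carrier_vec (dim_col K'); K' *\<^sub>v z = K' *\<^sub>v z'\<rbrakk> \<Longrightarrow> z = z'"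
    using Suc.IH [OF submod_head [OF Suc.prems]] unfolding S'_def by auto
  obtain d s where ds: "vCons d s \<in> S" "\<forall>a v. vCons a v \<in> S \<longrightarrow> d dvd a"
    using submod_pivot [OF pid Suc.prems] .
  have s: "s \<in> carrier_vec n"
    using ds Suc.prems by (force simp: submod_def)
  show ?case
  proof (cases "d = 0")
    case True
    \<comment> \<open>All first entries vanish, so only a zero row is put on top of
      \<open>K'\<close>.\<close>
    define K where "K = mat (Suc n) (dim_col K') (\<lambda>(i, j). if i = 0 then 0 else K' $$ (i - 1, j))"
    have dim: "dim_row K = Suc n" "dim_col K = dim_col K'"
      by (simp_all add: K_def)
    have Kz: "K *\<^sub>v z = vCons 0 (K' *\<^sub>v z)" if "z \<in> carrier_vec (dim_col K')" for z
    proof (rule eq_vecI)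
      fix i assume "i < dim_vec (vCons 0 (K' *\<^sub>v z))"
      then show "(K *\<^sub>v z) $ i = vCons 0 (K' *\<^sub>v z) $ i"
        using that K' by (cases i) (auto simp: K_def scalar_prod_def)
    qed (use K' dim in simp)
    have "v \<in> (\<lambda>z. K *\<^sub>v z) ` carrier_vec (dim_col K)" if v: "v \<in> S" for v
    proof -
      have "v \<in> carrier_vec (Suc n)"
        using v Suc.prems by (auto simp: submod_def)
      then obtain a w where w: "v = vCons a w"
        by (rule vec_SucE)
      then have "w \<in> S'" "a = 0"
        using ds(2) v True by (auto simp: S'_def)
      then obtain z where "z \<in> carrier_vec (dim_col K')" "w = K' *\<^sub>v z"
        using K' by blast
      then show ?thesis
        using w \<open>a = 0\<close> Kz dim by (intro image_eqI [of _ _ z]) auto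
    qed
    moreover have "K *\<^sub>v z \<in> S" if "z \<in> carrier_vec (dim_col K)" for z
      using that Kz dim K' by (auto simp: S'_def)
    ultimately show ?thesis
      using dim inj Kz by (intro exI [of _ K]) auto
  next
    case False
    \<comment> \<open>The pivot becomes column 0; the basis of \<open>S'\<close>, with a zero on
      top, is shifted one column to the right.\<close>
    define K where "K = mat (Suc n) (Suc (dim_col K'))
      (\<lambda>(i, j). if j = 0 then vCons d s $ i else if i = 0 then 0 else K' $$ (i - 1, j - 1))"
    have dim: "dim_row K = Suc n" "dim_col K = Suc (dim_col K')"
      by (simp_all add: K_def)
    have Kz: "K *\<^sub>v vCons c z = vCons (c * d) (c \<cdot>\<^sub>v s + K' *\<^sub>v z)" if "z \<in> carrier_vec (dim_col K')" for c z
    proof (rule eq_vecI)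
      fix i assume i: "i < dim_vec (vCons (c * d) (c \<cdot>\<^sub>v s + K' *\<^sub>v z))"
      have "row K 0 = vCons d (0\<^sub>v (dim_col K'))"
        by (rule eq_vecI) (auto simp: K_def vec_index_vCons)
      moreover have "row K (Suc j) = vCons (s $ j) (row K' j)" if "j < n" for j
        using that K' by (intro eq_vecI) (auto simp: K_def vec_index_vCons)
      ultimately show "(K *\<^sub>v vCons c z) $ i = vCons (c * d) (c \<cdot>\<^sub>v s + K' *\<^sub>v z) $ i"
        using that K' s i dim by (cases i) (auto simp: mult.commute)
    qed (use K' dim s in simp)
    have "v \<in> (\<lambda>z. K *\<^sub>v z) ` carrier_vec (dim_col K)" if v: "v \<in> S" for v
    proof -
      have "v \<in> carrier_vec (Suc n)"
        using v Suc.prems by (auto simp: submod_def)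
      then obtain a w where w: "w \<in> carrier_vec n" "v = vCons a w"
        by (rule vec_SucE)
      then obtain c where c: "a = c * d"
        using ds(2) v by (metis dvdE mult.commute)
      have "vCons 0 (w - c \<cdot>\<^sub>v s) \<in> S"
        using submod_diff_pivot [OF Suc.prems ds(1)] v w c by blast
      then obtain z where z: "z \<in> carrier_vec (dim_col K')" "w - c \<cdot>\<^sub>v s = K' *\<^sub>v z"
        using K' by (auto simp: S'_def)
      have "c \<cdot>\<^sub>v s + (w - c \<cdot>\<^sub>v s) = w"
        using w s by (intro eq_vecI) auto
      then have "K *\<^sub>v vCons c z = v"
        using z w c by (simp add: Kz)
      then show ?thesis
        using z dim by (intro image_eqI [of _ _ "vCons c z"]) auto
    qed
    moreover have "K *\<^sub>v v \<in> S" if "v \<in> carrier_vec (dim_col K)" for v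
    proof -
      have "v \<in> carrier_vec (Suc (dim_col K'))"
        using that dim by simp
      then obtain c z where z: "z \<in> carrier_vec (dim_col K')" "v = vCons c z"
        by (rule vec_SucE)
      have "vCons 0 (K' *\<^sub>v z) \<in> S" "c \<cdot>\<^sub>v vCons d s \<in> S"
        using z K' ds Suc.prems by (auto simp: S'_def submod_def)
      then have "c \<cdot>\<^sub>v vCons d s + vCons 0 (K' *\<^sub>v z) \<in> S"
        using Suc.prems by (simp add: submod_def)
      then show ?thesis
        using z s K' by (simp add: Kz smult_vCons add_vCons)
    qed
    \<comment> \<open>The first entries agree, so \<open>c * d = c' * d\<close>, and the nonzero
      \<open>d\<close> cancels in a domain; the tails are then settled by injectivity of
      \<open>K'\<close>.\<close>
    moreover have "v = v'" if v: "v \<in> carrier_vec (dim_col K)" "v' \<in> carrier_vec (dim_col K)" "K *\<^sub>v v = K *\<^sub>v v'" for v v'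
    proof -
      obtain c z c' z' where z: "z \<in> carrier_vec (dim_col K')" "v = vCons c z"
          "z' \<in> carrier_vec (dim_col K')" "v' = vCons c' z'"
        using v(1,2) dim vec_SucE [of v "dim_col K'"] vec_SucE [of v' "dim_col K'"] by metis
      with v(3) False have "c = c' \<and> c \<cdot>\<^sub>v s + K' *\<^sub>v z = c' \<cdot>\<^sub>v s + K' *\<^sub>v z'"
        by (auto simp: Kz)
      then have "c = c'" "c \<cdot>\<^sub>v s + K' *\<^sub>v z = c \<cdot>\<^sub>v s + K' *\<^sub>v z'"
        by auto
      moreover have "K' *\<^sub>v z = K' *\<^sub>v z'"
        using calculation(2) s K' by (auto simp: vec_eq_iff)
      ultimately show ?thesis
        using inj z by blast
    qed
    ultimately show ?thesis
      using dim by (intro exI [of _ K]) auto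
  qed
qed

text \<open>The solutions of the equation, written as concatenated vectors, form a submodule. A
  basis matrix \<open>K\<close> of it is cut horizontally: the upper \<open>n\<close> rows are
  \<open>p\<close>, the lower \<open>m\<close> rows are \<open>q\<close>.\<close>

lemma vec_pullback_ex:
  fixes f :: "'a::idom mat"
  assumes pid: "principal_ideals TYPE('a)" and fg: "dim_row f = dim_row g"
  shows "\<exists>p q. vec_pullback f g p q"
proof -
  define n m where "n = dim_col f" and "m = dim_col g"
  define S where "S = {x @\<^sub>v y | x y. x \<in> carrier_vec n \<and> y \<in> carrier_vec m \<and> f *\<^sub>v x = g *\<^sub>v y}"
  have f: "f \<in> carrier_mat (dim_row g) n" "g \<in> carrier_mat (dim_row g) m"
    using fg by (auto simp: n_def m_def)
  have "submod (n + m) S"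
    unfolding submod_def
  proof (intro conjI ballI allI)
    show "0\<^sub>v (n + m) \<in> S"
      unfolding S_def using fg
      by (intro CollectI exI [of _ "0\<^sub>v n"] exI [of _ "0\<^sub>v m"])
        (simp add: mult_mat_zero_vec n_def m_def)
  next
    fix v w :: "'a vec" assume "v \<in> S" "w \<in> S"
    then obtain x y x' y' where *: "v = x @\<^sub>v y" "w = x' @\<^sub>v y'" "x \<in> carrier_vec n" "y \<in> carrier_vec m"
      "x' \<in> carrier_vec n" "y' \<in> carrier_vec m" "f *\<^sub>v x = g *\<^sub>v y" "f *\<^sub>v x' = g *\<^sub>v y'"
      unfolding S_def by blast
    then have "f *\<^sub>v (x + x') = g *\<^sub>v (y + y')"
      using mult_add_distrib_mat_vec [OF f(1), of x x'] mult_add_distrib_mat_vec [OF f(2), of y y'] by metis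
    moreover have "v + w = (x + x') @\<^sub>v (y + y')"
      using * by (simp add: append_vec_add)
    ultimately show "v + w \<in> S"
      using * unfolding S_def by (intro CollectI exI [of _ "x + x'"] exI [of _ "y + y'"]) simp
  next
    fix c and v :: "'a vec" assume "v \<in> S"
    then obtain x y where *: "v = x @\<^sub>v y" "x \<in> carrier_vec n" "y \<in> carrier_vec m" "f *\<^sub>v x = g *\<^sub>v y"
      unfolding S_def by blast
    then have "f *\<^sub>v (c \<cdot>\<^sub>v x) = g *\<^sub>v (c \<cdot>\<^sub>v y)"
      by (simp add: mult_mat_vec_smult n_def m_def)
    with * show "c \<cdot>\<^sub>v v \<in> S"
      unfolding S_def by (intro CollectI exI [of _ "c \<cdot>\<^sub>v x"] exI [of _ "c \<cdot>\<^sub>v y"]) (simp add: smult_append)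
  qed (auto simp: S_def)
  then obtain K where K: "dim_row K = n + m" "S = (\<lambda>z. K *\<^sub>v z) ` carrier_vec (dim_col K)"
    and inj: "\<And>z z'. \<lbrakk>z \<in> carrier_vec (dim_col K); z' \<in> carrier_vec (dim_col K); K *\<^sub>v z = K *\<^sub>v z'\<rbrakk> \<Longrightarrow> z = z'"
    using submod_basis [OF pid, of "n + m" S] by blast
  define p where "p = mat n (dim_col K) (\<lambda>(i, j). K $$ (i, j))"
  define q where "q = mat m (dim_col K) (\<lambda>(i, j). K $$ (n + i, j))"
  have Kz: "K *\<^sub>v z = (p *\<^sub>v z) @\<^sub>v (q *\<^sub>v z)" if "z \<in> carrier_vec (dim_col K)" for z
    using that K by (intro eq_vecI) (auto simp: p_def q_def scalar_prod_def)
  have dim: "dim_row p = n" "dim_row q = m" "dim_col p = dim_col K" "dim_col q = dim_col K"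
    by (simp_all add: p_def q_def)
  have "vec_pullback f g p q"
    unfolding vec_pullback_def
  proof (intro conjI ballI impI)
    fix z :: "'a vec" assume "z \<in> carrier_vec (dim_col p)"
    then have "(p *\<^sub>v z) @\<^sub>v (q *\<^sub>v z) \<in> S"
      using Kz K dim by auto
    then obtain x y where "x \<in> carrier_vec n" "(p *\<^sub>v z) @\<^sub>v (q *\<^sub>v z) = x @\<^sub>v y" "f *\<^sub>v x = g *\<^sub>v y"
      by (auto simp: S_def)
    then show "f *\<^sub>v (p *\<^sub>v z) = g *\<^sub>v (q *\<^sub>v z)"
      using dim by (simp add: append_vec_inject)
  next
    fix x y :: "'a vec" assume *: "x \<in> carrier_vec (dim_col f)" "y \<in> carrier_vec (dim_col g)" "f *\<^sub>v x = g *\<^sub>v y"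
    then have "x @\<^sub>v y \<in> S"
      by (auto simp: S_def n_def m_def)
    then obtain z where "z \<in> carrier_vec (dim_col K)" "x @\<^sub>v y = (p *\<^sub>v z) @\<^sub>v (q *\<^sub>v z)"
      using Kz K by auto
    with * show "\<exists>z\<in>carrier_vec (dim_col p). p *\<^sub>v z = x \<and> q *\<^sub>v z = y"
      using dim by (intro bexI [of _ z]) (auto simp: append_vec_inject n_def)
  next
    fix z z' :: "'a vec" assume "z \<in> carrier_vec (dim_col p)" "z' \<in> carrier_vec (dim_col p)"
      "p *\<^sub>v z = p *\<^sub>v z'" "q *\<^sub>v z = q *\<^sub>v z'"
    then show "z = z'"
      using inj dim Kz by simp
  qed (use dim in \<open>auto simp: n_def m_def\<close>)
  then show ?thesis by blast
qed

lemma Mat_span_prop: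
  assumes pid: "principal_ideals TYPE('a::idom)"
  shows "span_prop (Mat :: 'a mat prop_data)"
proof -
  interpret is_prop "Mat :: 'a mat prop_data" by (rule Mat_is_prop)
  show ?thesis
  proof
    fix f g f' g' p q p' q' :: "'a mat"
    assume "tgt Mat f = tgt Mat g" "tgt Mat f' = tgt Mat g'"
      "pullback_sq Mat f g p q" "pullback_sq Mat f' g' p' q'"
    then show "pullback_sq Mat (tns Mat f f') (tns Mat g g') (tns Mat p p') (tns Mat q q')"
      by (simp add: pullback_Mat_iff vec_pullback_dsum)
  qed (simp add: pullback_Mat_iff vec_pullback_ex [OF pid])
qed

lemma op_Mat_span_prop:
  assumes "principal_ideals TYPE('a::idom)"
  shows "span_prop (op_prop (Mat :: 'a mat prop_data))"
  by (rule span_prop_transport [OF Mat_span_prop [OF assms] is_prop.op_is_prop [OF Mat_is_prop]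
      transpose_morphism transpose_morphism_op]) simp_all

section \<open>Matrices over the field of fractions\<close>

interpretation to_fract: inj_idom_hom "to_fract :: 'a::idom \<Rightarrow> 'a fract"
  by unfold_locales auto

abbreviation fract_mat :: "'a::idom mat \<Rightarrow> 'a fract mat" where "fract_mat \<equiv> map_mat to_fract"

abbreviation fract_vec :: "'a::idom vec \<Rightarrow> 'a fract vec" where "fract_vec \<equiv> map_vec to_fract"

lemma fract_mat_mult: "dim_col A = dim_row B \<Longrightarrow> fract_mat (A * B) = fract_mat A * fract_mat B"
  by (rule to_fract.mat_hom_mult [of _ "dim_row A" "dim_row B" _ "dim_col B"]) auto

lemma fract_mat_mult_vec: "dim_col A = dim_vec v \<Longrightarrow> fract_mat A *\<^sub>v fract_vec v = fract_vec (A *\<^sub>v v)"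
  by (rule to_fract.mult_mat_vec_hom [of _ "dim_row A" "dim_vec v", symmetric]) auto

lemma fract_mat_dsum: "fract_mat (dsum A B) = dsum (fract_mat A) (fract_mat B)"
  by (rule eq_matI) (auto simp: dsum_def)

lemma fract_mat_swap_mat: "fract_mat (swap_mat n m) = swap_mat n m"
  by (rule eq_matI) (auto simp: swap_mat_def)

lemma fract_mat_assoc:
  "dim_col A = dim_row B \<Longrightarrow> dim_col B = dim_vec v \<Longrightarrow>
    fract_mat (A * B) *\<^sub>v v = fract_mat A *\<^sub>v (fract_mat B *\<^sub>v v)"
  by (simp add: fract_mat_mult mult_mat_vec_assoc)

section \<open>Clearing denominators\<close>

lemma common_denominator:
  fixes S :: "'a::idom fract set"
  assumes "finite S"
  obtains d where "d \<noteq> 0" "\<forall>x\<in>S. \<exists>a. to_fract d * x = to_fract a"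
proof -
  have "\<exists>d. d \<noteq> 0 \<and> (\<forall>x\<in>S. \<exists>a. to_fract d * x = to_fract a)"
    using assms
  proof (induction S rule: finite_induct)
    case empty
    show ?case by (intro exI [of _ 1]) simp
  next
    case (insert x S)
    then obtain d where d: "d \<noteq> 0" "\<forall>x\<in>S. \<exists>a. to_fract d * x = to_fract a"
      by blast
    obtain p q where x: "x = Fract p q" "q \<noteq> 0"
      by (cases x)
    have "to_fract (d * q) * x = to_fract (d * p)"
      using x by (simp add: Fract_conv_to_fract)
    then have "\<exists>a. to_fract (d * q) * x = to_fract a" ..
    moreover have "\<exists>a. to_fract (d * q) * y = to_fract a" if y: "y \<in> S" for y
    proof -
      from d y obtain a where "to_fract d * y = to_fract a"
        by blast
      then have "to_fract (d * q) * y = to_fract (q * a)"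
        by (simp flip: \<open>to_fract d * y = to_fract a\<close>)
      then show ?thesis ..
    qed
    ultimately show ?case
      using d(1) x(2) by (intro exI [of _ "d * q"] conjI) (simp, blast)
  qed
  with that show ?thesis by blast
qed

lemma vec_clear_denominators:
  fixes x :: "'a::idom fract vec"
  obtains d w where "d \<noteq> 0" "dim_vec w = dim_vec x" "to_fract d \<cdot>\<^sub>v x = fract_vec w"
proof -
  have "finite (set\<^sub>v x)"
    by (simp add: vec_set_def)
  then obtain d where d: "d \<noteq> 0" "\<forall>c\<in>set\<^sub>v x. \<exists>a. to_fract d * c = to_fract a"
    by (rule common_denominator)
  then have "\<exists>a. to_fract d * x $ i = to_fract a" if "i < dim_vec x" for i
    using that by (auto simp: vec_set_def)
  then obtain a where "\<And>i. i < dim_vec x \<Longrightarrow> to_fract d * x $ i = to_fract (a i)"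
    by metis
  then have "to_fract d \<cdot>\<^sub>v x = fract_vec (vec (dim_vec x) a)"
    by (intro eq_vecI) auto
  with d that [of d "vec (dim_vec x) a"] show ?thesis
    by simp
qed

lemma mat_clear_denominators:
  fixes M :: "'a::idom fract mat"
  obtains d W where "d \<noteq> 0" "dim_row W = dim_row M" "dim_col W = dim_col M" "to_fract d \<cdot>\<^sub>m M = fract_mat W"
proof -
  have "finite (elements_mat M)"
    by (simp add: elements_mat_def)
  then obtain d where d: "d \<noteq> 0" "\<forall>c\<in>elements_mat M. \<exists>a. to_fract d * c = to_fract a"
    by (rule common_denominator)
  have "\<exists>a. to_fract d * M $$ (i, j) = to_fract a" if "i < dim_row M" "j < dim_col M" for i j
    using that d(2) by auto
  then obtain a where "\<And>i j. i < dim_row M \<Longrightarrow> j < dim_col M \<Longrightarrow> to_fract d * M $$ (i, j) = to_fract (a i j)"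
    by metis
  then have "to_fract d \<cdot>\<^sub>m M = fract_mat (mat (dim_row M) (dim_col M) (\<lambda>(i, j). a i j))"
    by (intro eq_matI) auto
  with d that [of d "mat (dim_row M) (dim_col M) (\<lambda>(i, j). a i j)"] show ?thesis
    by simp
qed

lemma smult_inverse:
  fixes x :: "'a::field vec"
  shows "c \<noteq> 0 \<Longrightarrow> inverse c \<cdot>\<^sub>v (c \<cdot>\<^sub>v x) = x" "c \<noteq> 0 \<Longrightarrow> c \<cdot>\<^sub>v (inverse c \<cdot>\<^sub>v x) = x"
  by (rule eq_vecI; simp add: field_simps)+

text \<open>By induction on \<open>n\<close>, with a vector of \<open>S\<close> whose first entry is invertible as pivot.\<close>

lemma separating_functional:
  fixes S :: "'a::field vec set"
  assumes "submod n S" "x \<in> carrier_vec n" "x \<notin> S"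
  shows "\<exists>u\<in>carrier_vec n. (\<forall>s\<in>S. u \<bullet> s = 0) \<and> u \<bullet> x \<noteq> 0"
  using assms
proof (induction n arbitrary: S x)
  case 0
  then have "x = 0\<^sub>v 0"
    by (intro eq_vecI) auto
  with 0 show ?case
    by (simp add: submod_def)
next
  case (Suc n)
  define S' where "S' = {w. vCons 0 w \<in> S}"
  have S': "submod n S'"
    unfolding S'_def by (rule submod_head [OF Suc.prems(1)])
  obtain a y where x: "y \<in> carrier_vec n" "x = vCons a y"
    using Suc.prems(2) by (rule vec_SucE)
  obtain d s where ds: "vCons d s \<in> S" "\<forall>a v. vCons a v \<in> S \<longrightarrow> d dvd a"
    using submod_pivot [OF principal_ideals_field Suc.prems(1)] .
  have S_cases: "\<exists>b w. w \<in> carrier_vec n \<and> t = vCons b w" if "t \<in> S" for t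
  proof -
    have "t \<in> carrier_vec (Suc n)"
      using that Suc.prems by (auto simp: submod_def)
    then show ?thesis
      by (metis vec_SucE)
  qed
  have s: "s \<in> carrier_vec n"
    using S_cases [OF ds(1)] by auto
  show ?case
  proof (cases "d = 0")
    case True
    \<comment> \<open>With pivot 0 the whole of \<open>S\<close> has first entry 0. Then either the
      first coordinate itself separates \<open>x\<close>, or \<open>x\<close> also starts with 0 and
      the problem moves to the tails.\<close>
    have S0: "\<exists>w. w \<in> S' \<and> w \<in> carrier_vec n \<and> t = vCons 0 w" if "t \<in> S" for t
      using S_cases [OF that] ds(2) True that by (auto simp: S'_def)
    show ?thesis
    proof (cases "a = 0")
      case True
      then have "y \<notin> S'"
        using Suc.prems(3) x by (simp add: S'_def)
      then obtain u where "u \<in> carrier_vec n" "\<forall>w\<in>S'. u \<bullet> w = 0" "u \<bullet> y \<noteq> 0"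
        using Suc.IH [OF S' x(1)] by blast
      then show ?thesis
        using S0 x by (intro bexI [of _ "vCons 0 u"]) (auto dest!: S0)
    next
      case False
      then show ?thesis
        using S0 x by (intro bexI [of _ "vCons 1 (0\<^sub>v n)"]) (auto dest!: S0)
    qed
  next
    case False
    \<comment> \<open>Subtracting \<open>a / d\<close> times the pivot clears the first entry of
      \<open>x\<close>; the remainder stays outside \<open>S\<close>, so the induction hypothesis
      separates its tail from \<open>S'\<close>.\<close>
    have y: "y - (a / d) \<cdot>\<^sub>v s \<notin> S'"
    proof
      assume "y - (a / d) \<cdot>\<^sub>v s \<in> S'"
      then have "vCons 0 (y - (a / d) \<cdot>\<^sub>v s) + (a / d) \<cdot>\<^sub>v vCons d s \<in> S"
        using Suc.prems ds by (simp add: S'_def submod_def)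
      moreover have "y - (a / d) \<cdot>\<^sub>v s + (a / d) \<cdot>\<^sub>v s = y"
        using x s by (intro eq_vecI) auto
      ultimately show False
        using Suc.prems(3) x s False by (simp add: smult_vCons add_vCons)
    qed
    then obtain u where u: "u \<in> carrier_vec n" "\<forall>w\<in>S'. u \<bullet> w = 0" "u \<bullet> (y - (a / d) \<cdot>\<^sub>v s) \<noteq> 0"
      using Suc.IH [OF S', of "y - (a / d) \<cdot>\<^sub>v s"] x s by auto
    \<comment> \<open>The first entry is chosen so that \<open>u'\<close> vanishes on the pivot.
      Hence \<open>u'\<close> takes on a vector the value of \<open>u\<close> on the tail left after
      elimination by the pivot.\<close>
    define u' where "u' = vCons (- (u \<bullet> s) / d) u"
    have diff: "u' \<bullet> vCons b w = u \<bullet> (w - (b / d) \<cdot>\<^sub>v s)"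
      if "w \<in> carrier_vec n" for b w
      using that u s unfolding u'_def by (simp add: scalar_prod_minus_distrib [of _ n])
    have "u' \<bullet> t = 0" if t: "t \<in> S" for t
    proof -
      obtain b w where w: "w \<in> carrier_vec n" "t = vCons b w"
        using S_cases [OF t] by blast
      have "vCons 0 (w - (b / d) \<cdot>\<^sub>v s) \<in> S"
        using submod_diff_pivot(1) [OF Suc.prems(1) ds(1), of "b / d" w] t w False by simp
      then show ?thesis
        using u w by (simp add: diff S'_def)
    qed
    moreover have "u' \<bullet> x \<noteq> 0"
      using u x by (simp add: diff)
    ultimately show ?thesis
      using u by (intro bexI [of _ u']) (auto simp: u'_def)
  qed
qed

section \<open>Linear relations of spans and cospans\<close>

text \<open>\<open>Phi\<close> and, below, \<open>Psi\<close> computed from one chosen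
  representative instead of a class; \<open>Phi_span_cls\<close> and \<open>Psi_cospan_cls\<close>
  establish the agreement.\<close>

definition span_rel :: "'a::idom mat \<Rightarrow> 'a mat \<Rightarrow> ('a fract vec \<times> 'a fract vec) set" where
  "span_rel A B = {(fract_mat A *\<^sub>v z, fract_mat B *\<^sub>v z) | z. z \<in> carrier_vec (dim_col A)}"

definition cospan_rel :: "'a::idom mat \<Rightarrow> 'a mat \<Rightarrow> ('a fract vec \<times> 'a fract vec) set" where
  "cospan_rel A B = {(x, y) | x y. x \<in> carrier_vec (dim_col A) \<and> y \<in> carrier_vec (dim_col B) \<and>
     fract_mat A *\<^sub>v x = fract_mat B *\<^sub>v y}"

lemma submod_lin_rel:
  assumes "lin_rel n m S"
  shows "submod (n + m) {x @\<^sub>v y | x y. (x, y) \<in> S}"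
proof -
  have car: "x \<in> carrier_vec n" "y \<in> carrier_vec m" if "(x, y) \<in> S" for x y
    using assms that by (auto simp: lin_rel_def)
  show ?thesis
    unfolding submod_def
  proof (intro conjI ballI allI subsetI)
    show "0\<^sub>v (n + m) \<in> {x @\<^sub>v y | x y. (x, y) \<in> S}"
      using assms by (intro CollectI exI [of _ "0\<^sub>v n"] exI [of _ "0\<^sub>v m"]) (simp add: lin_rel_def)
  next
    fix v w assume "v \<in> {x @\<^sub>v y | x y. (x, y) \<in> S}" "w \<in> {x @\<^sub>v y | x y. (x, y) \<in> S}"
    then obtain x y x' y' where *: "v = x @\<^sub>v y" "(x, y) \<in> S" "w = x' @\<^sub>v y'" "(x', y') \<in> S"
      by blast
    then have "v + w = (x + x') @\<^sub>v (y + y')"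
      using car by (simp add: append_vec_add [of _ n _ _ m])
    moreover have "(x + x', y + y') \<in> S"
      using assms * unfolding lin_rel_def by blast
    ultimately show "v + w \<in> {x @\<^sub>v y | x y. (x, y) \<in> S}"
      by blast
  next
    fix c v assume "v \<in> {x @\<^sub>v y | x y. (x, y) \<in> S}"
    then obtain x y where *: "v = x @\<^sub>v y" "(x, y) \<in> S"
      by blast
    then have "(c \<cdot>\<^sub>v x, c \<cdot>\<^sub>v y) \<in> S"
      using assms unfolding lin_rel_def by blast
    then show "c \<cdot>\<^sub>v v \<in> {x @\<^sub>v y | x y. (x, y) \<in> S}"
      using * by (auto simp: smult_append)
  qed (use car in auto)
qed

lemma span_rel_lin_rel:
  assumes "dim_col A = dim_col B"
  shows "lin_rel (dim_row A) (dim_row B) (span_rel A B)"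
  unfolding lin_rel_def
proof (intro conjI allI impI)
  show "(0\<^sub>v (dim_row A), 0\<^sub>v (dim_row B)) \<in> span_rel A B"
    unfolding span_rel_def using assms
    by (intro CollectI exI [of _ "0\<^sub>v (dim_col A)"]) (simp add: mult_mat_zero_vec)
next
  fix x y x' y' assume "(x, y) \<in> span_rel A B \<and> (x', y') \<in> span_rel A B"
  then obtain z z' where z: "z \<in> carrier_vec (dim_col A)" "z' \<in> carrier_vec (dim_col A)"
    "x = fract_mat A *\<^sub>v z" "y = fract_mat B *\<^sub>v z" "x' = fract_mat A *\<^sub>v z'" "y' = fract_mat B *\<^sub>v z'"
    by (auto simp: span_rel_def)
  have "fract_mat C *\<^sub>v (z + z') = fract_mat C *\<^sub>v z + fract_mat C *\<^sub>v z'" if "dim_col C = dim_col A" for C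
    using z that by (intro mult_add_distrib_mat_vec [of _ "dim_row C" "dim_col A"]) auto
  then show "(x + x', y + y') \<in> span_rel A B"
    unfolding span_rel_def using z assms by (intro CollectI exI [of _ "z + z'"]) simp
next
  fix c x y assume "(x, y) \<in> span_rel A B"
  then obtain z where "z \<in> carrier_vec (dim_col A)" "x = fract_mat A *\<^sub>v z" "y = fract_mat B *\<^sub>v z"
    by (auto simp: span_rel_def)
  then show "(c \<cdot>\<^sub>v x, c \<cdot>\<^sub>v y) \<in> span_rel A B"
    unfolding span_rel_def using assms by (intro CollectI exI [of _ "c \<cdot>\<^sub>v z"]) (simp add: mult_mat_vec_smult)
qed (auto simp: span_rel_def)

text \<open>A basis of the subspace is scaled by a common denominator of all its entries. A nonzero
  scalar of the field does not change the space spanned, and the scaled matrix has entries in the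
  ring; its upper and lower rows are the two legs.\<close>

lemma span_rel_surj:
  fixes S :: "('a::idom fract vec \<times> 'a fract vec) set"
  assumes "lin_rel n m S"
  obtains A B where "dim_col A = dim_col B" "dim_row A = n" "dim_row B = m" "S = span_rel A B"
proof -
  have car: "x \<in> carrier_vec n" "y \<in> carrier_vec m" if "(x, y) \<in> S" for x y
    using assms that by (auto simp: lin_rel_def)
  obtain K where K: "dim_row K = n + m" "{x @\<^sub>v y | x y. (x, y) \<in> S} = (\<lambda>z. K *\<^sub>v z) ` carrier_vec (dim_col K)"
    using submod_basis [OF principal_ideals_field submod_lin_rel [OF assms]] by blast
  obtain d W where W: "d \<noteq> 0" "dim_row W = dim_row K" "dim_col W = dim_col K" "to_fract d \<cdot>\<^sub>m K = fract_mat W"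
    by (rule mat_clear_denominators)
  define A where "A = mat n (dim_col K) (\<lambda>(i, j). W $$ (i, j))"
  define B where "B = mat m (dim_col K) (\<lambda>(i, j). W $$ (n + i, j))"
  have dim: "dim_row A = n" "dim_row B = m" "dim_col A = dim_col K" "dim_col B = dim_col K"
    by (simp_all add: A_def B_def)
  have Wz: "K *\<^sub>v (to_fract d \<cdot>\<^sub>v z) = (fract_mat A *\<^sub>v z) @\<^sub>v (fract_mat B *\<^sub>v z)" if "z \<in> carrier_vec (dim_col K)" for z
  proof -
    have "K *\<^sub>v (to_fract d \<cdot>\<^sub>v z) = (to_fract d \<cdot>\<^sub>m K) *\<^sub>v z"
      using that by (intro eq_vecI) auto
    also have "\<dots> = (fract_mat A *\<^sub>v z) @\<^sub>v (fract_mat B *\<^sub>v z)"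
      unfolding W(4) using that K W by (intro eq_vecI) (auto simp: A_def B_def scalar_prod_def)
    finally show ?thesis .
  qed
  have "S = span_rel A B"
  proof (intro equalityI subrelI)
    fix x y assume xy: "(x, y) \<in> S"
    then obtain z where z: "z \<in> carrier_vec (dim_col K)" "x @\<^sub>v y = K *\<^sub>v z"
      using K(2) by blast
    define w where "w = inverse (to_fract d) \<cdot>\<^sub>v z"
    have "w \<in> carrier_vec (dim_col K)" "x @\<^sub>v y = K *\<^sub>v (to_fract d \<cdot>\<^sub>v w)"
      using z W(1) by (simp_all add: w_def smult_inverse)
    with Wz [of w] show "(x, y) \<in> span_rel A B"
      using car [OF xy] dim by (auto simp: append_vec_inject span_rel_def)
  next
    fix x y assume "(x, y) \<in> span_rel A B"
    then obtain z where z: "z \<in> carrier_vec (dim_col K)" "x = fract_mat A *\<^sub>v z" "y = fract_mat B *\<^sub>v z"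
      using dim by (auto simp: span_rel_def)
    then have "x @\<^sub>v y \<in> {x @\<^sub>v y | x y. (x, y) \<in> S}"
      unfolding K(2) using Wz [of z] by (intro image_eqI [of _ _ "to_fract d \<cdot>\<^sub>v z"]) auto
    then obtain x' y' where "(x', y') \<in> S" "x @\<^sub>v y = x' @\<^sub>v y'"
      by blast
    with car z dim show "(x, y) \<in> S"
      by (auto simp: append_vec_inject)
  qed
  with that dim show ?thesis by metis
qed

text \<open>A solution over the fractions, multiplied by a denominator, is a solution over the ring.
  It factors through the pullback there, and dividing again gives the required parameter
  vector.\<close>

lemma span_rel_pullback:
  fixes f :: "'a::idom mat"
  assumes fg: "dim_row f = dim_row g" and pb: "pullback_sq Mat f g p q"
  shows "span_rel p q = cospan_rel f g"
proof (intro equalityI subrelI)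
  interpret is_prop "Mat :: 'a mat prop_data" by (rule Mat_is_prop)
  note D = pullback_sqD [OF pb, simplified]
  fix x y
  {
    assume "(x, y) \<in> span_rel p q"
    then obtain z where "z \<in> carrier_vec (dim_col p)" "x = fract_mat p *\<^sub>v z" "y = fract_mat q *\<^sub>v z"
      by (auto simp: span_rel_def)
    then show "(x, y) \<in> cospan_rel f g"
      using D by (simp add: cospan_rel_def flip: fract_mat_assoc)
  next
    assume xy: "(x, y) \<in> cospan_rel f g"
    \<comment> \<open>Concatenating \<open>x\<close> and \<open>y\<close> first yields one
      denominator for both; different ones would destroy the equation.\<close>
    obtain d w where d: "d \<noteq> 0" "dim_vec w = dim_vec (x @\<^sub>v y)" "to_fract d \<cdot>\<^sub>v (x @\<^sub>v y) = fract_vec w"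
      by (rule vec_clear_denominators)
    have "w \<in> carrier_vec (dim_col f + dim_col g)"
      using d xy by (intro carrier_vecI) (auto simp: cospan_rel_def)
    then obtain x' y' where w: "x' \<in> carrier_vec (dim_col f)" "y' \<in> carrier_vec (dim_col g)" "w = x' @\<^sub>v y'"
      by (rule vec_splitE)
    have "fract_vec w = fract_vec x' @\<^sub>v fract_vec y'"
      unfolding w by (rule eq_vecI) auto
    then have x': "to_fract d \<cdot>\<^sub>v x = fract_vec x'" "to_fract d \<cdot>\<^sub>v y = fract_vec y'"
      using d w xy by (simp_all add: smult_append append_vec_inject cospan_rel_def)
    have "fract_mat f *\<^sub>v (to_fract d \<cdot>\<^sub>v x) = fract_mat g *\<^sub>v (to_fract d \<cdot>\<^sub>v y)"
      using xy by (auto simp: cospan_rel_def mult_mat_vec_smult)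
    then have "f *\<^sub>v x' = g *\<^sub>v y'"
      unfolding x' using w by (simp add: fract_mat_mult_vec) (erule to_fract.vec_hom_inj)
    then obtain z where z: "z \<in> carrier_vec (dim_col p)" "p *\<^sub>v z = x'" "q *\<^sub>v z = y'"
      using pb w unfolding pullback_Mat_iff [OF fg] vec_pullback_def by metis
    define v where "v = inverse (to_fract d) \<cdot>\<^sub>v fract_vec z"
    have "fract_mat p *\<^sub>v v = inverse (to_fract d) \<cdot>\<^sub>v (to_fract d \<cdot>\<^sub>v x)"
      "fract_mat q *\<^sub>v v = inverse (to_fract d) \<cdot>\<^sub>v (to_fract d \<cdot>\<^sub>v y)"
      using z D unfolding x' v_def by (simp_all add: mult_mat_vec_smult fract_mat_mult_vec)
    then have "x = fract_mat p *\<^sub>v v" "y = fract_mat q *\<^sub>v v"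
      using d by (simp_all add: smult_inverse)
    then show "(x, y) \<in> span_rel p q"
      unfolding span_rel_def using z by (intro CollectI exI [of _ v]) (simp add: v_def)
  }
qed

lemma fract_mat_of_row: "fract_mat (mat_of_row a) = mat_of_row (fract_vec a)"
  by (rule eq_matI) (auto simp: mat_of_row_def)

lemma mat_of_row_mult_vec: "(mat_of_row a *\<^sub>v x) = vec 1 (\<lambda>_. a \<bullet> x)"
  by (rule eq_vecI) auto

text \<open>If \<open>(x, y)\<close> were not in the relation of the span, some functional over \<open>R\<close> would vanish on that
  relation but not on \<open>(x, y)\<close>.  Its two components form a cocone on the span, hence factor through the
  pushout, which forces the functional to vanish on \<open>(x, y)\<close>.\<close>

lemma cospan_rel_pushout:
  fixes f :: "'a::idom mat"
  assumes fg: "dim_col f = dim_col g" and po: "pullback_sq (op_prop Mat) f g p q"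
  shows "cospan_rel p q = span_rel f g"
proof (intro equalityI subrelI)
  interpret is_prop "op_prop (Mat :: 'a mat prop_data)"
    by (rule is_prop.op_is_prop [OF Mat_is_prop])
  note D = pullback_sqD [OF po, unfolded op_prop_simps, simplified]
  fix x y
  {
    assume "(x, y) \<in> span_rel f g"
    then obtain z where "z \<in> carrier_vec (dim_col f)" "x = fract_mat f *\<^sub>v z" "y = fract_mat g *\<^sub>v z"
      by (auto simp: span_rel_def)
    then show "(x, y) \<in> cospan_rel p q"
      using D fg by (simp add: cospan_rel_def flip: fract_mat_assoc)
  next
    assume xy: "(x, y) \<in> cospan_rel p q"
    then have car: "x \<in> carrier_vec (dim_row f)" "y \<in> carrier_vec (dim_row g)"
      using D by (simp_all add: cospan_rel_def)
    show "(x, y) \<in> span_rel f g"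
    proof (rule ccontr)
      assume notin: "(x, y) \<notin> span_rel f g"
      let ?T = "{x @\<^sub>v y | x y. (x, y) \<in> span_rel f g}"
      have "x @\<^sub>v y \<notin> ?T"
      proof
        assume "x @\<^sub>v y \<in> ?T"
        then obtain x' y' where "x @\<^sub>v y = x' @\<^sub>v y'" "(x', y') \<in> span_rel f g"
          by blast
        with notin car show False
          by (auto simp: append_vec_inject span_rel_def)
      qed
      then obtain u where u: "u \<in> carrier_vec (dim_row f + dim_row g)" "\<forall>s\<in>?T. u \<bullet> s = 0" "u \<bullet> (x @\<^sub>v y) \<noteq> 0"
        using separating_functional [OF submod_lin_rel [OF span_rel_lin_rel [OF fg]], of "x @\<^sub>v y"] car by auto
      \<comment> \<open>The functional must have entries in the ring to give arrows of
        \<open>Mat\<close> into the object 1; scaling keeps its zeros.\<close>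
      obtain d w where d: "d \<noteq> 0" "dim_vec w = dim_vec u" "to_fract d \<cdot>\<^sub>v u = fract_vec w"
        by (rule vec_clear_denominators)
      have "w \<in> carrier_vec (dim_row f + dim_row g)"
        using d u by (intro carrier_vecI) simp
      then obtain a b where w: "a \<in> carrier_vec (dim_row f)" "b \<in> carrier_vec (dim_row g)" "w = a @\<^sub>v b"
        by (rule vec_splitE)
      have fw: "fract_vec w = fract_vec a @\<^sub>v fract_vec b"
        unfolding w by (rule eq_vecI) auto
      have wv: "fract_vec a \<bullet> x' + fract_vec b \<bullet> y' = to_fract d * (u \<bullet> (x' @\<^sub>v y'))"
        if "x' \<in> carrier_vec (dim_row f)" "y' \<in> carrier_vec (dim_row g)" for x' y'
      proof -
        have "fract_vec a \<bullet> x' + fract_vec b \<bullet> y' = fract_vec w \<bullet> (x' @\<^sub>v y')"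
          unfolding fw using that w by (intro scalar_prod_append [symmetric]) auto
        also have "\<dots> = to_fract d * (u \<bullet> (x' @\<^sub>v y'))"
          unfolding d(3) [symmetric] using that u by (intro smult_scalar_prod_distrib) auto
        finally show ?thesis .
      qed
      \<comment> \<open>The sign of \<open>b\<close> turns the vanishing of the functional at a pair
        into the equation between \<open>p'\<close> and \<open>q'\<close> that a cocone
        requires.\<close>
      define p' where "p' = mat_of_row a"
      define q' where "q' = mat_of_row (- b)"
      have dim: "dim_row p' = 1" "dim_row q' = 1" "dim_col p' = dim_row f" "dim_col q' = dim_row g"
        using w by (simp_all add: p'_def q'_def)
      have fract_minus: "fract_vec (- b) = - fract_vec b"
        by (rule eq_vecI) auto
      have pq': "fract_mat p' *\<^sub>v x' = fract_mat q' *\<^sub>v y' \<longleftrightarrow> u \<bullet> (x' @\<^sub>v y') = 0"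
        if "x' \<in> carrier_vec (dim_row f)" "y' \<in> carrier_vec (dim_row g)" for x' y'
      proof -
        have "fract_mat p' *\<^sub>v x' = fract_mat q' *\<^sub>v y' \<longleftrightarrow> fract_vec a \<bullet> x' = - (fract_vec b \<bullet> y')"
          using that w by (auto simp: p'_def q'_def fract_mat_of_row mat_of_row_mult_vec fract_minus vec_eq_iff)
        also have "\<dots> \<longleftrightarrow> fract_vec a \<bullet> x' + fract_vec b \<bullet> y' = 0"
          by (simp add: eq_neg_iff_add_eq_0)
        also have "\<dots> \<longleftrightarrow> u \<bullet> (x' @\<^sub>v y') = 0"
          using wv [OF that] d(1) by simp
        finally show ?thesis .
      qed
      \<comment> \<open>The cocone equation is checked over the fractions, where \<open>u\<close> is
        known to vanish, and then descends to the ring by injectivity of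
        \<open>to_fract\<close>.\<close>
      have "fract_mat (p' * f) *\<^sub>v v = fract_mat (q' * g) *\<^sub>v v" if "v \<in> carrier_vec (dim_col g)" for v
      proof -
        have "(fract_mat f *\<^sub>v v, fract_mat g *\<^sub>v v) \<in> span_rel f g"
          using that fg by (auto simp: span_rel_def)
        then have "u \<bullet> ((fract_mat f *\<^sub>v v) @\<^sub>v (fract_mat g *\<^sub>v v)) = 0"
          using u(2) by blast
        then show ?thesis
          using pq' [of "fract_mat f *\<^sub>v v" "fract_mat g *\<^sub>v v"] that dim fg by (simp add: fract_mat_assoc)
      qed
      then have "fract_mat (p' * f) = fract_mat (q' * g)"
        by (intro mat_ext_vec) (use dim fg in auto)
      then have "p' * f = q' * g"
        by (rule to_fract.mat_hom_inj)
      then obtain t where t: "dim_col t = dim_row p" "t * p = p'" "t * q = q'"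
        using pullback_factor [OF po, of p' q'] dim by (auto simp: op_prop_simps)
      have "fract_mat p' *\<^sub>v x = fract_mat t *\<^sub>v (fract_mat p *\<^sub>v x)"
        using t car D by (simp add: fract_mat_assoc flip: t(2))
      also have "\<dots> = fract_mat t *\<^sub>v (fract_mat q *\<^sub>v y)"
        using xy by (simp add: cospan_rel_def)
      also have "\<dots> = fract_mat q' *\<^sub>v y"
        using t car D by (simp add: fract_mat_assoc flip: t(3))
      finally show False
        using pq' [OF car] u(3) by simp
    qed
  }
qed

lemma iso_MatE:
  fixes u :: "'a::comm_ring_1 mat"
  assumes "iso_arr Mat u"
  obtains v where "dim_col v = dim_row u" "dim_row v = dim_col u" "v * u = 1\<^sub>m (dim_col u)" "u * v = 1\<^sub>m (dim_row u)"
  using assms by (auto simp: iso_arr_def)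

section \<open>Relations of classes, structural arrows, sums and composites\<close>

text \<open>Another representative precomposes both legs with a matrix \<open>u\<close>, which
  amounts to replacing the parameter \<open>z\<close> by its image under \<open>u\<close>.\<close>

lemma Phi_span_cls:
  assumes AB: "dim_col A = dim_col B"
  shows "Phi (span_cls Mat A B) = span_rel A B"
proof (intro equalityI subrelI)
  interpret is_prop "Mat :: 'a mat prop_data" by (rule Mat_is_prop)
  fix x y
  {
    assume "(x, y) \<in> Phi (span_cls Mat A B)"
    then obtain u z where "dim_row u = dim_col A" "z \<in> carrier_vec (dim_col u)"
      "x = fract_mat (A * u) *\<^sub>v z" "y = fract_mat (B * u) *\<^sub>v z"
      by (auto simp: Phi_def span_cls_def)
    then show "(x, y) \<in> span_rel A B"
      using AB unfolding span_rel_def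
      by (intro CollectI exI [of _ "fract_mat u *\<^sub>v z"]) (simp add: fract_mat_assoc)
  next
    assume "(x, y) \<in> span_rel A B"
    moreover have "(A, B) \<in> span_cls Mat A B"
      using AB by (simp add: span_cls_self)
    ultimately show "(x, y) \<in> Phi (span_cls Mat A B)"
      unfolding Phi_def span_rel_def by blast
  }
qed

text \<open>Another representative multiplies both sides of the defining equation by an invertible
  \<open>u\<close>, and its inverse \<open>v\<close> cancels it.\<close>

lemma Psi_cospan_cls:
  assumes AB: "dim_row A = dim_row B"
  shows "Psi (span_cls (op_prop Mat) A B) = cospan_rel A B"
proof (intro equalityI subrelI)
  interpret is_prop "op_prop (Mat :: 'a mat prop_data)"
    by (rule is_prop.op_is_prop [OF Mat_is_prop])
  fix x y
  {
    assume "(x, y) \<in> Psi (span_cls (op_prop Mat) A B)"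
    then obtain u where u: "iso_arr (op_prop Mat) u" "dim_col u = dim_row A"
      "x \<in> carrier_vec (dim_col A)" "y \<in> carrier_vec (dim_col B)"
      "fract_mat (u * A) *\<^sub>v x = fract_mat (u * B) *\<^sub>v y"
      by (auto simp: Psi_def span_cls_def op_prop_simps)
    then have "iso_arr Mat u"
      by (simp add: is_prop.iso_arr_op [OF Mat_is_prop])
    then obtain v where v: "dim_col v = dim_row u" "dim_row v = dim_col u" "v * u = 1\<^sub>m (dim_col u)"
      by (rule iso_MatE)
    have *: "fract_mat v *\<^sub>v (fract_mat (u * C) *\<^sub>v z) = fract_mat C *\<^sub>v z"
      if "dim_row C = dim_row A" "z \<in> carrier_vec (dim_col C)" for C z
    proof -
      have "fract_mat v *\<^sub>v (fract_mat (u * C) *\<^sub>v z) = fract_mat (v * u) *\<^sub>v (fract_mat C *\<^sub>v z)"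
        using v(1) u(2) that by (simp add: fract_mat_assoc)
      also have "\<dots> = fract_mat C *\<^sub>v z"
        using that u(2) unfolding v(3) to_fract.mat_hom_one by simp
      finally show ?thesis .
    qed
    have "fract_mat A *\<^sub>v x = fract_mat B *\<^sub>v y"
      using * [of A x] * [of B y] u AB by simp
    with u show "(x, y) \<in> cospan_rel A B"
      by (simp add: cospan_rel_def)
  next
    assume "(x, y) \<in> cospan_rel A B"
    moreover have "(A, B) \<in> span_cls (op_prop Mat) A B"
      using AB by (intro span_cls_self) (simp_all add: op_prop_simps)
    ultimately show "(x, y) \<in> Psi (span_cls (op_prop Mat) A B)"
      unfolding Psi_def cospan_rel_def by blast
  }
qed

lemma span_rel_one: "span_rel (1\<^sub>m n) (1\<^sub>m n) = {(x, x) | x. x \<in> carrier_vec n}"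
  unfolding span_rel_def to_fract.mat_hom_one by (intro Collect_cong) (metis carrier_matD(2) one_carrier_mat one_mult_mat_vec index_map_mat(3))

lemma cospan_rel_one: "cospan_rel (1\<^sub>m n) (1\<^sub>m n) = {(x, x) | x. x \<in> carrier_vec n}"
  unfolding cospan_rel_def to_fract.mat_hom_one by auto

lemma span_rel_swap:
  "span_rel (1\<^sub>m (n + m) :: 'a::idom mat) (swap_mat n m) = {(x @\<^sub>v y, y @\<^sub>v x) | x y. x \<in> carrier_vec n \<and> y \<in> carrier_vec m}"
proof (intro equalityI subrelI)
  fix v w :: "'a fract vec"
  {
    assume "(v, w) \<in> span_rel (1\<^sub>m (n + m)) (swap_mat n m)"
    then have "v \<in> carrier_vec (n + m)" "w = swap_mat n m *\<^sub>v v"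
      by (auto simp: span_rel_def to_fract.mat_hom_one fract_mat_swap_mat)
    moreover from this(1) obtain x y where "x \<in> carrier_vec n" "y \<in> carrier_vec m" "v = x @\<^sub>v y"
      by (rule vec_splitE)
    ultimately show "(v, w) \<in> {(x @\<^sub>v y, y @\<^sub>v x) | x y. x \<in> carrier_vec n \<and> y \<in> carrier_vec m}"
      by (auto simp: swap_mat_mult_vec)
  next
    assume "(v, w) \<in> {(x @\<^sub>v y, y @\<^sub>v x) | x y. x \<in> carrier_vec n \<and> y \<in> carrier_vec m}"
    then obtain x y where "x \<in> carrier_vec n" "y \<in> carrier_vec m" "v = x @\<^sub>v y" "w = y @\<^sub>v x"
      by blast
    then show "(v, w) \<in> span_rel (1\<^sub>m (n + m)) (swap_mat n m)"
      unfolding span_rel_def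
      by (intro CollectI exI [of _ "x @\<^sub>v y"]) (simp add: to_fract.mat_hom_one fract_mat_swap_mat swap_mat_mult_vec)
  }
qed

lemma cospan_rel_swap:
  "cospan_rel (1\<^sub>m (n + m) :: 'a::idom mat) (swap_mat m n) = {(x @\<^sub>v y, y @\<^sub>v x) | x y. x \<in> carrier_vec n \<and> y \<in> carrier_vec m}"
proof (intro equalityI subrelI)
  fix v w :: "'a fract vec"
  {
    assume "(v, w) \<in> cospan_rel (1\<^sub>m (n + m)) (swap_mat m n)"
    then have "w \<in> carrier_vec (m + n)" "v = swap_mat m n *\<^sub>v w"
      by (auto simp: cospan_rel_def to_fract.mat_hom_one fract_mat_swap_mat)
    moreover from this(1) obtain x y where "x \<in> carrier_vec m" "y \<in> carrier_vec n" "w = x @\<^sub>v y"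
      by (rule vec_splitE)
    ultimately show "(v, w) \<in> {(x @\<^sub>v y, y @\<^sub>v x) | x y. x \<in> carrier_vec n \<and> y \<in> carrier_vec m}"
      by (auto simp: swap_mat_mult_vec)
  next
    assume "(v, w) \<in> {(x @\<^sub>v y, y @\<^sub>v x) | x y. x \<in> carrier_vec n \<and> y \<in> carrier_vec m}"
    then obtain x y where "x \<in> carrier_vec n" "y \<in> carrier_vec m" "v = x @\<^sub>v y" "w = y @\<^sub>v x"
      by blast
    then show "(v, w) \<in> cospan_rel (1\<^sub>m (n + m)) (swap_mat m n)"
      by (simp add: cospan_rel_def to_fract.mat_hom_one fract_mat_swap_mat swap_mat_mult_vec)
  }
qed

lemma span_rel_dsum:
  assumes "dim_col A = dim_col B" "dim_col A' = dim_col B'"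
  shows "span_rel (dsum A A') (dsum B B') =
    {(x @\<^sub>v x', y @\<^sub>v y') | x y x' y'. (x, y) \<in> span_rel A B \<and> (x', y') \<in> span_rel A' B'}"
proof (intro equalityI subrelI)
  fix v w
  {
    assume "(v, w) \<in> span_rel (dsum A A') (dsum B B')"
    then obtain z where z: "z \<in> carrier_vec (dim_col A + dim_col A')"
      "v = fract_mat (dsum A A') *\<^sub>v z" "w = fract_mat (dsum B B') *\<^sub>v z"
      by (auto simp: span_rel_def)
    then obtain x y where "x \<in> carrier_vec (dim_col A)" "y \<in> carrier_vec (dim_col A')" "z = x @\<^sub>v y"
      by (metis vec_splitE)
    moreover from this(1,2) have "(fract_mat A *\<^sub>v x, fract_mat B *\<^sub>v x) \<in> span_rel A B"
        "(fract_mat A' *\<^sub>v y, fract_mat B' *\<^sub>v y) \<in> span_rel A' B'"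
      by (auto simp: span_rel_def)
    ultimately show "(v, w) \<in> {(x @\<^sub>v x', y @\<^sub>v y') | x y x' y'. (x, y) \<in> span_rel A B \<and> (x', y') \<in> span_rel A' B'}"
      using assms z unfolding fract_mat_dsum by (fastforce simp: dsum_mult_vec)
  next
    assume "(v, w) \<in> {(x @\<^sub>v x', y @\<^sub>v y') | x y x' y'. (x, y) \<in> span_rel A B \<and> (x', y') \<in> span_rel A' B'}"
    then obtain z z' where "z \<in> carrier_vec (dim_col A)" "z' \<in> carrier_vec (dim_col A')"
      "v = (fract_mat A *\<^sub>v z) @\<^sub>v (fract_mat A' *\<^sub>v z')" "w = (fract_mat B *\<^sub>v z) @\<^sub>v (fract_mat B' *\<^sub>v z')"
      by (auto simp: span_rel_def)
    with assms show "(v, w) \<in> span_rel (dsum A A') (dsum B B')"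
      unfolding span_rel_def fract_mat_dsum
      by (intro CollectI exI [of _ "z @\<^sub>v z'"]) (simp add: dsum_mult_vec)
  }
qed

lemma cospan_rel_dsum:
  assumes "dim_row A = dim_row B" "dim_row A' = dim_row B'"
  shows "cospan_rel (dsum A A') (dsum B B') =
    {(x @\<^sub>v x', y @\<^sub>v y') | x y x' y'. (x, y) \<in> cospan_rel A B \<and> (x', y') \<in> cospan_rel A' B'}"
proof (intro equalityI subrelI)
  fix v w
  {
    assume vw: "(v, w) \<in> cospan_rel (dsum A A') (dsum B B')"
    then have "v \<in> carrier_vec (dim_col A + dim_col A')" "w \<in> carrier_vec (dim_col B + dim_col B')"
      by (auto simp: cospan_rel_def)
    then obtain x x' y y' where *: "x \<in> carrier_vec (dim_col A)" "x' \<in> carrier_vec (dim_col A')" "v = x @\<^sub>v x'"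
      "y \<in> carrier_vec (dim_col B)" "y' \<in> carrier_vec (dim_col B')" "w = y @\<^sub>v y'"
      by (metis vec_splitE)
    with vw have "(x, y) \<in> cospan_rel A B \<and> (x', y') \<in> cospan_rel A' B'"
      using assms unfolding cospan_rel_def fract_mat_dsum by (simp add: dsum_mult_vec append_vec_inject)
    with * show "(v, w) \<in> {(x @\<^sub>v x', y @\<^sub>v y') | x y x' y'. (x, y) \<in> cospan_rel A B \<and> (x', y') \<in> cospan_rel A' B'}"
      by blast
  next
    assume "(v, w) \<in> {(x @\<^sub>v x', y @\<^sub>v y') | x y x' y'. (x, y) \<in> cospan_rel A B \<and> (x', y') \<in> cospan_rel A' B'}"
    then obtain x y x' y' where "(x, y) \<in> cospan_rel A B" "(x', y') \<in> cospan_rel A' B'" "v = x @\<^sub>v x'" "w = y @\<^sub>v y'"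
      by blast
    then show "(v, w) \<in> cospan_rel (dsum A A') (dsum B B')"
      by (auto simp: cospan_rel_def fract_mat_dsum dsum_mult_vec)
  }
qed

text \<open>Parameters \<open>z\<close> and \<open>w\<close> of two composable pairs share the
  middle vector exactly when \<open>(z, w)\<close> lies in \<open>cospan_rel B A'\<close>. By
  \<open>span_rel_pullback\<close> these are the pairs parametrised by the apex of the
  pullback.\<close>

lemma span_rel_seq:
  fixes A :: "'a::idom mat"
  assumes dim: "dim_col A = dim_col B" "dim_col A' = dim_col B'" "dim_row B = dim_row A'"
    and pb: "pullback_sq Mat B A' p q"
  shows "span_rel (A * p) (B' * q) = span_rel A B O span_rel A' B'"
proof (intro equalityI subrelI)
  interpret is_prop "Mat :: 'a mat prop_data" by (rule Mat_is_prop)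
  note D = pullback_sqD [OF pb, simplified]
  fix x y
  {
    assume "(x, y) \<in> span_rel (A * p) (B' * q)"
    then obtain z where z: "z \<in> carrier_vec (dim_col p)"
      "x = fract_mat (A * p) *\<^sub>v z" "y = fract_mat (B' * q) *\<^sub>v z"
      by (auto simp: span_rel_def)
    have "(x, fract_mat B *\<^sub>v (fract_mat p *\<^sub>v z)) \<in> span_rel A B"
      unfolding span_rel_def using z D dim
      by (intro CollectI exI [of _ "fract_mat p *\<^sub>v z"]) (simp add: fract_mat_assoc)
    moreover have "(fract_mat A' *\<^sub>v (fract_mat q *\<^sub>v z), y) \<in> span_rel A' B'"
      unfolding span_rel_def using z D dim
      by (intro CollectI exI [of _ "fract_mat q *\<^sub>v z"]) (simp add: fract_mat_assoc)
    moreover have "fract_mat B *\<^sub>v (fract_mat p *\<^sub>v z) = fract_mat A' *\<^sub>v (fract_mat q *\<^sub>v z)"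
      using fract_mat_assoc [of B p z] fract_mat_assoc [of A' q z] z(1) D dim by simp
    ultimately show "(x, y) \<in> span_rel A B O span_rel A' B'"
      by auto
  next
    assume "(x, y) \<in> span_rel A B O span_rel A' B'"
    then obtain z w where z: "z \<in> carrier_vec (dim_col A)" "w \<in> carrier_vec (dim_col A')"
      "x = fract_mat A *\<^sub>v z" "y = fract_mat B' *\<^sub>v w" "fract_mat B *\<^sub>v z = fract_mat A' *\<^sub>v w"
      by (auto simp: span_rel_def)
    then have "(z, w) \<in> span_rel p q"
      unfolding span_rel_pullback [OF dim(3) pb] using dim by (simp add: cospan_rel_def)
    then obtain v where "v \<in> carrier_vec (dim_col p)" "z = fract_mat p *\<^sub>v v" "w = fract_mat q *\<^sub>v v"
      by (auto simp: span_rel_def)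
    then show "(x, y) \<in> span_rel (A * p) (B' * q)"
      unfolding span_rel_def using z D dim
      by (intro CollectI exI [of _ v]) (simp add: fract_mat_assoc)
  }
qed

text \<open>The hard inclusion must produce a middle vector. The images of \<open>x\<close> and
  \<open>y\<close> form a pair in \<open>cospan_rel p q\<close>, which by
  \<open>cospan_rel_pushout\<close> is the relation of the span \<open>(B, A')\<close>; its
  parameter is that vector.\<close>

lemma cospan_rel_seq:
  fixes A :: "'a::idom mat"
  assumes dim: "dim_row A = dim_row B" "dim_row A' = dim_row B'" "dim_col B = dim_col A'"
    and po: "pullback_sq (op_prop Mat) B A' p q"
  shows "cospan_rel (p * A) (q * B') = cospan_rel A B O cospan_rel A' B'"
proof (intro equalityI subrelI)
  interpret is_prop "op_prop (Mat :: 'a mat prop_data)"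
    by (rule is_prop.op_is_prop [OF Mat_is_prop])
  note D = pullback_sqD [OF po, unfolded op_prop_simps, simplified]
  fix x y
  {
    assume "(x, y) \<in> cospan_rel (p * A) (q * B')"
    then have xy: "x \<in> carrier_vec (dim_col A)" "y \<in> carrier_vec (dim_col B')"
      "fract_mat (p * A) *\<^sub>v x = fract_mat (q * B') *\<^sub>v y"
      by (auto simp: cospan_rel_def)
    then have "(fract_mat A *\<^sub>v x, fract_mat B' *\<^sub>v y) \<in> cospan_rel p q"
      using D dim by (simp add: cospan_rel_def fract_mat_assoc)
    then obtain v where "v \<in> carrier_vec (dim_col B)" "fract_mat A *\<^sub>v x = fract_mat B *\<^sub>v v"
        "fract_mat B' *\<^sub>v y = fract_mat A' *\<^sub>v v"
      unfolding cospan_rel_pushout [OF dim(3) po] by (auto simp: span_rel_def)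
    with xy have "(x, v) \<in> cospan_rel A B" "(v, y) \<in> cospan_rel A' B'"
      using dim by (simp_all add: cospan_rel_def)
    then show "(x, y) \<in> cospan_rel A B O cospan_rel A' B'"
      by blast
  next
    assume "(x, y) \<in> cospan_rel A B O cospan_rel A' B'"
    then obtain v where v: "(x, v) \<in> cospan_rel A B" "(v, y) \<in> cospan_rel A' B'"
      by blast
    have "fract_mat (p * A) *\<^sub>v x = fract_mat (p * B) *\<^sub>v v"
      using v dim(1,3) D(1-5) by (auto simp: cospan_rel_def fract_mat_assoc)
    also have "\<dots> = fract_mat (q * B') *\<^sub>v y"
      using v dim(2,3) D(1-5) unfolding D(6) by (auto simp: cospan_rel_def fract_mat_assoc)
    finally show "(x, y) \<in> cospan_rel (p * A) (q * B')"
      using v by (simp add: cospan_rel_def)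
  }
qed

section \<open>The morphisms to the PROP of linear relations\<close>

lemma prop_morphismI:
  assumes "\<And>f. f \<in> arr P \<Longrightarrow> F f \<in> arr Q" "\<And>f. f \<in> arr P \<Longrightarrow> src Q (F f) = src P f"
    "\<And>f. f \<in> arr P \<Longrightarrow> tgt Q (F f) = tgt P f" "\<And>n. F (idn P n) = idn Q n"
    "\<And>f g. \<lbrakk>f \<in> arr P; g \<in> arr P; tgt P f = src P g\<rbrakk> \<Longrightarrow> F (seq P f g) = seq Q (F f) (F g)"
    "\<And>f g. \<lbrakk>f \<in> arr P; g \<in> arr P\<rbrakk> \<Longrightarrow> F (tns P f g) = tns Q (F f) (F g)"
    "\<And>n m. F (swp P n m) = swp Q n m"
  shows "prop_morphism P Q F"
  using assms unfolding prop_morphism_def by blast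

lemma prop_morphism_comp:
  assumes "prop_morphism P Q F" "prop_morphism Q R G"
  shows "prop_morphism P R (\<lambda>f. G (F f))"
  using prop_morphismD [OF assms(1)] prop_morphismD [OF assms(2)] by (intro prop_morphismI) simp_all

text \<open>The laws are equations between typed composites. As \<open>F\<close> preserves sources
  and targets, composable arrows of the image lift to composable arrows, and each law follows from
  its counterpart in \<open>P\<close>. This spares a direct verification for
  \<open>SV\<close>.\<close>

lemma is_prop_image:
  assumes "is_prop P" and F: "prop_morphism P Q F" and surj: "arr Q = F ` arr P"
  shows "is_prop Q"
proof -
  interpret is_prop P by fact
  note D = prop_morphismD [OF F]
  note idn = D(4) [symmetric] and swp = D(7) [symmetric]
  show ?thesis
  proof (unfold_locales, unfold surj idn swp)
    fix f assume "f \<in> F ` arr P"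
    then obtain f' where f: "f' \<in> arr P" "f = F f'" by blast
    show "seq Q (F (idn P (src Q f))) f = f" "seq Q f (F (idn P (tgt Q f))) = f"
      using f by (simp_all add: D(2,3) flip: D(5))
    show "tns Q (F (idn P 0)) f = f" "tns Q f (F (idn P 0)) = f"
      using f by (simp_all add: tns_unit flip: D(6))
    fix g assume "g \<in> F ` arr P"
    then obtain g' where g: "g' \<in> arr P" "g = F g'" by blast
    show "tns Q f g \<in> F ` arr P" "src Q (tns Q f g) = src Q f + src Q g" "tgt Q (tns Q f g) = tgt Q f + tgt Q g"
      using f g by (simp_all add: D(2,3) flip: D(6))
    show "seq Q (tns Q f g) (F (swp P (tgt Q f) (tgt Q g))) = seq Q (F (swp P (src Q f) (src Q g))) (tns Q g f)"
      using f g by (simp add: D(2,3) swp_natural flip: D(5,6))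
    {
      assume "tgt Q f = src Q g"
      then show "seq Q f g \<in> F ` arr P" "src Q (seq Q f g) = src Q f" "tgt Q (seq Q f g) = tgt Q g"
        using f g by (simp_all add: D(2,3) flip: D(5))
    }
    fix h assume "h \<in> F ` arr P"
    then obtain h' where h: "h' \<in> arr P" "h = F h'" by blast
    show "tns Q (tns Q f g) h = tns Q f (tns Q g h)"
      using f g h by (simp add: tns_assoc flip: D(6))
    {
      assume "tgt Q f = src Q g" "tgt Q g = src Q h"
      then show "seq Q (seq Q f g) h = seq Q f (seq Q g h)"
        using f g h by (simp add: D(2,3) seq_assoc flip: D(5))
    }
    fix k assume "k \<in> F ` arr P"
    then obtain k' where k: "k' \<in> arr P" "k = F k'" by blast
    assume "tgt Q f = src Q g" "tgt Q h = src Q k"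
    then show "tns Q (seq Q f g) (seq Q h k) = seq Q (tns Q f h) (tns Q g k)"
      using f g h k by (simp add: D(2,3) tns_seq flip: D(5,6))
  next
    fix n m k
    show "F (swp P n (m + k)) = seq Q (tns Q (F (swp P n m)) (F (idn P k))) (tns Q (F (idn P m)) (F (swp P n k)))"
      by (simp add: swp_hexagon flip: D(5,6))
  qed (simp_all add: D(2,3) tns_idn swp_inverse swp_unit flip: D(5,6))
qed

text \<open>\<open>H\<close> evaluates \<open>F\<close> at a chosen preimage under \<open>p\<close>;
  the kernel condition makes the choice irrelevant, and the morphism laws are then checked on
  arbitrary preimages.\<close>

lemma prop_morphism_factor:
  assumes "is_prop P" and p: "prop_morphism P Q p" and surj: "arr Q = p ` arr P" and F: "prop_morphism P X F"
    and ker: "\<And>c c'. \<lbrakk>c \<in> arr P; c' \<in> arr P; p c = p c'\<rbrakk> \<Longrightarrow> F c = F c'"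
  obtains H where "prop_morphism Q X H" "\<forall>c\<in>arr P. H (p c) = F c"
proof -
  interpret is_prop P by fact
  define H where "H S = F (SOME c. c \<in> arr P \<and> p c = S)" for S
  have H: "H (p c) = F c" if c: "c \<in> arr P" for c
  proof -
    have "\<exists>c'. c' \<in> arr P \<and> p c' = p c"
      using c by blast
    from someI_ex [OF this] show ?thesis
      unfolding H_def using ker c by metis
  qed
  note D = prop_morphismD [OF p] and FD = prop_morphismD [OF F]
  have "prop_morphism Q X H"
  proof (rule prop_morphismI)
    fix n m
    show "H (idn Q n) = idn X n" "H (swp Q n m) = swp X n m"
      by (simp_all add: H FD(4,7) flip: D(4,7))
  next
    fix f assume "f \<in> arr Q"
    then obtain f' where f: "f' \<in> arr P" "f = p f'"
      unfolding surj by blast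
    then show "H f \<in> arr X" "src X (H f) = src Q f" "tgt X (H f) = tgt Q f"
      by (simp_all add: H FD(1-3) D(2,3))
    fix g assume "g \<in> arr Q"
    then obtain g' where g: "g' \<in> arr P" "g = p g'"
      unfolding surj by blast
    with f show "H (tns Q f g) = tns X (H f) (H g)"
      by (simp add: H FD(6) flip: D(6))
    assume "tgt Q f = src Q g"
    with f g show "H (seq Q f g) = seq X (H f) (H g)"
      by (simp add: H FD(5) D(2,3) flip: D(5))
  qed
  with H that show ?thesis by blast
qed

lemma SV_simps:
  "arr SV = {S. \<exists>n m. lin_rel n m S}" "idn SV n = {(x, x) | x. x \<in> carrier_vec n}" "seq SV S T = S O T"
  "tns SV S T = {(x @\<^sub>v x', y @\<^sub>v y') | x y x' y'. (x, y) \<in> S \<and> (x', y') \<in> T}"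
  "swp SV n m = {(x @\<^sub>v y, y @\<^sub>v x) | x y. x \<in> carrier_vec n \<and> y \<in> carrier_vec m}"
  by (simp_all add: SV_def)

text \<open>A linear relation contains the zero pair, so domain and range are nonempty and
  \<open>the_elem\<close> is applied to singletons.\<close>

lemma SV_src_tgt:
  assumes "lin_rel n m S"
  shows "src SV S = n" "tgt SV S = m"
proof -
  have sub: "S \<subseteq> carrier_vec n \<times> carrier_vec m" and zero: "(0\<^sub>v n, 0\<^sub>v m) \<in> S"
    using assms by (simp_all add: lin_rel_def)
  have "dim_vec ` Domain S = {n}"
  proof (intro equalityI subsetI)
    fix k assume "k \<in> {n}"
    then show "k \<in> dim_vec ` Domain S"
      using zero by (intro image_eqI [of _ _ "0\<^sub>v n"]) auto
  qed (use sub in auto)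
  moreover have "dim_vec ` Range S = {m}"
  proof (intro equalityI subsetI)
    fix k assume "k \<in> {m}"
    then show "k \<in> dim_vec ` Range S"
      using zero by (intro image_eqI [of _ _ "0\<^sub>v m"]) auto
  qed (use sub in auto)
  ultimately show "src SV S = n" "tgt SV S = m"
    by (simp_all add: SV_def)
qed

text \<open>In the first equation both sides are the graph of \<open>A\<close>, in the second its
  converse. These are the commuting conditions of the square on generators.\<close>

lemma span_rel_iota:
  fixes A :: "'a::idom mat"
  shows "span_rel (1\<^sub>m (dim_col A)) A = cospan_rel A (1\<^sub>m (dim_row A))"
    and "span_rel A (1\<^sub>m (dim_col A)) = cospan_rel (1\<^sub>m (dim_row A)) A"
  unfolding span_rel_def cospan_rel_def to_fract.mat_hom_one
  by (auto intro: carrier_vecI) (metis one_mult_mat_vec)+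

section \<open>The square over a principal ideal domain\<close>

context
  assumes pid: "principal_ideals TYPE('a::idom)"
begin

interpretation M: span_prop "Mat :: 'a mat prop_data"
  by (rule Mat_span_prop [OF pid])

interpretation opM: span_prop "op_prop (Mat :: 'a mat prop_data)"
  by (rule op_Mat_span_prop [OF pid])

lemma Phi_morphism: "prop_morphism (Span (Mat :: 'a mat prop_data)) SV Phi"
proof (rule prop_morphismI)
  fix n m
  show "Phi (idn (Span (Mat :: 'a mat prop_data)) n) = idn SV n"
    by (simp add: M.Span_idn Phi_span_cls span_rel_one SV_simps)
  show "Phi (swp (Span (Mat :: 'a mat prop_data)) n m) = swp SV n m"
    by (simp add: M.Span_swp Phi_span_cls span_rel_swap SV_simps)
next
  fix S assume "S \<in> arr (Span (Mat :: 'a mat prop_data))"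
  then obtain A B :: "'a mat" where S: "dim_col A = dim_col B" "S = span_cls Mat A B"
    by (auto elim: M.Span_arrE)
  then show "Phi S \<in> arr SV" "src SV (Phi S) = src (Span Mat) S" "tgt SV (Phi S) = tgt (Span Mat) S"
    using span_rel_lin_rel [OF S(1)] SV_src_tgt [OF span_rel_lin_rel [OF S(1)]]
    by (auto simp: Phi_span_cls M.Span_src M.Span_tgt SV_simps(1))
  fix T assume "T \<in> arr (Span (Mat :: 'a mat prop_data))"
  then obtain A' B' :: "'a mat" where T: "dim_col A' = dim_col B'" "T = span_cls Mat A' B'"
    by (auto elim: M.Span_arrE)
  show "Phi (tns (Span Mat) S T) = tns SV (Phi S) (Phi T)"
    using S T by (simp add: M.Span_tns Phi_span_cls span_rel_dsum SV_simps)
  assume "tgt (Span Mat) S = src (Span Mat) T"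
  then have dim: "dim_row B = dim_row A'"
    using S T by (simp add: M.Span_src M.Span_tgt)
  then obtain p q where pb: "pullback_sq Mat B A' p q"
    using M.pullback_ex [of B A'] by auto
  show "Phi (seq (Span Mat) S T) = seq SV (Phi S) (Phi T)"
    using S T span_rel_seq [OF S(1) T(1) dim pb] M.Span_seq [OF _ _ _ _ _ _ pb, of A B'] M.pullback_sqD [OF pb]
    by (simp add: Phi_span_cls SV_simps)
qed

text \<open>Serves three purposes: the PROP laws of \<open>SV\<close>, the construction of the
  mediating morphism, and its uniqueness.\<close>

lemma Phi_surj: "arr SV = Phi ` arr (Span (Mat :: 'a mat prop_data))"
proof (intro equalityI subsetI)
  fix S :: "('a fract vec \<times> 'a fract vec) set" assume "S \<in> arr SV"
  then obtain n m where "lin_rel n m S"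
    by (auto simp: SV_simps)
  then obtain A B where "dim_col A = dim_col B" "S = span_rel A B"
    by (metis span_rel_surj)
  then show "S \<in> Phi ` arr (Span (Mat :: 'a mat prop_data))"
    by (intro image_eqI [of _ _ "span_cls Mat A B"]) (simp_all add: Phi_span_cls M.Span_arrI)
qed (auto simp: prop_morphismD(1) [OF Phi_morphism])

lemma SV_is_prop: "is_prop (SV :: ('a fract vec \<times> 'a fract vec) set prop_data)"
  by (rule is_prop_image [OF M.Span_is_prop Phi_morphism Phi_surj])

lemma pullback_of_cospan:
  fixes A B :: "'a mat"
  assumes "dim_row A = dim_row B"
  obtains p q where "pullback_sq Mat A B p q" "dim_col q = dim_col p" "span_rel p q = cospan_rel A B"
  using M.pullback_ex [of A B] M.pullback_sqD(3) [of A B] span_rel_pullback [OF assms] assms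
  by auto

text \<open>Linearity is inherited from the relation of the pullback span.\<close>

lemma cospan_rel_lin_rel:
  fixes A B :: "'a mat"
  assumes "dim_row A = dim_row B"
  shows "lin_rel (dim_col A) (dim_col B) (cospan_rel A B)"
proof -
  obtain p q where pb: "pullback_sq Mat A B p q" "dim_col q = dim_col p" "span_rel p q = cospan_rel A B"
    using assms by (rule pullback_of_cospan)
  then show ?thesis
    using span_rel_lin_rel [of p q] M.pullback_sqD [OF pb(1)] by simp
qed

lemma Psi_morphism: "prop_morphism (Cospan (Mat :: 'a mat prop_data)) SV Psi"
  unfolding M.Cospan_op
proof (rule prop_morphismI)
  fix n m
  show "Psi (idn (Span (op_prop (Mat :: 'a mat prop_data))) n) = idn SV n"
    by (simp add: opM.Span_idn Psi_cospan_cls cospan_rel_one SV_simps op_prop_simps)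
  show "Psi (swp (Span (op_prop (Mat :: 'a mat prop_data))) n m) = swp SV n m"
    by (simp add: opM.Span_swp Psi_cospan_cls cospan_rel_swap SV_simps op_prop_simps)
next
  fix S assume "S \<in> arr (Span (op_prop (Mat :: 'a mat prop_data)))"
  then obtain A B :: "'a mat" where S: "dim_row A = dim_row B" "S = span_cls (op_prop Mat) A B"
    by (auto elim: opM.Span_arrE simp: op_prop_simps)
  then show "Psi S \<in> arr SV" "src SV (Psi S) = src (Span (op_prop Mat)) S" "tgt SV (Psi S) = tgt (Span (op_prop Mat)) S"
    using cospan_rel_lin_rel [OF S(1)] SV_src_tgt [OF cospan_rel_lin_rel [OF S(1)]]
    by (auto simp: Psi_cospan_cls opM.Span_src opM.Span_tgt SV_simps(1) op_prop_simps)
  fix T assume "T \<in> arr (Span (op_prop (Mat :: 'a mat prop_data)))"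
  then obtain A' B' :: "'a mat" where T: "dim_row A' = dim_row B'" "T = span_cls (op_prop Mat) A' B'"
    by (auto elim: opM.Span_arrE simp: op_prop_simps)
  show "Psi (tns (Span (op_prop Mat)) S T) = tns SV (Psi S) (Psi T)"
    using S T by (simp add: opM.Span_tns Psi_cospan_cls cospan_rel_dsum SV_simps op_prop_simps)
  assume "tgt (Span (op_prop Mat)) S = src (Span (op_prop Mat)) T"
  then have dim: "dim_col B = dim_col A'"
    using S T by (simp add: opM.Span_src opM.Span_tgt op_prop_simps)
  then obtain p q where po: "pullback_sq (op_prop Mat) B A' p q"
    using opM.pullback_ex [of B A'] by (auto simp: op_prop_simps)
  show "Psi (seq (Span (op_prop Mat)) S T) = seq SV (Psi S) (Psi T)"
    using S T cospan_rel_seq [OF S(1) T(1) dim po] opM.Span_seq [OF _ _ _ _ _ _ po, of A B']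
      opM.pullback_sqD [OF po]
    by (simp add: Psi_cospan_cls SV_simps op_prop_simps)
qed

lemma Cospan_is_prop: "is_prop (Cospan (Mat :: 'a mat prop_data))"
  unfolding M.Cospan_op by (rule opM.Span_is_prop)

lemma iota1_morphism: "prop_morphism Mat (Cospan (Mat :: 'a mat prop_data)) (iota1 Mat)"
  using opM.kappa2_morphism unfolding M.Cospan_op M.op_op M.iota_op [abs_def] .

lemma iota2_morphism: "prop_morphism (op_prop Mat) (Cospan (Mat :: 'a mat prop_data)) (iota2 Mat)"
  using opM.kappa1_morphism unfolding M.Cospan_op M.iota_op [abs_def] .

section \<open>Cocones on the square\<close>

text \<open>Apart from the sizes, \<open>vec_pullback\<close> sees \<open>f\<close> and
  \<open>g\<close> only through which pairs of vectors over the ring they send to the same vector.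
  As the ring embeds into its fractions, \<open>cospan_rel\<close> decides this, even when the
  apexes of the two cospans differ.\<close>

lemma pullback_cospan_rel_cong:
  fixes f g :: "'a mat"
  assumes dim: "dim_row f = dim_row g" "dim_row f' = dim_row g'" "dim_col f' = dim_col f" "dim_col g' = dim_col g"
    and eq: "cospan_rel f g = cospan_rel f' g'" and pb: "pullback_sq Mat f g p q"
  shows "pullback_sq Mat f' g' p q"
proof -
  have *: "f *\<^sub>v x = g *\<^sub>v y \<longleftrightarrow> (fract_vec x, fract_vec y) \<in> cospan_rel f g"
    if "dim_row f = dim_row g" "x \<in> carrier_vec (dim_col f)" "y \<in> carrier_vec (dim_col g)" for f g :: "'a mat" and x y
    using that by (auto simp: cospan_rel_def fract_mat_mult_vec dest: to_fract.vec_hom_inj)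
  have **: "f' *\<^sub>v x = g' *\<^sub>v y \<longleftrightarrow> f *\<^sub>v x = g *\<^sub>v y"
    if "x \<in> carrier_vec (dim_col f)" "y \<in> carrier_vec (dim_col g)" for x y
    using that dim eq * [of f g x y] * [of f' g' x y] by simp
  show ?thesis
    using pb unfolding pullback_Mat_iff [OF dim(1)] pullback_Mat_iff [OF dim(2)] vec_pullback_def dim(3,4)
    by (auto simp: **)
qed

text \<open>The cocone condition is stated on the generators, so that no terms of the coproduct
  occur in the argument.\<close>

context
  fixes X :: "'x prop_data" and F G
  assumes F: "prop_morphism (Span (Mat :: 'a mat prop_data)) X F"
    and G: "prop_morphism (Cospan (Mat :: 'a mat prop_data)) X G"
    and agree: "\<And>f. F (kappa1 Mat f) = G (iota1 Mat f)" "\<And>f. F (kappa2 Mat f) = G (iota2 Mat f)"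
begin

text \<open>The cospan is assembled from \<open>iota1\<close> and \<open>iota2\<close>;
  \<open>agree\<close> replaces these by \<open>kappa1\<close> and \<open>kappa2\<close>, whose
  composite in this order is the pullback.\<close>

lemma cocone_pullback:
  fixes A B :: "'a mat"
  assumes "dim_row A = dim_row B" "pullback_sq Mat A B p q"
  shows "G (span_cls (op_prop Mat) A B) = F (span_cls Mat p q)"
proof -
  have "span_cls (op_prop Mat) A B = seq (Cospan Mat) (iota1 Mat A) (iota2 Mat B)"
    using opM.span_cls_decompose [of A B] assms by (simp add: M.Cospan_op M.iota_op op_prop_simps)
  then have "G (span_cls (op_prop Mat) A B) = seq X (G (iota1 Mat A)) (G (iota2 Mat B))"
    using prop_morphismD(5) [OF G] prop_morphismD [OF iota1_morphism] prop_morphismD [OF iota2_morphism] assms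
    by (simp add: op_prop_simps)
  also have "\<dots> = F (seq (Span Mat) (kappa1 Mat A) (kappa2 Mat B))"
    using prop_morphismD(5) [OF F] M.kappa_arr assms by (simp flip: agree)
  also have "\<dots> = F (span_cls Mat p q)"
    using M.kappa_seq [OF _ _ _ assms(2)] assms(1) by simp
  finally show ?thesis .
qed

text \<open>Dually, the span is assembled from \<open>kappa2\<close> and \<open>kappa1\<close>, and
  the corresponding composite of \<open>iota2\<close> and \<open>iota1\<close> is the
  pushout.\<close>

lemma cocone_pushout:
  fixes A B :: "'a mat"
  assumes "dim_col A = dim_col B" "pullback_sq (op_prop Mat) A B p q"
  shows "F (span_cls Mat A B) = G (span_cls (op_prop Mat) p q)"
proof -
  have "F (span_cls Mat A B) = seq X (F (kappa2 Mat A)) (F (kappa1 Mat B))"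
    using prop_morphismD(5) [OF F] M.kappa_arr assms by (simp flip: M.span_cls_decompose)
  also have "\<dots> = G (seq (Cospan Mat) (iota2 Mat A) (iota1 Mat B))"
    using prop_morphismD(5) [OF G] prop_morphismD [OF iota1_morphism] prop_morphismD [OF iota2_morphism] assms
    by (simp add: op_prop_simps agree)
  also have "\<dots> = G (span_cls (op_prop Mat) p q)"
    using opM.kappa_seq [OF _ _ _ assms(2)] assms(1) by (simp add: M.Cospan_op M.iota_op op_prop_simps)
  finally show ?thesis .
qed

lemma cocone_kernel:
  assumes "S \<in> arr (Span (Mat :: 'a mat prop_data))" "T \<in> arr (Span (Mat :: 'a mat prop_data))"
    and eq: "Phi S = Phi T"
  shows "F S = F T"
proof -
  obtain A B :: "'a mat" where S: "dim_col A = dim_col B" "S = span_cls Mat A B"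
    using assms(1) by (auto elim: M.Span_arrE)
  obtain A' B' :: "'a mat" where T: "dim_col A' = dim_col B'" "T = span_cls Mat A' B'"
    using assms(2) by (auto elim: M.Span_arrE)
  have rel: "span_rel A B = span_rel A' B'"
    using eq S T by (simp add: Phi_span_cls)
  have dim: "dim_row A' = dim_row A" "dim_row B' = dim_row B"
    using SV_src_tgt [OF span_rel_lin_rel [OF S(1)]] SV_src_tgt [OF span_rel_lin_rel [OF T(1)]] rel by simp_all
  obtain p q where po: "pullback_sq (op_prop Mat) A B p q"
    using opM.pullback_ex [of A B] S by (auto simp: op_prop_simps)
  obtain p' q' where po': "pullback_sq (op_prop Mat) A' B' p' q'"
    using opM.pullback_ex [of A' B'] T by (auto simp: op_prop_simps)
  note D = opM.pullback_sqD [OF po, unfolded op_prop_simps, simplified]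
  note D' = opM.pullback_sqD [OF po', unfolded op_prop_simps, simplified]
  obtain r s where pb: "pullback_sq Mat p q r s"
    using M.pullback_ex [of p q] D by auto
  have "cospan_rel p q = cospan_rel p' q'"
    using cospan_rel_pushout [OF S(1) po] cospan_rel_pushout [OF T(1) po'] rel by simp
  \<comment> \<open>No isomorphism between the two pushouts is constructed: having the same
    relation, they admit the same pullback \<open>(r, s)\<close>.\<close>
  then have pb': "pullback_sq Mat p' q' r s"
    using D D' dim by (intro pullback_cospan_rel_cong [OF _ _ _ _ _ pb]) simp_all
  have "F S = F (span_cls Mat r s)"
    unfolding S(2) cocone_pushout [OF S(1) po] by (rule cocone_pullback [OF _ pb]) (use D in simp)
  also have "\<dots> = F T"
    unfolding T(2) cocone_pushout [OF T(1) po'] by (rule cocone_pullback [OF _ pb', symmetric]) (use D' in simp)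
  finally show ?thesis .
qed

text \<open>\<open>H\<close> is built from \<open>F\<close> alone. Its compatibility with
  \<open>G\<close> follows because a cospan and its pullback span have the same relation, while
  \<open>cocone_pullback\<close> equates their images in \<open>X\<close>.\<close>

lemma cocone_factor:
  obtains H where "prop_morphism SV X H" "\<forall>c\<in>arr (Span (Mat :: 'a mat prop_data)). H (Phi c) = F c"
    "\<forall>c\<in>arr (Cospan (Mat :: 'a mat prop_data)). H (Psi c) = G c"
proof -
  obtain H where H: "prop_morphism SV X H" "\<forall>c\<in>arr (Span (Mat :: 'a mat prop_data)). H (Phi c) = F c"
    using prop_morphism_factor [OF M.Span_is_prop Phi_morphism Phi_surj F cocone_kernel] .
  have "H (Psi c) = G c" if arr: "c \<in> arr (Cospan (Mat :: 'a mat prop_data))" for c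
  proof -
    obtain A B :: "'a mat" where "src (op_prop Mat) A = src (op_prop Mat) B"
      and c: "c = span_cls (op_prop Mat) A B"
      using arr unfolding M.Cospan_op by (rule opM.Span_arrE)
    then have dim: "dim_row A = dim_row B"
      by (simp add: op_prop_simps)
    obtain p q where pb: "pullback_sq Mat A B p q" "dim_col q = dim_col p" "span_rel p q = cospan_rel A B"
      using dim by (rule pullback_of_cospan)
    have "Psi c = Phi (span_cls Mat p q)"
      using c dim pb by (simp add: Psi_cospan_cls Phi_span_cls)
    then show ?thesis
      using H(2) pb(2) cocone_pullback [OF dim pb(1)] c by (simp add: M.Span_arrI)
  qed
  with H that show ?thesis by blast
qed

end

text \<open>Both paths are morphisms out of the coproduct that agree on the two injections, so both
  equal the same copairing into \<open>SV\<close>.\<close>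

lemma span_cospan_square:
  assumes "f \<in> arr (coprod (Mat :: 'a mat prop_data) (op_prop Mat))"
  shows "Phi (copair (Span Mat) (kappa1 Mat) (kappa2 Mat) f) =
    Psi (copair (Cospan Mat) (iota1 Mat) (iota2 Mat) f)"
proof -
  note U = coprod_universal [OF M.is_prop_axioms opM.is_prop_axioms]
  note K = U(4) [OF M.Span_is_prop M.kappa1_morphism M.kappa2_morphism]
  note I = U(4) [OF Cospan_is_prop iota1_morphism iota2_morphism]
  have eq1: "Phi (kappa1 Mat A) = Psi (iota1 Mat A)" for A :: "'a mat"
    by (simp add: kappa1_def iota1_def M.cospan_cls_op Phi_span_cls Psi_cospan_cls span_rel_iota)
  have eq2: "Phi (kappa2 Mat A) = Psi (iota2 Mat A)" for A :: "'a mat"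
    by (simp add: kappa2_def iota2_def M.cospan_cls_op Phi_span_cls Psi_cospan_cls span_rel_iota)
  note M1 = prop_morphism_comp [OF M.kappa1_morphism Phi_morphism]
  note M2 = prop_morphism_comp [OF M.kappa2_morphism Phi_morphism]
  have "Phi (copair (Span Mat) (kappa1 Mat) (kappa2 Mat) f) =
      copair SV (\<lambda>A. Phi (kappa1 Mat A)) (\<lambda>A. Phi (kappa2 Mat A)) f"
    by (rule U(5) [OF SV_is_prop M1 M2 prop_morphism_comp [OF conjunct1 [OF K] Phi_morphism] _ _ assms])
      (use K in simp_all)
  also have "\<dots> = Psi (copair (Cospan Mat) (iota1 Mat) (iota2 Mat) f)"
    by (rule U(5) [OF SV_is_prop M1 M2 prop_morphism_comp [OF conjunct1 [OF I] Psi_morphism] _ _ assms, symmetric])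
      (use I in \<open>simp_all add: eq1 eq2\<close>)
  finally show ?thesis .
qed

end

theorem theorem6p15:
  assumes "principal_domain (class_ring :: 'r::idom ring)"
  shows "prop_pushout TYPE('x)
    (coprod (Mat :: 'r mat prop_data) (op_prop Mat)) (Span Mat) (Cospan Mat)
    (SV :: ('r fract vec \<times> 'r fract vec) set prop_data)
    (copair (Span Mat) (kappa1 Mat) (kappa2 Mat)) (copair (Cospan Mat) (iota1 Mat) (iota2 Mat))
    Phi Psi"
proof -
  note pid = principal_ideals_domain [OF assms]
  interpret M: span_prop "Mat :: 'r mat prop_data"
    by (rule Mat_span_prop [OF pid])
  note op = M.op_is_prop
  note U = coprod_universal [OF M.is_prop_axioms op]
  note K = U(4) [OF M.Span_is_prop M.kappa1_morphism M.kappa2_morphism]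
  note I = U(4) [OF Cospan_is_prop [OF pid] iota1_morphism [OF pid] iota2_morphism [OF pid]]
  show ?thesis
    unfolding prop_pushout_def
  proof (intro conjI allI impI ballI)
    fix X :: "'x prop_data" and F G
    assume *: "is_prop X \<and> prop_morphism (Span (Mat :: 'r mat prop_data)) X F \<and>
      prop_morphism (Cospan (Mat :: 'r mat prop_data)) X G \<and>
      (\<forall>f\<in>arr (coprod Mat (op_prop Mat)). F (copair (Span Mat) (kappa1 Mat) (kappa2 Mat) f) =
        G (copair (Cospan Mat) (iota1 Mat) (iota2 Mat) f))"
    \<comment> \<open>Evaluating the cocone condition at the two injections of the coproduct
      recovers it on matrices and on reversed matrices.\<close>
    have "F (kappa1 Mat A) = G (iota1 Mat A)" "F (kappa2 Mat A) = G (iota2 Mat A)" for A :: "'r mat"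
    proof -
      have "inl Mat (op_prop Mat) A \<in> arr (coprod Mat (op_prop (Mat :: 'r mat prop_data)))"
        "inr Mat (op_prop Mat) A \<in> arr (coprod (Mat :: 'r mat prop_data) (op_prop Mat))"
        using prop_morphismD(1) [OF U(2), of A] prop_morphismD(1) [OF U(3), of A] by (simp_all add: op_prop_simps)
      with * show "F (kappa1 Mat A) = G (iota1 Mat A)" "F (kappa2 Mat A) = G (iota2 Mat A)"
        using K I by (metis Mat_simps(1) UNIV_I op_prop_simps(1))+
    qed
    then obtain H where H: "prop_morphism SV X H" "\<forall>f\<in>arr (Span (Mat :: 'r mat prop_data)). H (Phi f) = F f"
      "\<forall>f\<in>arr (Cospan (Mat :: 'r mat prop_data)). H (Psi f) = G f"
      using cocone_factor [OF pid, of X F G] * by blast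
    \<comment> \<open>Every arrow of \<open>SV\<close> is a value of \<open>Phi\<close>, so the
      condition on spans already determines the mediating morphism.\<close>
    have "H' f = H f" if "\<forall>c\<in>arr (Span (Mat :: 'r mat prop_data)). H' (Phi c) = F c" "f \<in> arr SV" for H' f
      using that H(2) unfolding Phi_surj [OF pid] by auto
    with H show "\<exists>H. prop_morphism SV X H \<and> (\<forall>f\<in>arr (Span (Mat :: 'r mat prop_data)). H (Phi f) = F f) \<and>
        (\<forall>f\<in>arr (Cospan (Mat :: 'r mat prop_data)). H (Psi f) = G f) \<and>
        (\<forall>H'. prop_morphism SV X H' \<and> (\<forall>f\<in>arr (Span (Mat :: 'r mat prop_data)). H' (Phi f) = F f) \<and>
          (\<forall>f\<in>arr (Cospan (Mat :: 'r mat prop_data)). H' (Psi f) = G f) \<longrightarrow> (\<forall>f\<in>arr SV. H' f = H f))"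
      by blast
  qed (use K I U(1) M.Span_is_prop Cospan_is_prop [OF pid] SV_is_prop [OF pid] Phi_morphism [OF pid]
      Psi_morphism [OF pid] span_cospan_square [OF pid] in blast)+
qed

end
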